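(* Let $H$ be an open subgroup of $G$, and for each prime $p$ let $x_p\in\mathbb Q$. Then there exists a consistent map $c\in\mathcal J^*$ such that (i) $c(\mathbb Q,p)=x_p$ for every prime $p$, and (ii) $\mathrm{Stab}_G(\Phi_c)=H$. Moreover, if $\{x_p/\log p: p\text{ prime}\}$ is bounded, then there exists $c\in\mathcal J'$ satisfying (i) and (ii).
   Context: Let $\overline{\mathbb Q}$ be an algebraic closure of $\mathbb Q$, $A$ the ring of algebraic integers, $\mathcal S=\overline{\mathbb Q}^\times/A^\times$ (a $\mathbb Q$-vector space, written multiplicatively with scalar action $\alpha\mapsto\alpha^r$). $G=\mathrm{Gal}(\overline{\mathbb Q}/\mathbb Q)$ with the Krull topology; it acts on $\mathcal S$, hence on linear maps $\Phi:\mathcal S\to\mathbb Q$ by $\Phi\mapsto\Phi\circ\sigma$, and $\mathrm{Stab}_G(\Phi)=\{\sigma\in G:\Phi\circ\sigma=\Phi\}$. For a number field $K$ and non-Archimedean place $v$ of $K$, $p_v$ is the prime below $v$, $K_v$ the completion, and $\|\cdot\|_v$ the extension to $K_v$ of the $p_v$-adic absolute value. Let $\mathcal H_K$ be the image of $K^\times$ in $\mathcal S$, $\mathcal S_K=\{\alpha:\alpha^n\in\mathcal H_K\text{ for some }n\in\mathbb N\}$, $\|\alpha\|_v=\|\alpha^n\|_v^{1/n}$ when $\alpha^n\in\mathcal H_K$. Let $\mathcal J$ be the set of pairs $(K,v)$, $K$ a number field, $v$ a non-Archimedean place of $K$. A map $c:\mathcal J\to\mathbb Q$ is consistent if $c(K,v)=\sum_{w\mid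 v}c(L,w)$ for all number fields $K$, finite extensions $L/K$ and non-Archimedean $v$ of $K$; $\mathcal J^*$ is the set of consistent maps. For $c\in\mathcal J^*$, $\Phi_c(\alpha)=\sum_v\frac{c(K,v)}{\log p_v}\log\|\alpha\|_v$ over non-Archimedean places of any number field $K$ with $\alpha\in\mathcal S_K$. $\mathcal J'$ is the set of $c\in\mathcal J^*$ for which $\frac{[K:\mathbb Q]}{[K_v:\mathbb Q_{p_v}]}\cdot\frac{c(K,v)}{\log p_v}$ is bounded over $(K,v)\in\mathcal J$. *)

theory Defs
  imports "HOL-Algebra.Group" "HOL-Analysis.Infinite_Sum"
    "HOL-Computational_Algebra.Polynomial" "HOL-Computational_Algebra.Primes"
begin

definition Qbar :: "complex set" where
  "Qbar = {z. algebraic z}"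

definition algebraic_integer :: "complex \<Rightarrow> bool" where
  "algebraic_integer z \<longleftrightarrow>
     (\<exists>p :: complex poly. (\<forall>i. coeff p i \<in> \<int>) \<and> lead_coeff p = 1 \<and> poly p z = 0)"

definition alg_int_unit :: "complex \<Rightarrow> bool" where
  "alg_int_unit z \<longleftrightarrow> z \<noteq> 0 \<and> algebraic_integer z \<and> algebraic_integer (inverse z)"

definition Gal :: "(complex \<Rightarrow> complex) set" where
  "Gal = {\<sigma>. bij_betw \<sigma> Qbar Qbar
          \<and> (\<forall>a\<in>Qbar. \<forall>b\<in>Qbar. \<sigma> (a + b) = \<sigma> a + \<sigma> b \<and> \<sigma> (a * b) = \<sigma> a * \<sigma> b)
          \<and> \<sigma> 1 = 1
          \<and> (\<forall>z. z \<notin> Qbar \<longrightarrow> \<sigma> z = z)}"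

definition Gal_group :: "(complex \<Rightarrow> complex) monoid" where
  "Gal_group = \<lparr>carrier = Gal, monoid.mult = (\<lambda>\<sigma> \<tau>. \<sigma> \<circ> \<tau>), monoid.one = id\<rparr>"

definition krull_open :: "(complex \<Rightarrow> complex) set \<Rightarrow> bool" where
  "krull_open U \<longleftrightarrow> U \<subseteq> Gal \<and>
     (\<forall>\<sigma>\<in>U. \<exists>F. finite F \<and> F \<subseteq> Qbar \<and> {\<tau>\<in>Gal. \<forall>a\<in>F. \<tau> a = \<sigma> a} \<subseteq> U)"

definition rat_span :: "complex set \<Rightarrow> complex set" where
  "rat_span B = {z. \<exists>q :: complex \<Rightarrow> rat. z = (\<Sum>b\<in>B. of_rat (q b) * b)}"

definition number_field :: "complex set \<Rightarrow> bool" where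
  "number_field K \<longleftrightarrow> K \<subseteq> Qbar \<and> 0 \<in> K \<and> 1 \<in> K
     \<and> (\<forall>a\<in>K. \<forall>b\<in>K. a + b \<in> K \<and> a - b \<in> K \<and> a * b \<in> K)
     \<and> (\<forall>a\<in>K. a \<noteq> 0 \<longrightarrow> inverse a \<in> K)
     \<and> (\<exists>B. finite B \<and> B \<subseteq> K \<and> K = rat_span B)"

definition nf_degree :: "complex set \<Rightarrow> nat" where
  "nf_degree K = (LEAST n. \<exists>B. finite B \<and> card B = n \<and> B \<subseteq> K \<and> K = rat_span B)"

definition padic_abs :: "nat \<Rightarrow> rat \<Rightarrow> real" where
  "padic_abs p q = (if q = 0 then 0 else
     (case quotient_of q of (a, b) \<Rightarrow>
        real p powr (real (multiplicity (int p) b) - real (multiplicity (int p) a))))"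

text \<open>A non-Archimedean place v of K is represented by its normalised absolute value
  (the unique one in its class extending the p_v-adic absolute value on Q), set to 0 outside K.\<close>
definition nonarch_place :: "complex set \<Rightarrow> (complex \<Rightarrow> real) \<Rightarrow> bool" where
  "nonarch_place K v \<longleftrightarrow>
     (\<forall>z. z \<notin> K \<longrightarrow> v z = 0) \<and> v 0 = 0 \<and> (\<forall>z\<in>K - {0}. v z > 0)
     \<and> (\<forall>a\<in>K. \<forall>b\<in>K. v (a * b) = v a * v b \<and> v (a + b) \<le> max (v a) (v b))
     \<and> (\<exists>p. prime p \<and> (\<forall>q. v (of_rat q) = padic_abs p q))"

definition place_prime :: "(complex \<Rightarrow> real) \<Rightarrow> nat" where
  "place_prime v = (THE p. prime p \<and> (\<forall>q. v (of_rat q) = padic_abs p q))"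

definition rat_place :: "nat \<Rightarrow> complex \<Rightarrow> real" where
  "rat_place p = (\<lambda>z. if z \<in> \<rat> then padic_abs p (THE q. z = of_rat q) else 0)"

definition v_cauchy :: "complex set \<Rightarrow> (complex \<Rightarrow> real) \<Rightarrow> (nat \<Rightarrow> complex) \<Rightarrow> bool" where
  "v_cauchy K v f \<longleftrightarrow> (\<forall>n. f n \<in> K) \<and>
     (\<forall>\<epsilon>>0. \<exists>N. \<forall>m\<ge>N. \<forall>n\<ge>N. v (f m - f n) < \<epsilon>)"

definition v_null :: "(complex \<Rightarrow> real) \<Rightarrow> (nat \<Rightarrow> complex) \<Rightarrow> bool" where
  "v_null v f \<longleftrightarrow> (\<lambda>n. v (f n)) \<longlonglongrightarrow> 0"

text \<open>K_v = Cauchy sequences in K modulo null sequences; Q_p sits inside as classes of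
  Cauchy sequences of rationals. [K_v:Q_p] is the minimal size of a Q_p-spanning family.\<close>
definition local_degree :: "complex set \<Rightarrow> (complex \<Rightarrow> real) \<Rightarrow> nat" where
  "local_degree K v = (LEAST d. \<exists>b :: nat \<Rightarrow> nat \<Rightarrow> complex.
      (\<forall>i<d. v_cauchy K v (b i)) \<and>
      (\<forall>f. v_cauchy K v f \<longrightarrow>
         (\<exists>a :: nat \<Rightarrow> nat \<Rightarrow> rat. (\<forall>i<d. v_cauchy K v (\<lambda>n. of_rat (a i n))) \<and>
             v_null v (\<lambda>n. f n - (\<Sum>i<d. of_rat (a i n) * b i n)))))"

type_synonym cmap = "complex set \<Rightarrow> (complex \<Rightarrow> real) \<Rightarrow> real"

definition consistent_maps :: "cmap set" where
  "consistent_maps = {c.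
     (\<forall>K v. number_field K \<and> nonarch_place K v \<longrightarrow> c K v \<in> \<rat>) \<and>
     (\<forall>K L v. number_field K \<and> number_field L \<and> K \<subseteq> L \<and> nonarch_place K v \<longrightarrow>
        c K v = (\<Sum>w\<in>{w. nonarch_place L w \<and> (\<forall>z\<in>K. w z = v z)}. c L w))}"

definition bounded_maps :: "cmap set" where
  "bounded_maps = {c \<in> consistent_maps. \<exists>B. \<forall>K v. number_field K \<and> nonarch_place K v \<longrightarrow>
      \<bar>real (nf_degree K) / real (local_degree K v) * (c K v / ln (real (place_prime v)))\<bar> \<le> B}"

text \<open>\<Phi>_c(\<alpha>) for nonzero algebraic \<alpha>: choose a number field K, n \<ge> 1 and \<beta> \<in> K^\<times> with
  \<alpha>^n \<equiv> \<beta> modulo units of A, so that \<parallel>\<alpha>\<parallel>_v = \<parallel>\<beta>\<parallel>_v^(1/n).\<close>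
definition Phi :: "cmap \<Rightarrow> complex \<Rightarrow> real" where
  "Phi c \<alpha> = (case (SOME (K, n, \<beta>). number_field K \<and> n \<ge> 1 \<and> \<beta> \<in> K - {0}
                        \<and> alg_int_unit (\<alpha> ^ n / \<beta>)) of (K, n, \<beta>) \<Rightarrow>
      infsum (\<lambda>v. c K v / ln (real (place_prime v)) * ln (v \<beta> powr (1 / real n)))
             {v. nonarch_place K v})"

definition Stab :: "(complex \<Rightarrow> real) \<Rightarrow> (complex \<Rightarrow> complex) set" where
  "Stab \<Phi> = {\<sigma>\<in>Gal. \<forall>\<alpha>\<in>Qbar - {0}. \<Phi> (\<sigma> \<alpha>) = \<Phi> \<alpha>}"

end

theory Submission
  imports Defs "HOL-Computational_Algebra.Fundamental_Theorem_Algebra"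
begin

text \<open>Fix for every prime \<open>p\<close> an extension \<open>N p\<close> of the \<open>p\<close>-adic absolute value to \<open>Qbar\<close>. All places of a
  number field above \<open>p\<close> have the form \<open>N p \<circ> \<sigma>\<close> with \<open>\<sigma>\<close> in the Galois group \<open>G\<close>, so a locally constant rational
  density \<open>g p\<close> on \<open>G\<close> defines a consistent map: \<open>c K v\<close> is the integral of \<open>g p\<close> over those \<open>\<sigma>\<close> for which
  \<open>N p \<circ> \<sigma>\<close> restricts to \<open>v\<close>. Integrals of locally constant functions are finite averages, and
  \<open>\<Phi>_c(\<alpha>)\<close> becomes the sum over \<open>p\<close> of the average of \<open>g p \<sigma> * ln (N p (\<sigma> \<alpha>)) / ln p\<close>.

  Write \<open>H\<close> as the stabilizer of some \<open>\<theta>\<close>, and choose a prime \<open>p0\<close>, an integer \<open>m\<close> and \<open>N p0\<close> such that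
  \<open>\<theta> - m\<close> is a non-unit while \<open>\<theta>' - m\<close> is a unit for all other conjugates \<open>\<theta>'\<close>. Take \<open>g p = x p\<close>, modified
  at \<open>p0\<close> by the indicator function of \<open>H\<close> minus its mean. Invariance under \<open>H\<close> is clear, and \<open>\<alpha> = \<theta> - m\<close> detects every
  element outside \<open>H\<close>. The same map is bounded because the degree \<open>[K_v : Q_p]\<close> is at least the number of embeddings
  of \<open>K\<close> inducing \<open>v\<close>.\<close>

section \<open>Algebraic numbers and extension of embeddings\<close>

text \<open>A density that is constant on the Galois group yields a functional invariant under the
  whole group, because averaging is invariant under right translation. So the numbers
  \<open>x p\<close> alone cannot single out H; only the deviation from a constant can, and one
  prime suffices for it. Subtracting the mean keeps the value at the rational place equal to
  \<open>x p\<close>, and a change at a single prime does not affect boundedness.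

  Isolation is tailored to this deviation: for \<rho> outside H and \<sigma> in H the conjugate
  \<open>\<sigma> (\<rho> \<theta>)\<close> differs from \<theta>, so every logarithm averaged over
  H for \<open>\<rho> (\<theta> - m)\<close> vanishes, while for \<open>\<theta> - m\<close> itself
  each of them is the same negative number. No cancellation can hide the difference.

  The number theory is kept elementary: places of \<open>Qbar\<close> come from maximal subrings,
  integrals from counting restrictions to finite sets, and the degree estimate from two one-sided
  inequalities. Completions enter only through approximation by elements of K.\<close>

interpretation rvs: vector_space "\<lambda>(q::rat) (z::complex). of_rat q * z"
  by unfold_locales (simp_all add: algebra_simps of_rat_add of_rat_mult)

section \<open>Linear algebra over the rationals and closure properties of algebraic numbers\<close>

lemma rat_span_eq_span: "finite B \<Longrightarrow> rat_span B = rvs.span B"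
  by (auto simp: rat_span_def rvs.span_finite)

text \<open>Indexing by numbers instead of by a set makes a repeated value count as a dependence, so
  no caller has to check that its family is injective.\<close>

lemma rational_dependence:
  fixes f :: "nat \<Rightarrow> complex"
  assumes "finite B" "\<And>i. i < m \<Longrightarrow> f i \<in> rvs.span B" "card B < m"
  shows "\<exists>q :: nat \<Rightarrow> rat. (\<Sum>i<m. of_rat (q i) * f i) = 0 \<and> (\<exists>i<m. q i \<noteq> 0)"
proof (cases "inj_on f {..<m}")
  case True
  have "rvs.dependent (f ` {..<m})"
  proof (rule ccontr)
    assume "\<not> rvs.dependent (f ` {..<m})"
    from rvs.independent_span_bound[OF assms(1) this] assms(2)
    have "card (f ` {..<m}) \<le> card B" by auto
    with True assms(3) show False by (simp add: card_image)
  qed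
  then obtain u where u: "\<exists>v\<in>f ` {..<m}. u v \<noteq> 0" "(\<Sum>v\<in>f ` {..<m}. of_rat (u v) * v) = 0"
    by (subst (asm) rvs.dependent_finite) auto
  show ?thesis
    using u True by (intro exI[of _ "\<lambda>i. u (f i)"]) (auto simp: sum.reindex)
next
  case False
  then obtain i j where ij: "i < m" "j < m" "i \<noteq> j" "f i = f j"
    by (auto simp: inj_on_def)
  define q :: "nat \<Rightarrow> rat" where "q k = (if k = i then 1 else 0) - (if k = j then 1 else 0)" for k
  have "(\<Sum>k<m. of_rat (q k) * f k) = (\<Sum>k<m. if k = i then f k else 0) - (\<Sum>k<m. if k = j then f k else 0)"
    unfolding sum_subtractf[symmetric] by (intro sum.cong) (auto simp: q_def)
  also have "\<dots> = 0" using ij by simp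
  finally show ?thesis using ij by (intro exI[of _ q]) (auto simp: q_def intro!: exI[of _ i])
qed

lemma algebraic_if_powers_in_span:
  assumes "finite B" "\<And>n. x ^ n \<in> rvs.span B"
  shows "algebraic x"
proof -
  let ?m = "Suc (card B)"
  obtain q :: "nat \<Rightarrow> rat" and i where q: "(\<Sum>i<?m. of_rat (q i) * x ^ i) = 0" "i < ?m" "q i \<noteq> 0"
    using rational_dependence[of B ?m "\<lambda>i. x ^ i"] assms by auto
  define p where "p = (\<Sum>i<?m. monom (of_rat (q i) :: complex) i)"
  have c: "coeff p k = (if k < ?m then of_rat (q k) else 0)" for k
    by (simp add: p_def coeff_sum del: sum.lessThan_Suc)
  show ?thesis
  proof (rule algebraicI'[of p])
    show "coeff p k \<in> \<rat>" for k by (simp add: c)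
    show "p \<noteq> 0" using q c[of i] by auto
    show "poly p x = 0" using q(1) by (simp add: p_def poly_sum poly_monom)
  qed
qed

lemma span_mult_closed:
  assumes "\<And>b. b \<in> B \<Longrightarrow> a * b \<in> rvs.span C" "x \<in> rvs.span B"
  shows "a * x \<in> rvs.span C"
  using assms(2)
proof (induction rule: rvs.span_induct_alt)
  case base
  show ?case by (simp add: rvs.span_zero)
next
  case (step c x y)
  have "a * (of_rat c * x + y) = of_rat c * (a * x) + a * y" by (simp add: algebra_simps)
  then show ?case using step assms(1) by (simp add: rvs.span_add rvs.span_scale)
qed

lemma algebraic_power_reduction:
  assumes "algebraic (a :: complex)"
  shows "\<exists>n>0. a ^ n \<in> rvs.span ((\<lambda>i. a ^ i) ` {..<n})"
proof -
  from assms obtain p :: "int poly" where p: "p \<noteq> 0" "poly (map_poly of_int p) a = 0"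
    by (rule algebraicE')
  define n where "n = degree p"
  have "(\<Sum>i\<le>n. of_int (coeff p i) * a ^ i) = 0"
    using p(2) by (simp add: poly_altdef n_def coeff_map_poly degree_map_poly)
  then have s: "of_int (coeff p n) * a ^ n = - (\<Sum>i<n. of_int (coeff p i) * a ^ i)"
    by (simp add: lessThan_Suc_atMost[symmetric] eq_neg_iff_add_eq_0 add.commute)
  have nz: "coeff p n \<noteq> 0" using p by (simp add: n_def)
  have "n \<noteq> 0"
  proof
    assume "n = 0"
    with s nz show False by simp
  qed
  have "a ^ n = (\<Sum>i<n. of_rat (- of_int (coeff p i) / of_int (coeff p n)) * a ^ i)"
  proof -
    have "a ^ n = - (\<Sum>i<n. of_int (coeff p i) * a ^ i) / of_int (coeff p n)"
      using s nz by (simp add: field_simps)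
    also have "\<dots> = (\<Sum>i<n. of_rat (- of_int (coeff p i) / of_int (coeff p n)) * a ^ i)"
      by (simp add: sum_negf[symmetric] sum_divide_distrib of_rat_divide of_rat_minus)
    finally show ?thesis .
  qed
  also have "\<dots> \<in> rvs.span ((\<lambda>i. a ^ i) ` {..<n})"
    by (intro rvs.span_sum rvs.span_scale rvs.span_base) auto
  finally show ?thesis using \<open>n \<noteq> 0\<close> by auto
qed

text \<open>The span of the finitely many monomials \<open>a ^ i * b ^ j\<close> is stable under
  multiplication by a and by b, hence by their sum and product. It contains 1, so it contains all
  powers of both.\<close>

lemma algebraic_add_mult:
  assumes "algebraic (a :: complex)" "algebraic b"
  shows "algebraic (a + b)" "algebraic (a * b)"
proof -
  obtain n m where n: "n > 0" "a ^ n \<in> rvs.span ((\<lambda>i. a ^ i) ` {..<n})"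
    and m: "m > 0" "b ^ m \<in> rvs.span ((\<lambda>i. b ^ i) ` {..<m})"
    using assms algebraic_power_reduction by blast
  define B where "B = (\<lambda>(i, j). a ^ i * b ^ j) ` ({..<n} \<times> {..<m})"
  have fin: "finite B" by (simp add: B_def)
  have B: "a ^ i * b ^ j \<in> rvs.span B" if "i < n" "j < m" for i j
    using that by (intro rvs.span_base) (auto simp: B_def)
  have a: "a * x \<in> rvs.span B" if "x \<in> B" for x
  proof -
    from that obtain i j where ij: "x = a ^ i * b ^ j" "i < n" "j < m" by (auto simp: B_def)
    have "b ^ j * a ^ Suc i \<in> rvs.span B"
    proof (cases "Suc i < n")
      case True then show ?thesis using B[of "Suc i" j] ij by (simp add: mult.commute)
    next
      case False
      then have "Suc i = n" using ij by simp
      moreover have "b ^ j * a ^ n \<in> rvs.span B"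
        by (rule span_mult_closed[OF _ n(2)]) (use B ij in \<open>auto simp: mult.commute\<close>)
      ultimately show ?thesis by simp
    qed
    then show ?thesis using ij by (simp add: mult_ac)
  qed
  have b: "b * x \<in> rvs.span B" if "x \<in> B" for x
  proof -
    from that obtain i j where ij: "x = a ^ i * b ^ j" "i < n" "j < m" by (auto simp: B_def)
    have "a ^ i * b ^ Suc j \<in> rvs.span B"
    proof (cases "Suc j < m")
      case True then show ?thesis using B[of i "Suc j"] ij by simp
    next
      case False
      then have "Suc j = m" using ij by simp
      moreover have "a ^ i * b ^ m \<in> rvs.span B"
        by (rule span_mult_closed[OF _ m(2)]) (use B ij in auto)
      ultimately show ?thesis by simp
    qed
    then show ?thesis using ij by (simp add: mult_ac)
  qed
  have one: "1 \<in> rvs.span B" using B[of 0 0] n m by simp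
  have *: "algebraic x" if x: "\<And>y. y \<in> rvs.span B \<Longrightarrow> x * y \<in> rvs.span B" for x
  proof (rule algebraic_if_powers_in_span[OF fin])
    show "x ^ k \<in> rvs.span B" for k by (induction k) (auto simp: one x)
  qed
  note a' = span_mult_closed[OF a] and b' = span_mult_closed[OF b]
  show "algebraic (a + b)" by (rule *) (simp add: distrib_right a' b' rvs.span_add)
  show "algebraic (a * b)" by (rule *) (simp add: mult.assoc a' b')
qed

lemma Qbar_closed [simp, intro]:
  shows "0 \<in> Qbar" "1 \<in> Qbar" "of_nat n \<in> Qbar" "of_int k \<in> Qbar" "of_rat q \<in> Qbar"
    "a \<in> Qbar \<Longrightarrow> b \<in> Qbar \<Longrightarrow> a + b \<in> Qbar"
    "a \<in> Qbar \<Longrightarrow> b \<in> Qbar \<Longrightarrow> a * b \<in> Qbar"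
    "a \<in> Qbar \<Longrightarrow> - a \<in> Qbar"
    "a \<in> Qbar \<Longrightarrow> inverse a \<in> Qbar"
  by (auto simp: Qbar_def algebraic_add_mult rat_imp_algebraic)

lemma Qbar_closed' [simp, intro]:
  shows "a \<in> Qbar \<Longrightarrow> b \<in> Qbar \<Longrightarrow> a - b \<in> Qbar"
    "a \<in> Qbar \<Longrightarrow> b \<in> Qbar \<Longrightarrow> a / b \<in> Qbar"
    "a \<in> Qbar \<Longrightarrow> a ^ n \<in> Qbar"
    "(\<And>i. i \<in> I \<Longrightarrow> f i \<in> Qbar) \<Longrightarrow> sum f I \<in> Qbar"
    "(\<And>i. i \<in> I \<Longrightarrow> f i \<in> Qbar) \<Longrightarrow> prod f I \<in> Qbar"
proof -
  show "a - b \<in> Qbar" if "a \<in> Qbar" "b \<in> Qbar"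
    using Qbar_closed(6)[of a "- b"] that by simp
  show "a / b \<in> Qbar" if "a \<in> Qbar" "b \<in> Qbar"
    using that by (simp add: divide_inverse)
  show "a ^ n \<in> Qbar" if "a \<in> Qbar" using that by (induction n) auto
  show "sum f I \<in> Qbar" if "\<And>i. i \<in> I \<Longrightarrow> f i \<in> Qbar"
    using that by (induction I rule: infinite_finite_induct) auto
  show "prod f I \<in> Qbar" if "\<And>i. i \<in> I \<Longrightarrow> f i \<in> Qbar"
    using that by (induction I rule: infinite_finite_induct) auto
qed

text \<open>Graphs of embeddings of subrings of \<open>Qbar\<close> into \<open>Qbar\<close>. The last condition says that the
  relation is single-valued; injectivity and closure under inverses come for free because every
  element is algebraic.\<close>
definition graph_ring :: "(complex \<times> complex) set \<Rightarrow> bool" where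
  "graph_ring R \<longleftrightarrow> R \<subseteq> Qbar \<times> Qbar \<and> (\<forall>q. (of_rat q, of_rat q) \<in> R) \<and>
     (\<forall>x y x' y'. (x, y) \<in> R \<longrightarrow> (x', y') \<in> R \<longrightarrow> (x + x', y + y') \<in> R \<and> (x * x', y * y') \<in> R) \<and>
     (\<forall>y. (0, y) \<in> R \<longrightarrow> y = 0)"

definition poly_pair :: "(complex \<times> complex) set \<Rightarrow> complex poly \<Rightarrow> complex poly \<Rightarrow> bool" where
  "poly_pair R P Q \<longleftrightarrow> (\<forall>i. (coeff P i, coeff Q i) \<in> R)"

section \<open>Extending partial embeddings to automorphisms\<close>

context
  fixes R assumes R: "graph_ring R"
begin

lemma graph_ring_sub: "(x, y) \<in> R \<Longrightarrow> x \<in> Qbar" "(x, y) \<in> R \<Longrightarrow> y \<in> Qbar"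
  using R by (auto simp: graph_ring_def)

lemma graph_ring_rat: "(of_rat q, of_rat q) \<in> R"
  using R by (auto simp: graph_ring_def)

lemma graph_ring_0: "(0, 0) \<in> R" and graph_ring_1: "(1, 1) \<in> R"
  using graph_ring_rat[of 0] graph_ring_rat[of 1] by auto

lemma graph_ring_add: "(x, y) \<in> R \<Longrightarrow> (x', y') \<in> R \<Longrightarrow> (x + x', y + y') \<in> R"
  and graph_ring_mult: "(x, y) \<in> R \<Longrightarrow> (x', y') \<in> R \<Longrightarrow> (x * x', y * y') \<in> R"
  and graph_ring_zeroD: "(0, y) \<in> R \<Longrightarrow> y = 0"
  using R by (auto simp: graph_ring_def)

lemma graph_ring_minus: "(x, y) \<in> R \<Longrightarrow> (- x, - y) \<in> R"
  using graph_ring_mult[OF graph_ring_rat[of "-1"]] by (simp add: of_rat_minus)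

lemma graph_ring_diff: "(x, y) \<in> R \<Longrightarrow> (x', y') \<in> R \<Longrightarrow> (x - x', y - y') \<in> R"
  using graph_ring_add[OF _ graph_ring_minus] by fastforce

lemma graph_ring_sum:
  "(\<And>i. i \<in> I \<Longrightarrow> (f i, g i) \<in> R) \<Longrightarrow> (sum f I, sum g I) \<in> R"
  by (induction I rule: infinite_finite_induct) (auto intro: graph_ring_0 graph_ring_add)

lemma graph_ring_power: "(x, y) \<in> R \<Longrightarrow> (x ^ n, y ^ n) \<in> R"
  by (induction n) (auto intro: graph_ring_1 graph_ring_mult)

lemma graph_ring_unique: "(x, y) \<in> R \<Longrightarrow> (x, y') \<in> R \<Longrightarrow> y = y'"
  using graph_ring_diff[of x y x y'] graph_ring_zeroD by force

lemma graph_ring_int_poly: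
  "(x, y) \<in> R \<Longrightarrow> (poly (map_poly of_int p) x, poly (map_poly of_int p) y) \<in> R"
proof -
  assume xy: "(x, y) \<in> R"
  have "(of_int k, of_int k) \<in> R" for k using graph_ring_rat[of "of_int k"] by simp
  then show ?thesis using xy
    by (auto simp: poly_altdef coeff_map_poly degree_map_poly intro!: graph_ring_sum graph_ring_mult graph_ring_power)
qed

text \<open>Write an integer equation for x as c + X * r with c non-zero. The partner y satisfies
  the same equation, so both inverses are given by the one formula - r / c, which the relation
  respects.\<close>

lemma graph_ring_inverse:
  assumes "(x, y) \<in> R" "x \<noteq> 0"
  shows "y \<noteq> 0" "(inverse x, inverse y) \<in> R"
proof -
  have "algebraic x" using graph_ring_sub(1)[OF assms(1)] by (simp add: Qbar_def)
  then obtain p where p: "coeff p 0 \<noteq> 0" "poly (map_poly of_int p) x = 0"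
    using assms(2) by (metis algebraicE'_nonzero)
  have py: "poly (map_poly of_int p) y = 0"
    using graph_ring_int_poly[OF assms(1), of p] p(2) graph_ring_zeroD by metis
  obtain c r where cr: "p = pCons c r" by (rule pCons_cases)
  with p have c: "c \<noteq> 0" by simp
  have x: "of_int c + x * poly (map_poly of_int r) x = 0"
    and y: "of_int c + y * poly (map_poly of_int r) y = 0"
    using p(2) py by (simp_all add: cr map_poly_pCons)
  show "y \<noteq> 0" using y c by auto
  have ix: "inverse x = of_rat (- 1 / of_int c) * poly (map_poly of_int r) x"
    using x c assms(2) by (simp add: of_rat_divide of_rat_minus field_simps eq_neg_iff_add_eq_0)
  have iy: "inverse y = of_rat (- 1 / of_int c) * poly (map_poly of_int r) y"
    using y c \<open>y \<noteq> 0\<close> by (simp add: of_rat_divide of_rat_minus field_simps eq_neg_iff_add_eq_0)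
  show "(inverse x, inverse y) \<in> R"
    unfolding ix iy by (intro graph_ring_mult graph_ring_rat graph_ring_int_poly assms(1))
qed

text \<open>Lets the extension argument enlarge the range as well as the domain, which is how
  surjectivity of the final map is obtained.\<close>

lemma graph_ring_converse: "graph_ring (R\<inverse>)"
  unfolding graph_ring_def
proof (intro conjI allI impI)
  show "R\<inverse> \<subseteq> Qbar \<times> Qbar" using graph_ring_sub by auto
  show "y = 0" if "(0, y) \<in> R\<inverse>" for y
    using that graph_ring_inverse(1)[of y 0] by auto
qed (auto intro: graph_ring_rat graph_ring_add graph_ring_mult)

lemma poly_pair_degree: "poly_pair R P Q \<Longrightarrow> degree P = degree Q"
proof -
  assume "poly_pair R P Q"
  then have "coeff P i = 0 \<longleftrightarrow> coeff Q i = 0" for i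
    unfolding poly_pair_def using graph_ring_inverse(1) graph_ring_zeroD by metis
  then show ?thesis by (simp add: degree_def)
qed

lemma poly_pair_mult:
  assumes "poly_pair R P Q" "poly_pair R P' Q'" shows "poly_pair R (P * P') (Q * Q')"
  using assms unfolding poly_pair_def coeff_mult by (blast intro: graph_ring_sum graph_ring_mult)

lemma poly_pair_const: "(x, y) \<in> R \<Longrightarrow> poly_pair R [:x:] [:y:]"
  by (auto simp: poly_pair_def coeff_pCons graph_ring_0 split: nat.splits)

lemma poly_pair_monom: "(x, y) \<in> R \<Longrightarrow> poly_pair R (monom x k) (monom y k)"
  by (auto simp: poly_pair_def graph_ring_0)

lemma poly_pair_int: "poly_pair R (map_poly of_int p) (map_poly of_int p)"
  using graph_ring_rat[of "of_int k" for k] by (simp add: poly_pair_def coeff_map_poly)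

text \<open>\<open>P0\<close> acts as the minimal polynomial of a over the domain of R, and
  \<open>Q0\<close> is its image. Division by \<open>P0\<close>, carried out in parallel on both
  sides, shows that every relation satisfied by a passes to b; therefore sending P(a) to Q(b) is
  well defined.\<close>

lemma graph_ring_adjoin:
  assumes a: "a \<in> Qbar"
    and P0: "poly_pair R P0 Q0" "P0 \<noteq> 0" "poly P0 a = 0"
    and min: "\<forall>P Q. poly_pair R P Q \<longrightarrow> P \<noteq> 0 \<longrightarrow> poly P a = 0 \<longrightarrow> degree P0 \<le> degree P"
    and b: "poly Q0 b = 0"
  shows "\<exists>S. graph_ring S \<and> R \<subseteq> S \<and> (a, b) \<in> S"
proof -
  have key: "poly Q b = 0" if "poly_pair R P Q" "poly P a = 0" for P Q
    using that
  proof (induction "degree P" arbitrary: P Q rule: less_induct)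
    case less
    show ?case
    proof (cases "P = 0")
      case True
      then have "Q = 0" using less.prems(1)
        by (metis graph_ring_zeroD poly_pair_def coeff_0 poly_eqI)
      then show ?thesis by simp
    next
      case False
      define k where "k = degree P - degree P0"
      have "degree P0 \<le> degree P" using min less.prems False by blast
      then have k: "degree P = degree P0 + k" by (simp add: k_def)
      \<comment> \<open>The quotient of leading coefficients, written as one function so that the
        elimination steps for P and for Q are related coefficient by coefficient.\<close>
      define l where "l = (\<lambda>A A0. inverse (lead_coeff A0) * lead_coeff A :: complex)"
      have "(lead_coeff P0, lead_coeff Q0) \<in> R" "(lead_coeff P, lead_coeff Q) \<in> R"
        using P0(1) less.prems(1) poly_pair_degree[OF P0(1)] poly_pair_degree[OF less.prems(1)]
        by (simp_all add: poly_pair_def)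
      then have "(l P P0, l Q Q0) \<in> R"
        unfolding l_def using P0(2) graph_ring_mult[OF graph_ring_inverse(2)] by simp
      define P1 where "P1 = P - monom (l P P0) k * P0"
      define Q1 where "Q1 = Q - monom (l Q Q0) k * Q0"
      have pp: "poly_pair R (monom (l P P0) k * P0) (monom (l Q Q0) k * Q0)"
        by (intro poly_pair_mult poly_pair_monom P0(1)) fact
      have pp1: "poly_pair R P1 Q1"
        using pp less.prems(1) unfolding P1_def Q1_def poly_pair_def by (auto intro: graph_ring_diff)
      have z: "poly P1 a = 0" using less.prems(2) P0(3) by (simp add: P1_def)
      have "poly Q1 b = 0"
      proof (cases "P1 = 0")
        case True
        then have "Q1 = 0" using pp1
          by (metis graph_ring_zeroD poly_pair_def coeff_0 poly_eqI)
        then show ?thesis by simp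
      next
        case F: False
        have "degree P1 \<le> degree P"
          unfolding P1_def
          using k degree_mult_le[of "monom (l P P0) k" P0] degree_monom_le[of "l P P0" k]
          by (intro degree_diff_le) auto
        moreover have "coeff P1 (degree P) = 0"
          using P0(2) by (simp add: P1_def k coeff_monom_mult l_def)
        ultimately have "degree P1 < degree P"
          using F by (metis leading_coeff_0_iff nless_le)
        from less.hyps[OF this pp1 z] show ?thesis .
      qed
      then show ?thesis using b by (simp add: Q1_def)
    qed
  qed
  \<comment> \<open>An integer polynomial is paired with itself, so one that annihilates a
    annihilates b as well.\<close>
  have bQ: "b \<in> Qbar"
  proof -
    from a have "algebraic a" by (simp add: Qbar_def)
    then obtain p where p: "p \<noteq> 0" "poly (map_poly of_int p) a = 0" by (rule algebraicE')
    from key[OF poly_pair_int p(2)] have "poly (map_poly of_int p) b = 0" .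
    moreover from p(1) have "map_poly of_int p \<noteq> (0 :: complex poly)"
      by (auto simp: poly_eq_iff coeff_map_poly)
    ultimately show ?thesis unfolding Qbar_def
      by (intro CollectI algebraicI[of "map_poly of_int p"]) (auto simp: coeff_map_poly)
  qed
  define S where "S = {(poly P a, poly Q b) | P Q. poly_pair R P Q}"
  have cf: "coeff P i \<in> Qbar" "coeff Q i \<in> Qbar" if "poly_pair R P Q" for P Q i
    using that graph_ring_sub unfolding poly_pair_def by blast+
  have pe: "poly P x \<in> Qbar" if "\<And>i. coeff P i \<in> Qbar" "x \<in> Qbar" for P x
    using that by (auto simp: poly_altdef)
  have RS: "R \<subseteq> S"
  proof
    fix z assume "z \<in> R"
    then obtain x y where "z = (x, y)" "(x, y) \<in> R" by (cases z) auto
    moreover from this have "(poly [:x:] a, poly [:y:] b) \<in> S"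
      unfolding S_def using poly_pair_const[of x y] by blast
    ultimately show "z \<in> S" by simp
  qed
  have "graph_ring S"
    unfolding graph_ring_def
  proof (intro conjI allI impI)
    show "S \<subseteq> Qbar \<times> Qbar" using pe cf a bQ by (auto simp: S_def)
    show "(of_rat q, of_rat q) \<in> S" for q using RS graph_ring_rat by auto
    show "y = 0" if "(0, y) \<in> S" for y using that key by (force simp: S_def)
  next
    fix x y x' y' assume "(x, y) \<in> S" "(x', y') \<in> S"
    then obtain P Q P' Q' where *: "poly_pair R P Q" "poly_pair R P' Q'"
      "x = poly P a" "y = poly Q b" "x' = poly P' a" "y' = poly Q' b" by (auto simp: S_def)
    have "poly_pair R (P + P') (Q + Q')" using * by (auto simp: poly_pair_def intro: graph_ring_add)
    then have "(poly (P + P') a, poly (Q + Q') b) \<in> S" unfolding S_def by blast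
    then show "(x + x', y + y') \<in> S" by (simp add: *)
    from poly_pair_mult[OF *(1,2)]
    have "(poly (P * P') a, poly (Q * Q') b) \<in> S" unfolding S_def by blast
    then show "(x * x', y * y') \<in> S" by (simp add: *)
  qed
  moreover have "(a, b) \<in> S"
  proof -
    have "(poly (monom 1 1) a, poly (monom 1 1) b) \<in> S"
      unfolding S_def using poly_pair_monom[OF graph_ring_1, of 1] by blast
    then show ?thesis by (simp add: poly_monom)
  qed
  ultimately show ?thesis using RS by blast
qed

lemma graph_ring_minimal_pair:
  assumes a: "a \<in> Qbar"
  obtains P0 Q0 where "poly_pair R P0 Q0" "P0 \<noteq> 0" "poly P0 a = 0" "degree Q0 = degree P0"
    "\<forall>P Q. poly_pair R P Q \<longrightarrow> P \<noteq> 0 \<longrightarrow> poly P a = 0 \<longrightarrow> degree P0 \<le> degree P"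
    "degree P0 > 0"
proof -
  define A where "A = {(P, Q). poly_pair R P Q \<and> P \<noteq> 0 \<and> poly P a = 0}"
  from a have "algebraic a" by (simp add: Qbar_def)
  then obtain p where p: "p \<noteq> 0" "poly (map_poly of_int p) a = 0" by (rule algebraicE')
  from p(1) have "map_poly of_int p \<noteq> (0 :: complex poly)"
    by (auto simp: poly_eq_iff coeff_map_poly)
  with p have "(map_poly of_int p, map_poly of_int p) \<in> A"
    using poly_pair_int[of p] by (auto simp: A_def)
  then obtain z where z: "z \<in> A" "\<And>y. y \<in> A \<Longrightarrow> degree (fst z) \<le> degree (fst y)"
    using ex_has_least_nat[of "\<lambda>z. z \<in> A" _ "\<lambda>z. degree (fst z)"] by metis
  have "degree (fst z) > 0"
  proof (rule ccontr)
    assume "\<not> degree (fst z) > 0"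
    then have "degree (fst z) = 0" by simp
    then obtain c where "fst z = [:c:]" by (rule degree_eq_zeroE)
    with z(1) show False by (auto simp: A_def)
  qed
  obtain P0 Q0 where PQ: "z = (P0, Q0)" by (cases z)
  have 1: "poly_pair R P0 Q0" "P0 \<noteq> 0" "poly P0 a = 0" using z(1) by (auto simp: A_def PQ)
  have 2: "\<forall>P Q. poly_pair R P Q \<longrightarrow> P \<noteq> 0 \<longrightarrow> poly P a = 0 \<longrightarrow> degree P0 \<le> degree P"
  proof (intro allI impI)
    fix P Q assume "poly_pair R P Q" "P \<noteq> 0" "poly P a = 0"
    then have "(P, Q) \<in> A" by (simp add: A_def)
    from z(2)[OF this] show "degree P0 \<le> degree P" by (simp add: PQ)
  qed
  show ?thesis
    by (rule that[OF 1 _ 2]) (use poly_pair_degree[OF 1(1)] \<open>degree (fst z) > 0\<close> in \<open>auto simp: PQ\<close>)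
qed

lemma graph_ring_extend:
  assumes a: "a \<in> Qbar"
  shows "\<exists>S b. graph_ring S \<and> R \<subseteq> S \<and> (a, b) \<in> S"
proof -
  from graph_ring_minimal_pair[OF a] obtain P0 Q0 where P0: "poly_pair R P0 Q0" "P0 \<noteq> 0" "poly P0 a = 0"
    "degree Q0 = degree P0"
    "\<forall>P Q. poly_pair R P Q \<longrightarrow> P \<noteq> 0 \<longrightarrow> poly P a = 0 \<longrightarrow> degree P0 \<le> degree P"
    "degree P0 > 0" by metis
  obtain b where "poly Q0 b = 0" using alg_closed_imp_poly_has_root[of Q0] P0 by auto
  from graph_ring_adjoin[OF a P0(1,2,3,5) this] show ?thesis by blast
qed

end

lemma graph_ring_Union:
  assumes "C \<noteq> {}" "subset.chain (Collect graph_ring) C"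
  shows "graph_ring (\<Union>C)"
proof -
  have gr: "graph_ring X" if "X \<in> C" for X using assms(2) that by (auto simp: subset_chain_def)
  have ch: "X \<subseteq> Y \<or> Y \<subseteq> X" if "X \<in> C" "Y \<in> C" for X Y
    using assms(2) that by (auto simp: subset_chain_def)
  obtain X0 where X0: "X0 \<in> C" using assms(1) by blast
  show ?thesis unfolding graph_ring_def
  proof (intro conjI allI impI)
    show "\<Union>C \<subseteq> Qbar \<times> Qbar" using gr graph_ring_sub by fast
    show "(of_rat q, of_rat q) \<in> \<Union>C" for q using X0 gr graph_ring_rat by blast
    show "y = 0" if "(0, y) \<in> \<Union>C" for y using that gr graph_ring_zeroD by blast
  next
    fix x y x' y' assume "(x, y) \<in> \<Union>C" "(x', y') \<in> \<Union>C"
    then obtain X where "X \<in> C" "(x, y) \<in> X" "(x', y') \<in> X" using ch by blast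
    then show "(x + x', y + y') \<in> \<Union>C" "(x * x', y * y') \<in> \<Union>C"
      using gr graph_ring_add graph_ring_mult by blast+
  qed
qed

text \<open>A maximal graph is total, since a missing argument could be adjoined, and onto, since a
  missing value could be adjoined to the converse graph.\<close>

lemma graph_ring_extends_to_Gal:
  assumes "graph_ring R"
  shows "\<exists>\<sigma>\<in>Gal. \<forall>(x, y)\<in>R. \<sigma> x = y"
proof -
  have "\<exists>M\<in>{S. graph_ring S \<and> R \<subseteq> S}. \<forall>X\<in>{S. graph_ring S \<and> R \<subseteq> S}. M \<subseteq> X \<longrightarrow> X = M"
  proof (rule subset_Zorn_nonempty)
    show "{S. graph_ring S \<and> R \<subseteq> S} \<noteq> {}" using assms by blast
    fix C assume C: "C \<noteq> {}" "subset.chain {S. graph_ring S \<and> R \<subseteq> S} C"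
    then have "graph_ring (\<Union>C)" by (intro graph_ring_Union) (auto simp: subset_chain_def)
    moreover have "R \<subseteq> \<Union>C" using C unfolding subset_chain_def by blast
    ultimately show "\<Union>C \<in> {S. graph_ring S \<and> R \<subseteq> S}" by blast
  qed
  then obtain M where M0: "graph_ring M" "R \<subseteq> M" "\<forall>X\<in>{S. graph_ring S \<and> R \<subseteq> S}. M \<subseteq> X \<longrightarrow> X = M"
    by blast
  have M: "graph_ring M" "R \<subseteq> M" "\<And>X. graph_ring X \<Longrightarrow> M \<subseteq> X \<Longrightarrow> X = M"
    using M0 by auto
  have dom: "\<exists>b. (a, b) \<in> M" if "a \<in> Qbar" for a
    using graph_ring_extend[OF M(1) that] M(3) by blast
  have ran: "\<exists>a. (a, b) \<in> M" if b: "b \<in> Qbar" for b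
  proof -
    obtain S a where S: "graph_ring S" "M\<inverse> \<subseteq> S" "(b, a) \<in> S"
      using graph_ring_extend[OF graph_ring_converse[OF M(1)] b] by blast
    from S(2) have "M \<subseteq> S\<inverse>" by auto
    from M(3)[OF graph_ring_converse[OF S(1)] this] S(3) show ?thesis by auto
  qed
  define \<sigma> where "\<sigma> x = (if x \<in> Qbar then THE y. (x, y) \<in> M else x)" for x
  have \<sigma>: "\<sigma> x = y" if "(x, y) \<in> M" for x y
    using that graph_ring_sub[OF M(1)] graph_ring_unique[OF M(1)] by (auto simp: \<sigma>_def)
  have \<sigma>M: "(x, \<sigma> x) \<in> M" if "x \<in> Qbar" for x using dom[OF that] \<sigma> by auto
  have "bij_betw \<sigma> Qbar Qbar"
  proof (rule bij_betwI')
    fix x y assume xy: "x \<in> Qbar" "y \<in> Qbar"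
    show "(\<sigma> x = \<sigma> y) = (x = y)"
      using \<sigma>M[OF xy(1)] \<sigma>M[OF xy(2)] graph_ring_unique[OF graph_ring_converse[OF M(1)]] by auto
  next
    show "\<sigma> x \<in> Qbar" if "x \<in> Qbar" for x using \<sigma>M[OF that] graph_ring_sub[OF M(1)] by blast
    show "\<exists>x\<in>Qbar. y = \<sigma> x" if "y \<in> Qbar" for y
      using ran[OF that] \<sigma> graph_ring_sub[OF M(1)] by blast
  qed
  moreover have "\<sigma> (a + b) = \<sigma> a + \<sigma> b \<and> \<sigma> (a * b) = \<sigma> a * \<sigma> b" if "a \<in> Qbar" "b \<in> Qbar" for a b
    using \<sigma>[OF graph_ring_add[OF M(1) \<sigma>M[OF that(1)] \<sigma>M[OF that(2)]]]
      \<sigma>[OF graph_ring_mult[OF M(1) \<sigma>M[OF that(1)] \<sigma>M[OF that(2)]]] by simp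
  moreover have "\<sigma> 1 = 1" by (rule \<sigma>[OF graph_ring_1[OF M(1)]])
  ultimately have "\<sigma> \<in> Gal" by (auto simp: Gal_def \<sigma>_def)
  then show ?thesis using \<sigma> M(2) by blast
qed

text \<open>An irrational x has a rational polynomial of least degree greater than 1. In
  characteristic 0 this polynomial has a second root different from x, and sending x to that root
  extends to an automorphism.\<close>

theorem Gal_fixed_imp_rational:
  assumes x: "x \<in> Qbar" and fixed: "\<And>\<sigma>. \<sigma> \<in> Gal \<Longrightarrow> \<sigma> x = x"
  shows "x \<in> \<rat>"
proof (rule ccontr)
  assume nrat: "x \<notin> \<rat>"
  define D where "D = range (\<lambda>q. (of_rat q, of_rat q) :: complex \<times> complex)"
  have D: "graph_ring D"
    by (auto simp: graph_ring_def D_def of_rat_add[symmetric] of_rat_mult[symmetric])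
  from graph_ring_minimal_pair[OF D x] obtain P Q where P: "poly_pair D P Q" "P \<noteq> 0" "poly P x = 0"
    "degree Q = degree P"
    "\<forall>P' Q'. poly_pair D P' Q' \<longrightarrow> P' \<noteq> 0 \<longrightarrow> poly P' x = 0 \<longrightarrow> degree P \<le> degree P'"
    "degree P > 0" by metis
  have pp: "poly_pair D A B \<longleftrightarrow> A = B \<and> (\<forall>i. coeff A i \<in> \<rat>)" for A B
  proof -
    have "(u, v) \<in> D \<longleftrightarrow> u = v \<and> u \<in> \<rat>" for u v by (auto simp: D_def Rats_def)
    then show ?thesis by (auto simp: poly_pair_def poly_eq_iff)
  qed
  have PQ: "Q = P" and rat: "coeff P i \<in> \<rat>" for i using P(1) pp by auto
  obtain S where S: "P = [:-x, 1:] * S" using P(3) by (auto simp: poly_eq_0_iff_dvd elim: dvdE)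
  have "degree S > 0"
  proof (rule ccontr)
    assume "\<not> degree S > 0"
    then obtain c where c: "S = [:c:]" by (auto elim: degree_eq_zeroE)
    then have "c \<noteq> 0" using P(2) S by auto
    have "c \<in> \<rat>" "- x * c \<in> \<rat>" using rat[of 1] rat[of 0] by (auto simp: S c mult.commute)
    then have "(- x * c) / c \<in> \<rat>" by (rule Rats_divide[rotated])
    then have "- x \<in> \<rat>" using \<open>c \<noteq> 0\<close> by simp
    then show False using nrat Rats_minus_iff by blast
  qed
  then obtain y where y: "poly S y = 0" using alg_closed_imp_poly_has_root by blast
  \<comment> \<open>A double root would also be a root of the derivative, which has rational
    coefficients and smaller degree.\<close>
  have "y \<noteq> x"
  proof
    assume "y = x"
    have "pderiv P \<noteq> 0" using P(6) by (simp add: pderiv_eq_0_iff)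
    moreover have "poly (pderiv P) x = 0" using y \<open>y = x\<close> unfolding S pderiv_mult by (simp add: pderiv_pCons)
    moreover have "poly_pair D (pderiv P) (pderiv P)"
      unfolding pp using rat by (auto simp: coeff_pderiv)
    ultimately have "degree P \<le> degree (pderiv P)" using P(5) by blast
    then show False using P(6) by (simp add: degree_pderiv)
  qed
  have "poly Q y = 0" using y by (simp add: PQ S)
  from graph_ring_adjoin[OF D x P(1,2,3,5) this]
  obtain T where "graph_ring T" "(x, y) \<in> T" by blast
  then obtain \<sigma> where "\<sigma> \<in> Gal" "\<sigma> x = y" using graph_ring_extends_to_Gal[of T] by auto
  with fixed \<open>y \<noteq> x\<close> show False by blast
qed

section \<open>Absolute values\<close>

text \<open>Subfields without a finiteness condition, so that the rules for places apply both to
  number fields and to \<open>Qbar\<close> itself.\<close>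

definition csubfield :: "complex set \<Rightarrow> bool" where
  "csubfield K \<longleftrightarrow> 0 \<in> K \<and> 1 \<in> K \<and> (\<forall>a\<in>K. \<forall>b\<in>K. a + b \<in> K \<and> a - b \<in> K \<and> a * b \<in> K)
     \<and> (\<forall>a\<in>K. a \<noteq> 0 \<longrightarrow> inverse a \<in> K)"

lemma csubfield_Qbar: "csubfield Qbar"
  by (auto simp: csubfield_def)

lemma number_field_csubfield: "number_field K \<Longrightarrow> csubfield K"
  and number_field_subset_Qbar: "number_field K \<Longrightarrow> K \<subseteq> Qbar"
  by (auto simp: number_field_def csubfield_def)

context
  fixes K assumes K: "csubfield K"
begin

lemma csubfield_closed:
  shows "0 \<in> K" "1 \<in> K" "a \<in> K \<Longrightarrow> b \<in> K \<Longrightarrow> a + b \<in> K" "a \<in> K \<Longrightarrow> b \<in> K \<Longrightarrow> a - b \<in> K"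
    "a \<in> K \<Longrightarrow> b \<in> K \<Longrightarrow> a * b \<in> K" "a \<in> K \<Longrightarrow> inverse a \<in> K"
proof -
  show "inverse a \<in> K" if "a \<in> K"
    using K that by (cases "a = 0") (auto simp: csubfield_def)
qed (use K in \<open>auto simp: csubfield_def\<close>)

lemma csubfield_uminus: "a \<in> K \<Longrightarrow> - a \<in> K"
  using csubfield_closed(4)[of 0 a] csubfield_closed(1) by simp

lemma csubfield_divide: "a \<in> K \<Longrightarrow> b \<in> K \<Longrightarrow> a / b \<in> K"
  using csubfield_closed by (simp add: divide_inverse)

lemma csubfield_power: "a \<in> K \<Longrightarrow> a ^ n \<in> K"
  by (induction n) (auto intro: csubfield_closed)

lemma csubfield_sum: "(\<And>i. i \<in> I \<Longrightarrow> f i \<in> K) \<Longrightarrow> sum f I \<in> K"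
  by (induction I rule: infinite_finite_induct) (auto intro: csubfield_closed)

lemma csubfield_of_nat: "of_nat n \<in> K"
  by (induction n) (auto intro: csubfield_closed)

lemma csubfield_of_int: "of_int n \<in> K"
  by (cases n rule: int_cases2) (auto intro: csubfield_uminus csubfield_of_nat)

lemma csubfield_of_rat: "of_rat q \<in> K"
  by (cases q) (auto simp: of_rat_rat intro: csubfield_divide csubfield_of_int)

end

text \<open>\<open>padic_abs\<close> is defined through the reduced fraction; this frees it from the
  choice of representation, by comparing multiplicities in the cross-multiplied equation.\<close>

lemma padic_abs_fraction:
  assumes "prime p" "c \<noteq> 0" "d \<noteq> 0"
  shows "padic_abs p (of_int c / of_int d) =
    real p powr (real (multiplicity (int p) d) - real (multiplicity (int p) c))"
proof -
  obtain a b where ab: "quotient_of (of_int c / of_int d) = (a, b)" by fastforce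
  have b: "b > 0" using ab quotient_of_denom_pos by blast
  have q: "(of_int c / of_int d :: rat) = of_int a / of_int b" using quotient_of_div[OF ab] .
  then have a: "a \<noteq> 0" using assms b by auto
  have "(of_int (c * b) :: rat) = of_int (a * d)" using q assms b by (simp add: field_simps)
  then have eq: "c * b = a * d" by (rule of_int_eq_iff[THEN iffD1])
  have pp: "prime_elem (int p)" using assms by simp
  have "multiplicity (int p) c + multiplicity (int p) b = multiplicity (int p) a + multiplicity (int p) d"
    using prime_elem_multiplicity_mult_distrib[OF pp, of c b]
      prime_elem_multiplicity_mult_distrib[OF pp, of a d] eq assms a b by simp
  then have "real (multiplicity (int p) b) - real (multiplicity (int p) a) =
    real (multiplicity (int p) d) - real (multiplicity (int p) c)" by linarith
  then show ?thesis using ab assms by (simp add: padic_abs_def)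
qed

lemma padic_abs_0 [simp]: "padic_abs p 0 = 0"
  by (simp add: padic_abs_def)

lemma padic_abs_of_int:
  "prime p \<Longrightarrow> c \<noteq> 0 \<Longrightarrow> padic_abs p (of_int c) = real p powr (- real (multiplicity (int p) c))"
  using padic_abs_fraction[of p c 1] by simp

lemma padic_abs_of_int_le_1: "prime p \<Longrightarrow> padic_abs p (of_int c) \<le> 1"
proof (cases "c = 0")
  case False
  assume p: "prime p"
  then have "real p > 1" using prime_gt_1_nat by auto
  then show ?thesis using p False
    by (simp add: padic_abs_of_int powr_minus field_simps ge_one_powr_ge_zero)
qed simp

lemma padic_abs_of_int_eq_1: "prime p \<Longrightarrow> \<not> int p dvd c \<Longrightarrow> padic_abs p (of_int c) = 1"
proof -
  assume p: "prime p" "\<not> int p dvd c"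
  then have "c \<noteq> 0" "multiplicity (int p) c = 0" by (auto intro: not_dvd_imp_multiplicity_0)
  then show ?thesis using p prime_gt_0_nat[OF p(1)] by (simp add: padic_abs_of_int)
qed

lemma padic_abs_self: "prime p \<Longrightarrow> padic_abs p (of_nat p) = 1 / real p"
proof -
  assume p: "prime p"
  then have "prime_elem (int p)" by simp
  then have "multiplicity (int p) (int p) = 1" by (simp add: multiplicity_self prime_elem_def)
  then show ?thesis using padic_abs_of_int[of p "int p"] p prime_gt_0_nat[OF p]
    by (simp add: powr_minus field_simps)
qed

text \<open>\<open>nonarch_place\<close> hides the prime in an existential quantifier. Here it is a
  parameter, which allows places of different fields above the same prime to be compared.\<close>

definition place_over :: "complex set \<Rightarrow> nat \<Rightarrow> (complex \<Rightarrow> real) \<Rightarrow> bool" where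
  "place_over K p v \<longleftrightarrow> nonarch_place K v \<and> prime p \<and> (\<forall>q. v (of_rat q) = padic_abs p q)"

lemma place_over_unique:
  assumes "place_over K p v" "place_over L p' v"
  shows "p = p'"
proof (rule ccontr)
  assume "p \<noteq> p'"
  have pr: "prime p" "prime p'" using assms by (auto simp: place_over_def)
  then have "\<not> p' dvd p" using \<open>p \<noteq> p'\<close> primes_dvd_imp_eq by blast
  then have "\<not> int p' dvd int p" by simp
  then have "padic_abs p' (of_nat p) = 1" using padic_abs_of_int_eq_1[OF pr(2), of "int p"] by simp
  moreover have "padic_abs p' (of_nat p) = padic_abs p (of_nat p)"
    using assms by (auto simp: place_over_def)
  ultimately have "real p = 1" using padic_abs_self[OF pr(1)] by simp
  then show False using prime_gt_1_nat[OF pr(1)] by simp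
qed

lemma place_over_place_prime: "place_over K p v \<Longrightarrow> place_prime v = p"
  unfolding place_prime_def
  by (rule the_equality) (auto simp: place_over_def intro: place_over_unique[of K _ v K p, unfolded place_over_def])

lemma nonarch_place_over: "nonarch_place K v \<Longrightarrow> place_over K (place_prime v) v"
  using place_over_place_prime[of K _ v] by (auto simp: place_over_def nonarch_place_def)

context
  fixes K p v
  assumes K: "csubfield K" and v: "place_over K p v"
begin

lemma place_prime_p: "prime p" and place_p_gt_1: "real p > 1" and place_of_rat: "v (of_rat q) = padic_abs p q"
  using v prime_gt_1_nat by (auto simp: place_over_def)

lemma place_0: "v 0 = 0" and place_pos: "a \<in> K \<Longrightarrow> a \<noteq> 0 \<Longrightarrow> v a > 0"
  and place_mult: "a \<in> K \<Longrightarrow> b \<in> K \<Longrightarrow> v (a * b) = v a * v b"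
  and place_add: "a \<in> K \<Longrightarrow> b \<in> K \<Longrightarrow> v (a + b) \<le> max (v a) (v b)"
  and place_outside: "a \<notin> K \<Longrightarrow> v a = 0"
  using v by (auto simp: place_over_def nonarch_place_def)

lemma place_nonneg: "v a \<ge> 0"
  by (metis place_0 place_pos place_outside less_eq_real_def)

lemma place_1: "v 1 = 1"
proof -
  have "v 1 * v 1 = v 1" using place_mult[of 1 1] csubfield_closed(2)[OF K] by simp
  moreover have "v 1 > 0" using place_pos csubfield_closed(2)[OF K] by simp
  ultimately show ?thesis by simp
qed

lemma place_power: "a \<in> K \<Longrightarrow> v (a ^ n) = v a ^ n"
  by (induction n) (auto simp: place_1 place_mult csubfield_power[OF K])

lemma place_uminus: "a \<in> K \<Longrightarrow> v (- a) = v a"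
proof -
  assume a: "a \<in> K"
  have "v (- 1) = v (of_rat (of_int (- 1)))" by (simp add: of_rat_minus)
  also have "\<dots> = 1" unfolding place_of_rat
    by (rule padic_abs_of_int_eq_1[OF place_prime_p]) (use place_p_gt_1 in auto)
  finally show ?thesis using place_mult[of "-1" a] a csubfield_uminus[OF K csubfield_closed(2)[OF K]] by simp
qed

lemma place_diff: "a \<in> K \<Longrightarrow> b \<in> K \<Longrightarrow> v (a - b) \<le> max (v a) (v b)"
  using place_add[of a "- b"] place_uminus csubfield_uminus[OF K] by simp

lemma place_inverse: "a \<in> K \<Longrightarrow> v (inverse a) = inverse (v a)"
proof (cases "a = 0")
  case False
  assume a: "a \<in> K"
  have "v a * v (inverse a) = 1"
    using place_mult[of a "inverse a"] a False csubfield_closed(6)[OF K a] place_1 by simp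
  then show ?thesis by (metis inverse_unique)
qed (simp add: place_0)

lemma place_divide: "a \<in> K \<Longrightarrow> b \<in> K \<Longrightarrow> v (a / b) = v a / v b"
  using place_mult place_inverse csubfield_closed(6)[OF K] by (simp add: divide_inverse)

lemma place_sum_le:
  assumes "finite I" "M \<ge> 0" "\<And>i. i \<in> I \<Longrightarrow> f i \<in> K" "\<And>i. i \<in> I \<Longrightarrow> v (f i) \<le> M"
  shows "v (sum f I) \<le> M"
  using assms
proof (induction I rule: finite_induct)
  case (insert x F)
  have "v (f x + sum f F) \<le> max (v (f x)) (v (sum f F))"
    using insert by (intro place_add csubfield_sum[OF K]) auto
  also have "\<dots> \<le> M" using insert by auto
  finally show ?case using insert by simp
qed (simp add: place_0)

lemma place_sum_less:
  assumes "finite I" "M > 0" "\<And>i. i \<in> I \<Longrightarrow> f i \<in> K" "\<And>i. i \<in> I \<Longrightarrow> v (f i) < M"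
  shows "v (sum f I) < M"
  using assms
proof (induction I rule: finite_induct)
  case (insert x F)
  have "v (f x + sum f F) \<le> max (v (f x)) (v (sum f F))"
    using insert by (intro place_add csubfield_sum[OF K]) auto
  also have "\<dots> < M" using insert by auto
  finally show ?case using insert by simp
qed (simp add: place_0)

lemma place_add_eq:
  assumes "a \<in> K" "b \<in> K" "v b < v a"
  shows "v (a + b) = v a"
proof -
  have "v a \<le> max (v (a + b)) (v b)"
    using place_diff[of "a + b" b] assms csubfield_closed(3)[OF K] by simp
  moreover have "v (a + b) \<le> max (v a) (v b)" using place_add assms by blast
  ultimately show ?thesis using assms(3) by auto
qed

lemma place_of_int_le_1: "v (of_int c) \<le> 1"
  using place_of_rat[of "of_int c"] padic_abs_of_int_le_1[OF place_prime_p] by simp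

lemma place_of_nat_le_1: "v (of_nat c) \<le> 1"
  using place_of_int_le_1[of "int c"] by simp

lemma place_p: "v (of_nat p) = 1 / real p"
  using place_of_rat[of "of_nat p"] padic_abs_self[OF place_prime_p] by simp

end

subsection \<open>Extending the p-adic absolute value to the algebraic numbers\<close>

text \<open>Set-up of Chevalley's extension argument: a subring that is maximal among those without
  \<open>1 / p\<close> turns out to be a valuation ring in which p is not a unit.\<close>

definition subring_avoiding :: "complex \<Rightarrow> complex set \<Rightarrow> bool" where
  "subring_avoiding y R \<longleftrightarrow> R \<subseteq> Qbar \<and> 1 \<in> R \<and> (\<forall>a\<in>R. \<forall>b\<in>R. a - b \<in> R \<and> a * b \<in> R) \<and> y \<notin> R"

lemma subring_avoiding_closed:
  assumes "subring_avoiding y R"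
  shows "0 \<in> R" "1 \<in> R" "a \<in> R \<Longrightarrow> b \<in> R \<Longrightarrow> a - b \<in> R" "a \<in> R \<Longrightarrow> b \<in> R \<Longrightarrow> a * b \<in> R"
    "a \<in> R \<Longrightarrow> - a \<in> R" "a \<in> R \<Longrightarrow> b \<in> R \<Longrightarrow> a + b \<in> R" "a \<in> R \<Longrightarrow> a \<in> Qbar"
proof -
  show 0: "0 \<in> R" using assms unfolding subring_avoiding_def by (metis diff_self)
  show m: "- a \<in> R" if "a \<in> R" for a
    using assms that 0 unfolding subring_avoiding_def by (metis diff_0)
  show "a + b \<in> R" if "a \<in> R" "b \<in> R"
    using assms that(1) m[OF that(2)] unfolding subring_avoiding_def by (metis diff_minus_eq_add)
qed (use assms in \<open>auto simp: subring_avoiding_def\<close>)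

section \<open>Valuation rings of the algebraic numbers and the absolute values they define\<close>

locale maximal_ring =
  fixes p :: nat and R :: "complex set"
  assumes p: "prime p" and R: "subring_avoiding (1 / of_nat p) R"
    and maximal: "\<And>S. subring_avoiding (1 / of_nat p) S \<Longrightarrow> R \<subseteq> S \<Longrightarrow> S = R"
begin

lemmas R_closed = subring_avoiding_closed[OF R]

lemma inverse_p_notin: "1 / of_nat p \<notin> R" using R by (simp add: subring_avoiding_def)

lemma p_nz: "(of_nat p :: complex) \<noteq> 0" using p by (auto simp: prime_gt_0_nat)

lemma R_sum: "(\<And>i. i \<in> I \<Longrightarrow> f i \<in> R) \<Longrightarrow> sum f I \<in> R"
  by (induction I rule: infinite_finite_induct) (auto intro: R_closed)

lemma R_power: "a \<in> R \<Longrightarrow> a ^ n \<in> R"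
  by (induction n) (auto intro: R_closed)

lemma R_of_nat: "of_nat n \<in> R"
  by (induction n) (auto intro: R_closed)

lemma R_of_int: "of_int n \<in> R"
  by (cases n rule: int_cases2) (auto intro: R_closed R_of_nat)

text \<open>A witness that \<open>1 / p\<close> is a polynomial in u of degree at most n over R. The
  degree is recorded because the contradiction is reached by descent on it.\<close>

definition relation_of_degree :: "nat \<Rightarrow> complex \<Rightarrow> bool" where
  "relation_of_degree n u \<longleftrightarrow> (\<exists>a. (\<forall>i. a i \<in> R) \<and> of_nat p * (\<Sum>i\<le>n. a i * u ^ i) = 1)"

lemma relation_mono: "relation_of_degree n u \<Longrightarrow> n \<le> m \<Longrightarrow> relation_of_degree m u"
proof -
  assume "relation_of_degree n u" and nm: "n \<le> m"
  then obtain a where a: "\<forall>i. a i \<in> R" "of_nat p * (\<Sum>i\<le>n. a i * u ^ i) = 1"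
    by (auto simp: relation_of_degree_def)
  define b where "b i = (if i \<le> n then a i else 0)" for i
  have "(\<Sum>i\<le>m. b i * u ^ i) = (\<Sum>i\<le>n. a i * u ^ i)"
    using nm by (intro sum.mono_neutral_cong_right) (auto simp: b_def)
  then show ?thesis using a R_closed(1) by (auto simp: relation_of_degree_def b_def intro!: exI[of _ b])
qed

text \<open>The ring R[u] is strictly larger than R, so by maximality it must contain
  \<open>1 / p\<close>.\<close>

lemma relation_exists:
  assumes "u \<in> Qbar" "u \<notin> R"
  shows "\<exists>n. relation_of_degree n u"
proof -
  define S where "S = {poly P u | P. \<forall>i. coeff P i \<in> R}"
  have RS: "R \<subseteq> S"
  proof
    fix x assume "x \<in> R"
    then have "\<forall>i. coeff [:x:] i \<in> R" by (auto simp: coeff_pCons R_closed split: nat.splits)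
    then have "poly [:x:] u \<in> S" unfolding S_def by blast
    then show "x \<in> S" by simp
  qed
  have "\<forall>i. coeff [:0, 1:] i \<in> R" by (auto simp: coeff_pCons R_closed split: nat.splits)
  then have "poly [:0, 1:] u \<in> S" unfolding S_def by blast
  then have "u \<in> S" by simp
  then have "S \<noteq> R" using assms by blast
  then have "\<not> subring_avoiding (1 / of_nat p) S" using maximal RS by blast
  moreover have "S \<subseteq> Qbar" using assms(1) R_closed(7) by (auto simp: S_def poly_altdef)
  moreover have "1 \<in> S" using RS R_closed by blast
  moreover have "a - b \<in> S \<and> a * b \<in> S" if "a \<in> S" "b \<in> S" for a b
  proof -
    from that obtain P Q where PQ: "\<forall>i. coeff P i \<in> R" "\<forall>i. coeff Q i \<in> R" "a = poly P u" "b = poly Q u"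
      by (auto simp: S_def)
    have "\<forall>i. coeff (P - Q) i \<in> R" using PQ R_closed by auto
    then have "poly (P - Q) u \<in> S" unfolding S_def by blast
    moreover have "\<forall>i. coeff (P * Q) i \<in> R" using PQ R_closed by (auto simp: coeff_mult intro!: R_sum)
    then have "poly (P * Q) u \<in> S" unfolding S_def by blast
    ultimately show ?thesis by (simp add: PQ)
  qed
  ultimately have "1 / of_nat p \<in> S" by (auto simp: subring_avoiding_def)
  then obtain P where P: "\<forall>i. coeff P i \<in> R" "1 / of_nat p = poly P u" by (auto simp: S_def)
  then have "of_nat p * (\<Sum>i\<le>degree P. coeff P i * u ^ i) = 1"
    using p_nz by (simp add: poly_altdef[symmetric] field_simps)
  then show ?thesis using P(1) unfolding relation_of_degree_def by blast
qed

text \<open>The two relations \<open>1 = p * f(u)\<close> and \<open>1 = p * g(1/u)\<close> of the same degree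
  \<open>n + 1\<close> are combined: the second one, multiplied by \<open>u ^ (n + 1)\<close>, eliminates the top term of the first.\<close>
lemma relation_step:
  assumes "u \<noteq> 0" "relation_of_degree (Suc n) u" "relation_of_degree (Suc n) (inverse u)"
  shows "relation_of_degree n u"
proof -
  let ?p = "of_nat p :: complex"
  obtain a where a: "\<And>i. a i \<in> R" "?p * (\<Sum>i\<le>Suc n. a i * u ^ i) = 1"
    using assms(2) by (auto simp: relation_of_degree_def)
  obtain b where b: "\<And>i. b i \<in> R" "?p * (\<Sum>i\<le>Suc n. b i * inverse u ^ i) = 1"
    using assms(3) by (auto simp: relation_of_degree_def)
  define s where "s = (\<Sum>i\<le>n. a i * u ^ i)"
  define t where "t = (\<Sum>i\<le>n. b (Suc n - i) * u ^ i)"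
  have "u ^ Suc n * (\<Sum>i\<le>Suc n. b i * inverse u ^ i) = (\<Sum>i\<le>Suc n. b i * u ^ (Suc n - i))"
    unfolding sum_distrib_left
    by (intro sum.cong refl) (use assms(1) in \<open>auto simp: power_diff power_inverse field_simps\<close>)
  also have "\<dots> = (\<Sum>i\<le>Suc n. b (Suc n - i) * u ^ i)"
    using sum.nat_diff_reindex[of "\<lambda>i. b i * u ^ (Suc n - i)" "Suc (Suc n)"]
    by (simp add: lessThan_Suc_atMost del: sum.lessThan_Suc sum.atMost_Suc)
  also have "\<dots> = t + b 0 * u ^ Suc n" by (simp add: t_def)
  finally have "u ^ Suc n = ?p * (t + b 0 * u ^ Suc n)"
    using b(2) by (metis mult.left_commute mult.right_neutral)
  then have 1: "(1 - ?p * b 0) * u ^ Suc n = ?p * t" by (subst left_diff_distrib) (simp add: diff_eq_eq algebra_simps del: power_Suc)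
  have 2: "?p * (s + a (Suc n) * u ^ Suc n) = 1" using a(2) by (simp add: s_def)
  \<comment> \<open>In 1 = p * b 0 + (1 - p * b 0) * 1 the last factor is replaced by the first
    relation. Its top term then carries the factor 1 - p * b 0 and can be rewritten by the second
    relation, without inverting that factor.\<close>
  define c where "c i = (if i = 0 then b 0 else 0) + (1 - ?p * b 0) * a i + ?p * a (Suc n) * b (Suc n - i)" for i
  have "(\<Sum>i\<le>n. c i * u ^ i) = b 0 + (1 - ?p * b 0) * s + ?p * a (Suc n) * t"
  proof -
    have "(\<Sum>i\<le>n. (if i = 0 then b 0 else 0) * u ^ i) = (\<Sum>i\<le>n. if i = 0 then b 0 else 0)"
      by (intro sum.cong) auto
    also have "\<dots> = b 0" by simp
    finally show ?thesis
      by (simp add: c_def s_def t_def distrib_right sum.distrib sum_distrib_left mult.assoc)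
  qed
  moreover have "?p * (b 0 + (1 - ?p * b 0) * s + ?p * a (Suc n) * t) = 1"
  proof -
    have "?p * (b 0 + (1 - ?p * b 0) * s + a (Suc n) * (?p * t)) =
      ?p * b 0 + (1 - ?p * b 0) * (?p * (s + a (Suc n) * u ^ Suc n))"
      unfolding 1[symmetric] by (simp add: algebra_simps)
    then show ?thesis unfolding 2 by (simp add: algebra_simps)
  qed
  moreover have "c i \<in> R" for i
    unfolding c_def using a(1) b(1) R_closed R_of_nat by auto
  ultimately show ?thesis unfolding relation_of_degree_def by metis
qed

text \<open>If both u and its inverse were missing, both would have relations of a common degree.
  \<open>relation_step\<close>, applied to u and to its inverse, lowers both degrees at once; in
  degree 0 a relation says that \<open>1 / p\<close> lies in R.\<close>

lemma valuation_ring: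
  assumes "u \<in> Qbar" "u \<noteq> 0"
  shows "u \<in> R \<or> inverse u \<in> R"
proof (rule ccontr)
  assume c: "\<not> (u \<in> R \<or> inverse u \<in> R)"
  then obtain n m where "relation_of_degree n u" "relation_of_degree m (inverse u)"
    using relation_exists[of u] relation_exists[of "inverse u"] assms by auto
  then have "relation_of_degree (max n m) u" "relation_of_degree (max n m) (inverse u)"
    using relation_mono by auto
  moreover have "\<not> (relation_of_degree k u \<and> relation_of_degree k (inverse u))" for k
  proof (induction k)
    case 0
    show ?case
    proof
      assume "relation_of_degree 0 u \<and> relation_of_degree 0 (inverse u)"
      then obtain a where "\<forall>i. a i \<in> R" "of_nat p * a (0::nat) = (1::complex)" unfolding relation_of_degree_def by auto
      moreover from this have "1 / of_nat p = a 0" using p_nz by (simp add: field_simps)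
      ultimately have "1 / of_nat p \<in> R" by simp
      then show False using inverse_p_notin by blast
    qed
  next
    case (Suc k)
    then show ?case using relation_step[of u k] relation_step[of "inverse u" k] assms(2) by auto
  qed
  ultimately show False by blast
qed

text \<open>The unit group of R. The explicit \<open>x \<noteq> 0\<close> is essential because
  \<open>inverse 0\<close> is 0, which lies in R.\<close>

definition U :: "complex set" where "U = {x\<in>R. inverse x \<in> R \<and> x \<noteq> 0}"

lemma U_closed:
  shows "1 \<in> U" "x \<in> U \<Longrightarrow> y \<in> U \<Longrightarrow> x * y \<in> U" "x \<in> U \<Longrightarrow> inverse x \<in> U"
    "x \<in> U \<Longrightarrow> y \<in> U \<Longrightarrow> x / y \<in> U" "x \<in> U \<Longrightarrow> x ^ n \<in> U"
proof -
  show *: "1 \<in> U" "x \<in> U \<Longrightarrow> y \<in> U \<Longrightarrow> x * y \<in> U" "x \<in> U \<Longrightarrow> inverse x \<in> U" for x y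
    by (auto simp: U_def R_closed)
  show "x \<in> U \<Longrightarrow> y \<in> U \<Longrightarrow> x / y \<in> U" by (simp add: divide_inverse *)
  show "x \<in> U \<Longrightarrow> x ^ n \<in> U" by (induction n) (auto simp: *)
qed

text \<open>From s * p + t * c = 1 one gets 1/p = s + t * (c/p), so c/p is not in R. Hence p/c is in
  R, and so is 1/c = s * (p/c) + t.\<close>

lemma int_coprime_in_U:
  assumes "\<not> int p dvd c" shows "of_int c \<in> U"
proof -
  have c0: "c \<noteq> 0" using assms by auto
  have "coprime (int p) c" using p assms by (simp add: prime_imp_coprime)
  then obtain s t where "s * int p + t * c = 1" by (metis bezout_int coprime_imp_gcd_eq_1)
  then have st: "of_int s * of_nat p + of_int t * of_int c = (1 :: complex)"
    by (metis of_int_1 of_int_add of_int_mult of_int_of_nat_eq)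
  have "of_int c / of_nat p \<notin> R"
  proof
    assume "of_int c / of_nat p \<in> R"
    then have "of_int s + of_int t * (of_int c / of_nat p) \<in> R" by (intro R_closed R_of_int)
    moreover have "of_int s + of_int t * (of_int c / of_nat p) = (1 / of_nat p :: complex)"
      using st p_nz by (simp add: field_simps)
    ultimately show False using inverse_p_notin by simp
  qed
  then have "inverse (of_int c / of_nat p) \<in> R"
    using valuation_ring[of "of_int c / of_nat p"] c0 p_nz by auto
  then have "of_int s * inverse (of_int c / of_nat p) + of_int t \<in> R" by (intro R_closed R_of_int)
  moreover have "of_int s * inverse (of_int c / of_nat p) + of_int t = (inverse (of_int c) :: complex)"
    using st c0 by (simp add: field_simps)
  ultimately show ?thesis using c0 R_of_int by (simp add: U_def)
qed

text \<open>R is local: of two non-zero non-units one divides the other, say a/b is in R, and if a +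
  b = b * (1 + a/b) were a unit then b would be one too.\<close>

lemma nonunit_sum:
  assumes "finite I" "\<And>i. i \<in> I \<Longrightarrow> f i \<in> R - U"
  shows "sum f I \<in> R - U"
proof -
  have add: "a + b \<in> R - U" if ab: "a \<in> R - U" "b \<in> R - U" for a b
  proof -
    have *: "a + b \<in> R - U" if ab: "a \<in> R - U" "b \<in> R - U" "b \<noteq> 0" "a / b \<in> R" for a b
    proof -
      have "a + b \<notin> U"
      proof
        assume "a + b \<in> U"
        then have "inverse (a + b) * (1 + a / b) \<in> R" "a + b \<noteq> 0"
          using that by (auto simp: U_def intro!: R_closed)
        moreover have "inverse (a + b) * (1 + a / b) = inverse b"
          using that(3) \<open>a + b \<noteq> 0\<close> by (simp add: field_simps)
        ultimately show False using ab by (simp add: U_def)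
      qed
      then show ?thesis using ab R_closed by auto
    qed
    show ?thesis
    proof (cases "a = 0 \<or> b = 0")
      case False
      then have "a / b \<in> R \<or> inverse (a / b) \<in> R"
        using valuation_ring[of "a / b"] ab R_closed(7) by auto
      then show ?thesis using *[of a b] *[of b a] ab False by (auto simp: add.commute)
    qed (use ab in auto)
  qed
  have "0 \<in> R - U" by (simp add: U_def R_closed)
  with assms show ?thesis
  proof (induction I rule: finite_induct)
    case (insert x F)
    then show ?case using add[of "f x" "sum f F"] by simp
  qed simp
qed

lemma exists_dominant_term:
  assumes "finite I" "I \<noteq> {}" "\<And>i. i \<in> I \<Longrightarrow> f i \<in> Qbar - {0}"
  shows "\<exists>k\<in>I. \<forall>i\<in>I. f i / f k \<in> R"
  using assms
proof (induction I rule: finite_ne_induct)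
  case (singleton x)
  then show ?case by (auto simp: R_closed)
next
  case (insert x F)
  then obtain k where k: "k \<in> F" "\<forall>i\<in>F. f i / f k \<in> R" by auto
  have nz: "f x \<noteq> 0" "f k \<noteq> 0" "f x \<in> Qbar" "f k \<in> Qbar" using insert k by auto
  then have "f x / f k \<in> R \<or> f k / f x \<in> R" using valuation_ring[of "f x / f k"] by auto
  then show ?case
  proof
    assume h: "f k / f x \<in> R"
    have "f i / f x \<in> R" if "i \<in> F" for i
    proof -
      have "(f i / f k) * (f k / f x) \<in> R" using k h that R_closed by blast
      then show ?thesis using nz by simp
    qed
    then show ?thesis using nz by (intro bexI[of _ x]) (auto simp: R_closed)
  qed (use k in auto)
qed

text \<open>States that x should have absolute value p to the power r: if x^n * p^m is a unit and p
  has size 1/p, then the size of x is p^(m/n). This yields a real-valued, correctly normalised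
  absolute value without studying the value group abstractly.\<close>

definition has_exponent :: "complex \<Rightarrow> real \<Rightarrow> bool" where
  "has_exponent x r \<longleftrightarrow> x \<noteq> 0 \<and> (\<exists>n>0. \<exists>m::int. x ^ n * of_nat p powi m \<in> U \<and> r = of_int m / of_nat n)"

lemma has_exponent_mult:
  assumes "has_exponent x r" "has_exponent y s"
  shows "has_exponent (x * y) (r + s)"
proof -
  obtain n m n' m' where h: "n > 0" "x ^ n * of_nat p powi m \<in> U" "r = of_int m / of_nat n"
    "n' > 0" "y ^ n' * of_nat p powi m' \<in> U" "s = of_int m' / of_nat n'" "x \<noteq> 0" "y \<noteq> 0"
    using assms by (auto simp: has_exponent_def)
  have "(x ^ n * of_nat p powi m) ^ n' * (y ^ n' * of_nat p powi m') ^ n \<in> U"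
    using h U_closed(2,5) by blast
  also have "(x ^ n * of_nat p powi m) ^ n' * (y ^ n' * of_nat p powi m') ^ n =
    (x * y) ^ (n * n') * of_nat p powi (m * int n' + m' * int n)"
    using p_nz by (simp add: power_mult_distrib power_mult[symmetric] mult.commute power_int_add
        power_int_mult power_int_of_nat)
  finally have "(x * y) ^ (n * n') * of_nat p powi (m * int n' + m' * int n) \<in> U" .
  moreover have "r + s = of_int (m * int n' + m' * int n) / of_nat (n * n')"
    using h by (simp add: field_simps)
  ultimately show ?thesis unfolding has_exponent_def using h
    by (intro conjI exI[of _ "n * n'"] exI[of _ "m * int n' + m' * int n"]) auto
qed

lemma has_exponent_inverse: "has_exponent x r \<Longrightarrow> has_exponent (inverse x) (- r)"
proof -
  assume "has_exponent x r"
  then obtain n m where h: "n > 0" "x ^ n * of_nat p powi m \<in> U" "r = of_int m / of_nat n" "x \<noteq> 0"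
    by (auto simp: has_exponent_def)
  have "inverse (x ^ n * of_nat p powi m) = inverse x ^ n * of_nat p powi (- m)"
    by (simp add: power_int_minus power_inverse)
  then have "inverse x ^ n * of_nat p powi (- m) \<in> U" using U_closed(3)[OF h(2)] by simp
  then show ?thesis using h unfolding has_exponent_def
    by (intro conjI exI[of _ n] exI[of _ "- m"]) auto
qed

text \<open>Identifies R with the closed unit ball. For r at most 0 the power x^n lies in R, and x =
  x^n * (1/x)^(n-1) follows if 1/x is in R. For r positive, x in R would put a negative power of p,
  and hence \<open>1 / p\<close>, into R.\<close>

lemma has_exponent_le_0_iff:
  assumes "has_exponent x r" "x \<in> Qbar" shows "r \<le> 0 \<longleftrightarrow> x \<in> R"
proof -
  obtain n m where h: "n > 0" "x ^ n * of_nat p powi m \<in> U" "r = of_int m / of_nat n" "x \<noteq> 0"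
    using assms by (auto simp: has_exponent_def)
  have r: "r \<le> 0 \<longleftrightarrow> m \<le> 0" using h by (simp add: divide_le_0_iff)
  define u where "u = x ^ n * of_nat p powi m"
  have u: "u \<in> U" "u \<in> R" "inverse u \<in> R" "u \<noteq> 0" using h(2) by (auto simp: u_def U_def)
  show ?thesis
  proof
    assume "r \<le> 0"
    then have "of_nat p powi (- m) = (of_nat p :: complex) ^ nat (- m)"
      using r by (simp add: power_int_def)
    then have "of_nat p powi (- m) \<in> R" by (simp add: R_power R_of_nat)
    then have "u * of_nat p powi (- m) \<in> R" using u R_closed by blast
    also have "u * of_nat p powi (- m) = x ^ n"
      using p_nz by (simp add: u_def power_int_minus)
    finally have xn: "x ^ n \<in> R" .
    show "x \<in> R"
    proof (rule ccontr)
      assume "x \<notin> R"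
      then have "inverse x \<in> R" using valuation_ring assms(2) h(4) by blast
      then have "x ^ n * inverse x ^ (n - 1) \<in> R" using xn R_power R_closed by blast
      moreover have "x ^ n * inverse x ^ (n - 1) = x"
        using h by (cases n) (auto simp: power_inverse)
      ultimately show False using \<open>x \<notin> R\<close> by simp
    qed
  next
    assume x: "x \<in> R"
    show "r \<le> 0"
    proof (rule ccontr)
      assume "\<not> r \<le> 0"
      then have m: "m > 0" using r by simp
      then have "of_nat p ^ (nat m - 1) * (x ^ n * inverse u) \<in> R"
        using x u by (intro R_closed R_power R_of_nat)
      moreover have "x ^ n * inverse u = inverse (of_nat p ^ nat m)"
        using h(4) m by (simp add: u_def power_int_def field_simps)
      moreover have "of_nat p ^ (nat m - 1) * inverse (of_nat p ^ nat m) = (1 / of_nat p :: complex)"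
        using m p_nz by (cases "nat m") (auto simp: field_simps)
      ultimately show False using inverse_p_notin by simp
    qed
  qed
qed

lemma U_has_exponent: "x \<in> U \<Longrightarrow> has_exponent x 0"
  unfolding has_exponent_def by (intro conjI exI[of _ 1] exI[of _ 0]) (auto simp: U_def)

text \<open>The quotient x/x = 1 has the exponents r - s and s - r, and 1 lies in R, so neither is
  positive.\<close>

lemma has_exponent_unique:
  assumes "has_exponent x r" "has_exponent x s" "x \<in> Qbar" shows "r = s"
proof -
  have x: "x \<noteq> 0" using assms by (simp add: has_exponent_def)
  have "has_exponent (x * inverse x) (r + - s)" "has_exponent (x * inverse x) (s + - r)"
    by (intro has_exponent_mult has_exponent_inverse assms)+
  then show ?thesis
    using has_exponent_le_0_iff[of 1 "r - s"] has_exponent_le_0_iff[of 1 "s - r"] x R_closed by simp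
qed

lemma has_exponent_int:
  assumes "c \<noteq> 0" shows "has_exponent (of_int c) (- real (multiplicity (int p) c))"
proof -
  let ?m = "multiplicity (int p) c"
  have "\<not> is_unit (int p)" using prime_gt_1_nat[OF p] by simp
  then obtain d where d: "c = int p ^ ?m * d" "\<not> int p dvd d"
    using multiplicity_decompose'[OF assms] by metis
  then have "of_int c * of_nat p powi (- int ?m) = (of_int d :: complex)"
  proof -
    have "(of_int c :: complex) = of_nat p ^ ?m * of_int d" by (subst d(1)) simp
    then show ?thesis using p_nz by (simp add: power_int_minus power_int_of_nat)
  qed
  then have "of_int c * of_nat p powi (- int ?m) \<in> U" using int_coprime_in_U[OF d(2)] by simp
  then show ?thesis unfolding has_exponent_def using assms
    by (intro conjI exI[of _ 1] exI[of _ "- int ?m"]) auto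
qed

lemma has_exponent_root:
  assumes "has_exponent (x ^ n) r" "n > 0" shows "has_exponent x (r / real n)"
proof -
  obtain k m where h: "k > 0" "(x ^ n) ^ k * of_nat p powi m \<in> U" "r = of_int m / of_nat k" "x ^ n \<noteq> 0"
    using assms by (auto simp: has_exponent_def)
  then show ?thesis unfolding has_exponent_def using assms(2)
    by (intro conjI exI[of _ "n * k"] exI[of _ m]) (auto simp: power_mult)
qed

text \<open>The terms of an integer equation for x sum to 0, so some other term must have the same
  size as the dominant one; otherwise -1 would be a sum of non-units. The quotient of these two
  terms being a unit, a power of x is a unit times a rational number, whose exponent is
  known.\<close>

lemma exists_exponent:
  assumes "x \<in> Qbar" "x \<noteq> 0" shows "\<exists>r. has_exponent x r"
proof -
  from assms have "algebraic x" by (simp add: Qbar_def)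
  then obtain f where f: "f \<noteq> 0" "poly (map_poly of_int f) x = 0" by (rule algebraicE')
  define T where "T i = of_int (coeff f i) * x ^ i" for i
  define I where "I = {i. i \<le> degree f \<and> coeff f i \<noteq> 0}"
  have fin: "finite I" by (simp add: I_def)
  have I: "degree f \<in> I" using f by (simp add: I_def)
  have T: "T i \<in> Qbar - {0}" if "i \<in> I" for i
    using that assms by (auto simp: T_def I_def)
  have "(\<Sum>i\<le>degree f. T i) = 0"
    using f(2) by (simp add: T_def poly_altdef coeff_map_poly degree_map_poly)
  also have "(\<Sum>i\<le>degree f. T i) = (\<Sum>i\<in>I. T i)"
    by (intro sum.mono_neutral_right) (auto simp: I_def T_def)
  finally have sum0: "(\<Sum>i\<in>I. T i) = 0" .
  obtain k where k: "k \<in> I" "\<forall>i\<in>I. T i / T k \<in> R"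
    using exists_dominant_term[of I T] fin T I by auto
  have "\<exists>i\<in>I - {k}. T i / T k \<in> U"
  proof (rule ccontr)
    assume "\<not> ?thesis"
    then have "(\<Sum>i\<in>I - {k}. T i / T k) \<in> R - U" using fin k by (intro nonunit_sum) auto
    moreover have "(\<Sum>i\<in>I - {k}. T i / T k) = - 1"
    proof -
      have "(\<Sum>i\<in>I. T i / T k) = 0" using sum0 by (simp add: sum_divide_distrib[symmetric])
      then have "T k / T k + (\<Sum>i\<in>I - {k}. T i / T k) = 0"
        using sum.remove[OF fin k(1), of "\<lambda>i. T i / T k"] by simp
      then show ?thesis using T[OF k(1)] by (simp add: eq_neg_iff_add_eq_0 add.commute)
    qed
    moreover have "- 1 \<in> U" by (simp add: U_def R_closed)
    ultimately show False by simp
  qed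
  then obtain i where i: "i \<in> I" "i \<noteq> k" "T i / T k \<in> U" by blast
  have *: "\<exists>r. has_exponent x r" if "i \<in> I" "k \<in> I" "k < i" "T i / T k \<in> U" for i k
  proof -
    define c d where "c = coeff f i" "d = coeff f k"
    have cd: "c \<noteq> 0" "d \<noteq> 0" using that by (auto simp: I_def c_d_def)
    obtain r s where rs: "has_exponent (of_int c) r" "has_exponent (of_int d) s"
      using has_exponent_int cd by blast
    have "has_exponent (T i / T k * (of_int d * inverse (of_int c))) (0 + (s + - r))"
      by (intro has_exponent_mult U_has_exponent has_exponent_inverse that rs)
    also have "T i / T k * (of_int d * inverse (of_int c)) = x ^ (i - k)"
      using cd assms that(3) by (simp add: T_def c_d_def[symmetric] power_diff field_simps)
    finally show ?thesis using has_exponent_root[of x "i - k"] that(3) by auto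
  qed
  show ?thesis
  proof (cases "k < i")
    case True
    then show ?thesis using * i k by blast
  next
    case False
    then have "i < k" using i by simp
    moreover have "T k / T i \<in> U" using U_closed(3)[OF i(3)] by simp
    ultimately show ?thesis using * i k by blast
  qed
qed

definition absval :: "complex \<Rightarrow> real" where
  "absval x = (if x \<in> Qbar - {0} then real p powr (THE r. has_exponent x r) else 0)"

lemma absval_eq: "has_exponent x r \<Longrightarrow> x \<in> Qbar \<Longrightarrow> absval x = real p powr r"
proof -
  assume h: "has_exponent x r" "x \<in> Qbar"
  then have "(THE r. has_exponent x r) = r" using has_exponent_unique by blast
  moreover have "x \<noteq> 0" using h by (simp add: has_exponent_def)
  ultimately show ?thesis using h by (simp add: absval_def)
qed

lemma place_over_absval: "place_over Qbar p absval"
proof -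
  have p1: "real p > 1" using prime_gt_1_nat[OF p] by simp
  have le1: "absval x \<le> 1 \<longleftrightarrow> x \<in> R" if "x \<in> Qbar" for x
  proof (cases "x = 0")
    case False
    then obtain r where r: "has_exponent x r" using exists_exponent \<open>x \<in> Qbar\<close> by blast
    have "absval x \<le> 1 \<longleftrightarrow> real p powr r \<le> real p powr 0" using absval_eq r that p1 by simp
    also have "\<dots> \<longleftrightarrow> r \<le> 0" using p1 by (subst powr_le_cancel_iff) auto
    finally show ?thesis using has_exponent_le_0_iff[OF r that] by simp
  qed (simp add: absval_def R_closed)
  have mult: "absval (a * b) = absval a * absval b" if ab: "a \<in> Qbar" "b \<in> Qbar" for a b
  proof (cases "a = 0 \<or> b = 0")
    case False
    then obtain r s where rs: "has_exponent a r" "has_exponent b s" using exists_exponent ab by blast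
    then show ?thesis using absval_eq[OF has_exponent_mult[OF rs]] absval_eq ab by (simp add: powr_add)
  qed (auto simp: absval_def)
  have pos: "absval a > 0" if "a \<in> Qbar" "a \<noteq> 0" for a using that p1 by (simp add: absval_def)
  \<comment> \<open>Dividing by the larger summand reduces the ultrametric inequality to closure of
    the unit ball R under addition of 1.\<close>
  have ultra: "absval (a + b) \<le> absval b" if ab: "a \<in> Qbar" "b \<in> Qbar" "b \<noteq> 0" "absval a \<le> absval b" for a b
  proof -
    have "absval (a / b) * absval b = absval a" using mult[of "a / b" b] ab by simp
    then have "absval (a / b) \<le> 1" using pos[OF ab(2,3)] ab(4)
      by (metis mult_le_cancel_right2 not_less_iff_gr_or_eq)
    then have "1 + a / b \<in> R" using le1 ab R_closed by auto
    then have "absval (1 + a / b) \<le> 1" using le1 ab by auto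
    moreover have "absval (a + b) = absval (1 + a / b) * absval b"
      using mult[of "1 + a / b" b] ab by (simp add: distrib_right add.commute)
    ultimately show ?thesis using pos[OF ab(2,3)] by (simp add: mult_le_cancel_right2)
  qed
  have "absval (a + b) \<le> max (absval a) (absval b)" if "a \<in> Qbar" "b \<in> Qbar" for a b
  proof (cases "a = 0 \<or> b = 0")
    case False
    then show ?thesis using ultra[of a b] ultra[of b a] that by (auto simp: add.commute max_def)
  qed (auto simp: absval_def)
  moreover have "absval (of_rat q) = padic_abs p q" for q
  proof (cases "q = 0")
    case False
    obtain c d where cd: "q = Fract c d" "d > 0" by (cases q) auto
    then have q: "q = of_int c / of_int d" by (simp add: Fract_of_int_quotient)
    have nz: "c \<noteq> 0" "d \<noteq> 0" using False cd q by auto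
    have "has_exponent (of_int c * inverse (of_int d))
      (- real (multiplicity (int p) c) + - (- real (multiplicity (int p) d)))"
      by (intro has_exponent_mult has_exponent_inverse has_exponent_int nz)
    moreover have "of_int c * inverse (of_int d) = (of_rat q :: complex)"
      by (simp add: q divide_inverse of_rat_mult of_rat_inverse)
    ultimately show ?thesis using absval_eq[of "of_rat q"] padic_abs_fraction[OF p nz]
      by (simp add: q)
  qed (simp add: absval_def)
  ultimately show ?thesis using mult pos p
    by (auto simp: place_over_def nonarch_place_def absval_def)
qed

end

text \<open>Zorn's lemma starts from the ring of integers, which does not contain
  \<open>1 / p\<close>.\<close>

theorem exists_place_over_Qbar:
  assumes p: "prime p"
  shows "\<exists>v. place_over Qbar p v"
proof -
  let ?y = "1 / of_nat p :: complex"
  let ?A = "Collect (subring_avoiding ?y)"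
  have p1: "p > 1" using prime_gt_1_nat[OF p] .
  have "?y \<notin> \<int>"
  proof
    assume "?y \<in> \<int>"
    then obtain k where k: "?y = of_int k" by (auto elim: Ints_cases)
    then have "of_int (k * int p) = (1 :: complex)" using p1 by (simp add: field_simps)
    then have "k * int p = 1" by (metis of_int_eq_1_iff)
    then have "int p dvd 1" by (metis dvd_triv_right)
    then show False using p1 by simp
  qed
  then have "subring_avoiding ?y \<int>"
    by (auto simp: subring_avoiding_def elim!: Ints_cases)
  then have ne: "?A \<noteq> {}" by blast
  have "\<exists>M\<in>?A. \<forall>X\<in>?A. M \<subseteq> X \<longrightarrow> X = M"
  proof (rule subset_Zorn_nonempty[OF ne])
    fix C assume C: "C \<noteq> {}" "subset.chain ?A C"
    have gr: "subring_avoiding ?y X" if "X \<in> C" for X using C(2) that by (auto simp: subset_chain_def)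
    have ch: "X \<subseteq> Y \<or> Y \<subseteq> X" if "X \<in> C" "Y \<in> C" for X Y
      using C(2) that by (auto simp: subset_chain_def)
    have "a - b \<in> \<Union>C \<and> a * b \<in> \<Union>C" if ab: "a \<in> \<Union>C" "b \<in> \<Union>C" for a b
    proof -
      obtain X where X: "X \<in> C" "a \<in> X" "b \<in> X" using ab ch by blast
      then show ?thesis using subring_avoiding_closed(3,4)[OF gr[OF X(1)]] by blast
    qed
    moreover have "\<Union>C \<subseteq> Qbar" "?y \<notin> \<Union>C" "1 \<in> \<Union>C"
      using gr C(1) by (auto simp: subring_avoiding_def)
    ultimately show "\<Union>C \<in> ?A" by (auto simp: subring_avoiding_def)
  qed
  then obtain R where R: "subring_avoiding ?y R" "\<And>S. subring_avoiding ?y S \<Longrightarrow> R \<subseteq> S \<Longrightarrow> S = R"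
    by blast
  interpret maximal_ring p R by unfold_locales (use p R in auto)
  show ?thesis using place_over_absval by blast
qed

section \<open>The Galois group\<close>

text \<open>The group theory library claims the token \<open>inv\<close>.\<close>
abbreviation ginv :: "(complex \<Rightarrow> complex) \<Rightarrow> complex \<Rightarrow> complex" where
  "ginv \<equiv> inv_into UNIV"

text \<open>Since elements of \<open>Gal\<close> are the identity off \<open>Qbar\<close>, they
  permute all complex numbers, and \<open>ginv\<close> really is the group inverse.\<close>

lemma Gal_bij: assumes "\<sigma> \<in> Gal" shows "bij \<sigma>"
proof -
  have b: "bij_betw \<sigma> Qbar Qbar" and o: "\<And>z. z \<notin> Qbar \<Longrightarrow> \<sigma> z = z"
    using assms by (auto simp: Gal_def)
  have "bij_betw \<sigma> (- Qbar) (- Qbar)"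
    using o by (auto simp: bij_betw_def inj_on_def image_iff)
  from bij_betw_combine[OF b this] show ?thesis by (simp add: Compl_partition)
qed

lemma Gal_inj: "\<sigma> \<in> Gal \<Longrightarrow> \<sigma> x = \<sigma> y \<longleftrightarrow> x = y"
  using Gal_bij by (auto dest: bij_is_inj injD)

lemma Gal_Qbar: "\<sigma> \<in> Gal \<Longrightarrow> \<sigma> x \<in> Qbar \<longleftrightarrow> x \<in> Qbar"
  unfolding Gal_def by (auto dest: bij_betwE)

lemma Gal_add: "\<sigma> \<in> Gal \<Longrightarrow> a \<in> Qbar \<Longrightarrow> b \<in> Qbar \<Longrightarrow> \<sigma> (a + b) = \<sigma> a + \<sigma> b"
  and Gal_mult: "\<sigma> \<in> Gal \<Longrightarrow> a \<in> Qbar \<Longrightarrow> b \<in> Qbar \<Longrightarrow> \<sigma> (a * b) = \<sigma> a * \<sigma> b"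
  and Gal_1: "\<sigma> \<in> Gal \<Longrightarrow> \<sigma> 1 = 1"
  by (auto simp: Gal_def)

lemma Gal_0: "\<sigma> \<in> Gal \<Longrightarrow> \<sigma> 0 = 0"
  using Gal_add[of \<sigma> 0 0] by simp

lemma Gal_eq_0_iff: "\<sigma> \<in> Gal \<Longrightarrow> \<sigma> x = 0 \<longleftrightarrow> x = 0"
  using Gal_inj[of \<sigma> x 0] by (simp add: Gal_0)

lemma Gal_uminus: "\<sigma> \<in> Gal \<Longrightarrow> a \<in> Qbar \<Longrightarrow> \<sigma> (- a) = - \<sigma> a"
  using Gal_add[of \<sigma> a "- a"] by (simp add: Gal_0 eq_neg_iff_add_eq_0 add.commute)

lemma Gal_diff: "\<sigma> \<in> Gal \<Longrightarrow> a \<in> Qbar \<Longrightarrow> b \<in> Qbar \<Longrightarrow> \<sigma> (a - b) = \<sigma> a - \<sigma> b"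
  using Gal_add[of \<sigma> a "- b"] by (simp add: Gal_uminus)

lemma Gal_inverse: "\<sigma> \<in> Gal \<Longrightarrow> a \<in> Qbar \<Longrightarrow> \<sigma> (inverse a) = inverse (\<sigma> a)"
proof (cases "a = 0")
  case False
  assume "\<sigma> \<in> Gal" "a \<in> Qbar"
  then have "\<sigma> a * \<sigma> (inverse a) = 1" using Gal_mult[of \<sigma> a "inverse a"] False by (simp add: Gal_1)
  then show ?thesis by (metis inverse_unique)
qed (simp add: Gal_0)

lemma Gal_divide: "\<sigma> \<in> Gal \<Longrightarrow> a \<in> Qbar \<Longrightarrow> b \<in> Qbar \<Longrightarrow> \<sigma> (a / b) = \<sigma> a / \<sigma> b"
  by (simp add: divide_inverse Gal_mult Gal_inverse)

lemma Gal_power: "\<sigma> \<in> Gal \<Longrightarrow> a \<in> Qbar \<Longrightarrow> \<sigma> (a ^ n) = \<sigma> a ^ n"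
  by (induction n) (auto simp: Gal_mult Gal_1)

lemma Gal_sum: "\<sigma> \<in> Gal \<Longrightarrow> (\<And>i. i \<in> I \<Longrightarrow> f i \<in> Qbar) \<Longrightarrow> \<sigma> (sum f I) = (\<Sum>i\<in>I. \<sigma> (f i))"
  by (induction I rule: infinite_finite_induct) (auto simp: Gal_add Gal_0)

lemma Gal_prod: "\<sigma> \<in> Gal \<Longrightarrow> (\<And>i. i \<in> I \<Longrightarrow> f i \<in> Qbar) \<Longrightarrow> \<sigma> (prod f I) = (\<Prod>i\<in>I. \<sigma> (f i))"
  by (induction I rule: infinite_finite_induct) (auto simp: Gal_mult Gal_1)

lemma Gal_of_nat: "\<sigma> \<in> Gal \<Longrightarrow> \<sigma> (of_nat n) = of_nat n"
  by (induction n) (auto simp: Gal_add Gal_0 Gal_1)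

lemma Gal_of_int: "\<sigma> \<in> Gal \<Longrightarrow> \<sigma> (of_int n) = of_int n"
  by (cases n rule: int_cases2) (auto simp: Gal_uminus Gal_of_nat)

lemma Gal_of_rat: "\<sigma> \<in> Gal \<Longrightarrow> \<sigma> (of_rat q) = of_rat q"
  by (cases q) (auto simp: of_rat_rat Gal_divide Gal_of_int)

lemma Gal_id [simp]: "id \<in> Gal"
  unfolding Gal_def by simp

lemma Gal_comp [simp]: assumes "\<sigma> \<in> Gal" "\<tau> \<in> Gal" shows "\<sigma> \<circ> \<tau> \<in> Gal"
proof -
  have o: "\<sigma> z = z" "\<tau> z = z" if "z \<notin> Qbar" for z using assms that by (auto simp: Gal_def)
  have "bij_betw \<sigma> Qbar Qbar" "bij_betw \<tau> Qbar Qbar" using assms by (auto simp: Gal_def)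
  then have "bij_betw (\<sigma> \<circ> \<tau>) Qbar Qbar" by (metis bij_betw_trans)
  moreover have "\<forall>a\<in>Qbar. \<forall>b\<in>Qbar. (\<sigma> \<circ> \<tau>) (a + b) = (\<sigma> \<circ> \<tau>) a + (\<sigma> \<circ> \<tau>) b \<and>
      (\<sigma> \<circ> \<tau>) (a * b) = (\<sigma> \<circ> \<tau>) a * (\<sigma> \<circ> \<tau>) b"
    using assms by (simp add: Gal_add Gal_mult Gal_Qbar)
  moreover have "(\<sigma> \<circ> \<tau>) 1 = 1" using assms by (simp add: Gal_1)
  moreover have "\<forall>z. z \<notin> Qbar \<longrightarrow> (\<sigma> \<circ> \<tau>) z = z" using o by simp
  ultimately show ?thesis unfolding Gal_def by blast
qed

lemma Gal_inv [simp]: assumes s: "\<sigma> \<in> Gal" shows "ginv \<sigma> \<in> Gal"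
proof -
  have b: "bij \<sigma>" by (rule Gal_bij[OF s])
  have r: "\<sigma> (ginv \<sigma> x) = x" and l: "ginv \<sigma> (\<sigma> x) = x" for x
    using b by (simp_all add: bij_is_surj surj_f_inv_f bij_is_inj)
  have Q: "ginv \<sigma> x \<in> Qbar \<longleftrightarrow> x \<in> Qbar" for x using Gal_Qbar[OF s, of "ginv \<sigma> x"] r by simp
  have "bij_betw (ginv \<sigma>) Qbar Qbar"
    by (rule bij_betw_byWitness[where f' = \<sigma>]) (use r l Q Gal_Qbar[OF s] in auto)
  moreover have "ginv \<sigma> (a + b) = ginv \<sigma> a + ginv \<sigma> b" "ginv \<sigma> (a * b) = ginv \<sigma> a * ginv \<sigma> b"
    if "a \<in> Qbar" "b \<in> Qbar" for a b
    using that Gal_add[OF s, of "ginv \<sigma> a" "ginv \<sigma> b"] Gal_mult[OF s, of "ginv \<sigma> a" "ginv \<sigma> b"] Q r l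
    by metis+
  moreover have "ginv \<sigma> 1 = 1" using l[of 1] s by (simp add: Gal_1)
  moreover have "ginv \<sigma> z = z" if "z \<notin> Qbar" for z using l[of z] s that by (simp add: Gal_def)
  ultimately show ?thesis by (auto simp: Gal_def)
qed

lemma Gal_inv_right: "\<sigma> \<in> Gal \<Longrightarrow> \<sigma> (ginv \<sigma> x) = x" and Gal_inv_left: "\<sigma> \<in> Gal \<Longrightarrow> ginv \<sigma> (\<sigma> x) = x"
  using Gal_bij[of \<sigma>] by (simp_all add: bij_is_surj surj_f_inv_f bij_is_inj)

subsection \<open>Conjugates\<close>

definition conjs :: "complex \<Rightarrow> complex set" where "conjs x = (\<lambda>\<sigma>. \<sigma> x) ` Gal"

lemma Gal_int_poly_root:
  assumes "\<sigma> \<in> Gal" "x \<in> Qbar" "poly (map_poly of_int f) x = 0"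
  shows "poly (map_poly of_int f) (\<sigma> x) = 0"
proof -
  have "poly (map_poly of_int f) (\<sigma> x) = \<sigma> (poly (map_poly of_int f) x)"
    using assms(1,2) by (simp add: poly_altdef coeff_map_poly degree_map_poly Gal_sum Gal_mult Gal_power Gal_of_int)
  then show ?thesis using assms by (simp add: Gal_0)
qed

lemma finite_conjs: "x \<in> Qbar \<Longrightarrow> finite (conjs x)"
proof -
  assume x: "x \<in> Qbar"
  then have "algebraic x" by (simp add: Qbar_def)
  then obtain f where f: "f \<noteq> 0" "poly (map_poly of_int f) x = 0" by (rule algebraicE')
  have "map_poly of_int f \<noteq> (0 :: complex poly)" using f(1) by (auto simp: poly_eq_iff coeff_map_poly)
  then have "finite {z :: complex. poly (map_poly of_int f) z = 0}" by (rule poly_roots_finite)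
  then show ?thesis
    by (rule finite_subset[rotated]) (use Gal_int_poly_root x f in \<open>auto simp: conjs_def\<close>)
qed

lemma self_conjs [simp]: "x \<in> conjs x"
  unfolding conjs_def using Gal_id by (metis id_apply image_iff)

lemma conjs_subset: "x \<in> Qbar \<Longrightarrow> conjs x \<subseteq> Qbar"
  by (auto simp: conjs_def Gal_Qbar)

lemma Gal_image_conjs: assumes "\<sigma> \<in> Gal" shows "\<sigma> ` conjs x = conjs x"
proof
  show "\<sigma> ` conjs x \<subseteq> conjs x"
  proof clarify
    fix y assume "y \<in> conjs x"
    then obtain \<tau> where "\<tau> \<in> Gal" "y = \<tau> x" by (auto simp: conjs_def)
    then show "\<sigma> y \<in> conjs x" unfolding conjs_def
      by (intro image_eqI[where x = "\<sigma> \<circ> \<tau>"]) (use assms in simp_all)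
  qed
  show "conjs x \<subseteq> \<sigma> ` conjs x"
  proof
    fix y assume "y \<in> conjs x"
    then obtain \<tau> where \<tau>: "\<tau> \<in> Gal" "y = \<tau> x" by (auto simp: conjs_def)
    then have "y = \<sigma> ((ginv \<sigma> \<circ> \<tau>) x)" using assms by (simp add: Gal_inv_right)
    moreover have "(ginv \<sigma> \<circ> \<tau>) x \<in> conjs x" unfolding conjs_def
      by (rule image_eqI[where x = "ginv \<sigma> \<circ> \<tau>"]) (use assms \<tau> in simp_all)
    ultimately show "y \<in> \<sigma> ` conjs x" by blast
  qed
qed

lemma Gal_conjs_iff: "\<sigma> \<in> Gal \<Longrightarrow> \<sigma> y \<in> conjs x \<longleftrightarrow> y \<in> conjs x"
  using Gal_image_conjs[of \<sigma> x] inj_image_mem_iff[OF bij_is_inj[OF Gal_bij], of \<sigma> y "conjs x"] by simp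

lemma Gal_prod_conjs:
  assumes "\<sigma> \<in> Gal" "\<And>o'. o' \<in> conjs x \<Longrightarrow> g (\<sigma> o') = \<sigma> (g o')" "\<And>o'. o' \<in> conjs x \<Longrightarrow> g o' \<in> Qbar"
  shows "\<sigma> (\<Prod>o'\<in>conjs x. g o') = (\<Prod>o'\<in>conjs x. g o')"
proof -
  have "(\<Prod>o'\<in>conjs x. g o') = (\<Prod>o'\<in>\<sigma> ` conjs x. g o')" using Gal_image_conjs[OF assms(1)] by simp
  also have "\<dots> = (\<Prod>o'\<in>conjs x. g (\<sigma> o'))"
    using Gal_inj[OF assms(1)] by (subst prod.reindex) (auto simp: inj_on_def)
  also have "\<dots> = \<sigma> (\<Prod>o'\<in>conjs x. g o')" using assms by (simp add: Gal_prod)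
  finally show ?thesis by simp
qed

section \<open>Polynomials with conjugate roots and primitive elements\<close>

lemma Gal_poly:
  assumes "\<sigma> \<in> Gal" "\<And>i. coeff P i \<in> Qbar" "x \<in> Qbar"
  shows "\<sigma> (poly P x) = poly (map_poly \<sigma> P) (\<sigma> x)"
proof -
  have "degree (map_poly \<sigma> P) = degree P"
    by (rule degree_map_poly) (use Gal_eq_0_iff[OF assms(1)] in auto)
  then show ?thesis using assms
    by (simp add: poly_altdef coeff_map_poly Gal_0 Gal_sum Gal_mult Gal_power)
qed

lemma Gal_fixed_poly_rational:
  assumes "\<And>i. coeff P i \<in> Qbar" "\<And>\<sigma>. \<sigma> \<in> Gal \<Longrightarrow> map_poly \<sigma> P = P"
  shows "coeff P i \<in> \<rat>"
proof (rule Gal_fixed_imp_rational)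
  fix \<sigma> assume s: "\<sigma> \<in> Gal"
  then have "coeff (map_poly \<sigma> P) i = coeff P i" using assms(2) by simp
  then show "\<sigma> (coeff P i) = coeff P i" using s by (simp add: coeff_map_poly Gal_0)
qed (rule assms)

lemma poly_eq_0_if_many_roots:
  fixes P :: "complex poly"
  assumes "finite T" "degree P < card T" "\<And>t. t \<in> T \<Longrightarrow> poly P t = 0"
  shows "P = 0"
proof (rule ccontr)
  assume P: "P \<noteq> 0"
  have "card T \<le> card {x. poly P x = 0}"
    by (rule card_mono) (use assms P in \<open>auto simp: poly_roots_finite\<close>)
  also have "\<dots> \<le> degree P" using P by (rule card_poly_roots_bound)
  finally show False using assms by simp
qed

lemma Qbar_coeffs_mult:
  assumes "\<And>i. coeff P i \<in> Qbar" "\<And>i. coeff Q i \<in> Qbar"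
  shows "coeff (P * Q) i \<in> Qbar"
  unfolding coeff_mult using assms by auto

lemma Qbar_coeffs_linear_prod:
  assumes "T \<subseteq> Qbar"
  shows "coeff (\<Prod>t\<in>T. [:- t, 1:]) i \<in> Qbar"
  using assms
proof (induction T arbitrary: i rule: infinite_finite_induct)
  case (insert x F)
  have "coeff ([:- x, 1:] * (\<Prod>t\<in>F. [:- t, 1:])) i \<in> Qbar"
    by (rule Qbar_coeffs_mult) (use insert in \<open>auto simp: coeff_pCons split: nat.splits\<close>)
  then show ?case using insert by simp
qed (auto simp: one_pCons coeff_pCons split: nat.splits)

text \<open>The minimal polynomial of an algebraic x over the rationals, given by its distinct
  roots.\<close>

definition conj_poly :: "complex \<Rightarrow> complex poly" where
  "conj_poly x = (\<Prod>o'\<in>conjs x. [:- o', 1:])"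

lemma degree_linear_prod: "degree (\<Prod>t\<in>T. [:- t, 1:] :: complex poly) = card T"
proof (induction T rule: infinite_finite_induct)
  case (insert x F)
  have "degree ([:- x, 1:] * (\<Prod>t\<in>F. [:- t, 1:])) = degree [:- x, 1:] + degree (\<Prod>t\<in>F. [:- t, 1:])"
    by (rule degree_mult_eq) (use insert in \<open>auto simp: prod_zero_iff\<close>)
  then show ?case using insert by (simp del: mult_pCons_left)
qed auto

lemma lead_coeff_linear_prod: "lead_coeff (\<Prod>t\<in>T. [:- t, 1:] :: complex poly) = 1"
  by (simp add: lead_coeff_prod)

text \<open>Applying \<sigma> permutes the roots, so the polynomial and its image are monic of equal
  degree with the same roots. Their difference has too many roots for its degree.\<close>

lemma conj_poly_rational:
  assumes x: "x \<in> Qbar" shows "coeff (conj_poly x) i \<in> \<rat>"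
proof (rule Gal_fixed_poly_rational)
  show c: "coeff (conj_poly x) i \<in> Qbar" for i
    unfolding conj_poly_def by (rule Qbar_coeffs_linear_prod[OF conjs_subset[OF x]])
  fix \<sigma> assume s: "\<sigma> \<in> Gal"
  let ?P = "conj_poly x" and ?Q = "map_poly \<sigma> (conj_poly x)"
  have deg: "degree ?P = card (conjs x)" "degree ?Q = card (conjs x)" and lc: "lead_coeff ?P = 1"
    using Gal_eq_0_iff[OF s] lead_coeff_linear_prod[of "conjs x"]
    by (simp_all add: degree_map_poly conj_poly_def degree_linear_prod)
  have card: "card (conjs x) > 0" using finite_conjs[OF x] self_conjs[of x] unfolding card_gt_0_iff by blast
  have "?Q - ?P = 0"
  proof (rule poly_eq_0_if_many_roots[OF finite_conjs[OF x]])
    have "coeff (?Q - ?P) (card (conjs x)) = 0"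
      using lc deg s by (simp add: coeff_map_poly Gal_0 Gal_1)
    moreover have "degree (?Q - ?P) \<le> card (conjs x)"
      by (rule degree_diff_le) (simp_all add: deg)
    ultimately show "degree (?Q - ?P) < card (conjs x)"
      using card by (metis leading_coeff_0_iff degree_0 le_neq_implies_less)
    fix t assume t: "t \<in> conjs x"
    then obtain t' where t': "t' \<in> conjs x" "t = \<sigma> t'" using Gal_image_conjs[OF s, of x] by blast
    have 0: "poly ?P t = 0" if "t \<in> conjs x" for t
      using that finite_conjs[OF x] by (auto simp: conj_poly_def poly_prod)
    have "poly ?Q t = \<sigma> (poly ?P t')" using Gal_poly[OF s c] t' conjs_subset[OF x] by auto
    then show "poly (?Q - ?P) t = 0" using 0 t t' s by (simp add: Gal_0)
  qed
  then show "?Q = ?P" by simp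
qed

text \<open>The primitive element argument: \<open>\<theta> + t * s\<close> works for every natural
  t outside a finite set. Separation is phrased through automorphisms because restrictions of these
  are what gets counted later.\<close>

lemma separating_element:
  assumes "finite S" "S \<subseteq> Qbar"
  shows "\<exists>\<theta>\<in>rvs.span S. \<theta> \<in> Qbar \<and> (\<forall>\<sigma>\<in>Gal. \<forall>\<tau>\<in>Gal. \<sigma> \<theta> = \<tau> \<theta> \<longrightarrow> (\<forall>s\<in>S. \<sigma> s = \<tau> s))"
  using assms
proof (induction S rule: finite_induct)
  case empty
  show ?case by (intro bexI[of _ 0]) (auto simp: rvs.span_zero)
next
  case (insert s S)
  then obtain \<theta> where \<theta>: "\<theta> \<in> rvs.span S" "\<theta> \<in> Qbar"
    "\<And>\<sigma> \<tau>. \<sigma> \<in> Gal \<Longrightarrow> \<tau> \<in> Gal \<Longrightarrow> \<sigma> \<theta> = \<tau> \<theta> \<Longrightarrow> (\<forall>s\<in>S. \<sigma> s = \<tau> s)" by auto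
  have s: "s \<in> Qbar" using insert by auto
  \<comment> \<open>These are the only values of t at which two automorphisms that differ on s could
    agree on \<open>\<theta> + t * s\<close>. Pairs with equal w and \<open>w'\<close> contribute
    only 0, as division by zero yields 0.\<close>
  define bad where "bad = (\<lambda>(u, u', w, w'). (u' - u) / (w - w')) ` (conjs \<theta> \<times> conjs \<theta> \<times> conjs s \<times> conjs s)"
  have "finite bad" unfolding bad_def using finite_conjs \<theta>(2) s by auto
  then have "finite (of_nat -` bad :: nat set)"
    by (rule finite_vimageI) (auto simp: inj_on_def)
  then obtain t :: nat where t: "of_nat t \<notin> bad" by (metis ex_new_if_finite infinite_UNIV_nat vimage_eq)
  define \<eta> where "\<eta> = \<theta> + of_nat t * s"
  have \<eta>Q: "\<eta> \<in> Qbar" using \<theta> s by (simp add: \<eta>_def)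
  have "of_nat t * s = of_rat (of_nat t) * s" by simp
  then have "\<eta> \<in> rvs.span (insert s S)" unfolding \<eta>_def
    using \<theta>(1) rvs.span_mono[of S "insert s S"] rvs.span_scale[OF rvs.span_base[of s "insert s S"]]
    by (metis insertI1 rvs.span_add subset_iff subset_insertI)
  moreover have "\<forall>a\<in>insert s S. \<sigma> a = \<tau> a" if st: "\<sigma> \<in> Gal" "\<tau> \<in> Gal" "\<sigma> \<eta> = \<tau> \<eta>" for \<sigma> \<tau>
  proof -
    have eq: "\<sigma> \<theta> + of_nat t * \<sigma> s = \<tau> \<theta> + of_nat t * \<tau> s"
      using st s \<theta>(2) by (simp add: \<eta>_def Gal_add Gal_mult Gal_of_nat)
    have ss: "\<sigma> s = \<tau> s"
    proof (rule ccontr)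
      assume "\<sigma> s \<noteq> \<tau> s"
      then have "of_nat t = (\<tau> \<theta> - \<sigma> \<theta>) / (\<sigma> s - \<tau> s)" using eq by (simp add: field_simps)
      moreover have "(\<sigma> \<theta>, \<tau> \<theta>, \<sigma> s, \<tau> s) \<in> conjs \<theta> \<times> conjs \<theta> \<times> conjs s \<times> conjs s"
        using st by (auto simp: conjs_def)
      ultimately have "of_nat t \<in> bad" unfolding bad_def by (force intro: image_eqI)
      then show False using t by blast
    qed
    then show ?thesis using eq \<theta>(3)[OF st(1,2)] by simp
  qed
  ultimately show ?case using \<eta>Q by (intro bexI[of _ \<eta>]) auto
qed

subsection \<open>Averaging over the Galois group\<close>

text \<open>Each element represents a coset of the pointwise stabilizer of S. For a finite set S of
  algebraic numbers this is a finite quotient of the Galois group, and \<sigma> is cut off by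
  \<open>restrict\<close> so that cosets become equal functions.\<close>

definition Emb :: "complex set \<Rightarrow> (complex \<Rightarrow> complex) set" where
  "Emb S = (\<lambda>\<sigma>. restrict \<sigma> S) ` Gal"

definition depends :: "complex set \<Rightarrow> ((complex \<Rightarrow> complex) \<Rightarrow> 'a) \<Rightarrow> bool" where
  "depends S h \<longleftrightarrow> (\<forall>\<sigma>\<in>Gal. \<forall>\<tau>\<in>Gal. (\<forall>s\<in>S. \<sigma> s = \<tau> s) \<longrightarrow> h \<sigma> = h \<tau>)"

definition lift :: "complex set \<Rightarrow> (complex \<Rightarrow> complex) \<Rightarrow> (complex \<Rightarrow> complex)" where
  "lift S e = (SOME \<sigma>. \<sigma> \<in> Gal \<and> restrict \<sigma> S = e)"

definition avg_on :: "complex set \<Rightarrow> ((complex \<Rightarrow> complex) \<Rightarrow> real) \<Rightarrow> real" where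
  "avg_on S h = (\<Sum>e\<in>Emb S. h (lift S e)) / real (card (Emb S))"

text \<open>Integration of a locally constant function against normalised Haar measure. The chosen S
  is immaterial, which is the content of \<open>avg_eq\<close>.\<close>

definition avg :: "((complex \<Rightarrow> complex) \<Rightarrow> real) \<Rightarrow> real" where
  "avg h = avg_on (SOME S. finite S \<and> S \<subseteq> Qbar \<and> depends S h) h"

lemma dependsD: "depends S h \<Longrightarrow> \<sigma> \<in> Gal \<Longrightarrow> \<tau> \<in> Gal \<Longrightarrow> (\<And>s. s \<in> S \<Longrightarrow> \<sigma> s = \<tau> s) \<Longrightarrow> h \<sigma> = h \<tau>"
  unfolding depends_def by blast

lemma depends_mono: "depends S h \<Longrightarrow> S \<subseteq> T \<Longrightarrow> depends T h"
  unfolding depends_def by blast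

lemma lift_Emb: assumes "e \<in> Emb S" shows "lift S e \<in> Gal" "restrict (lift S e) S = e"
proof -
  from assms have "\<exists>\<sigma>. \<sigma> \<in> Gal \<and> restrict \<sigma> S = e" by (auto simp: Emb_def)
  from someI_ex[OF this] show "lift S e \<in> Gal" "restrict (lift S e) S = e" by (auto simp: lift_def)
qed

lemma restrict_Emb: "\<sigma> \<in> Gal \<Longrightarrow> restrict \<sigma> S \<in> Emb S"
  by (auto simp: Emb_def)

lemma depends_lift:
  assumes "depends S h" "\<sigma> \<in> Gal" shows "h (lift S (restrict \<sigma> S)) = h \<sigma>"
proof (rule dependsD[OF assms(1) lift_Emb(1) assms(2)])
  show "restrict \<sigma> S \<in> Emb S" using assms by (simp add: restrict_Emb)
  fix s assume "s \<in> S"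
  then show "lift S (restrict \<sigma> S) s = \<sigma> s"
    using lift_Emb(2)[OF restrict_Emb[OF assms(2)], of S] by (metis restrict_apply')
qed

lemma finite_Emb: assumes "finite S" "S \<subseteq> Qbar" shows "finite (Emb S)"
proof (rule finite_subset)
  show "Emb S \<subseteq> PiE S conjs" by (auto simp: Emb_def conjs_def)
  show "finite (PiE S conjs)" using assms finite_conjs by (intro finite_PiE) auto
qed

lemma card_Emb_pos: assumes "finite S" "S \<subseteq> Qbar" shows "card (Emb S) > 0"
  using finite_Emb[OF assms] restrict_Emb[OF Gal_id] by (auto simp: card_gt_0_iff)

text \<open>Composition on the left with an automorphism \<tau> inducing e carries the fibre over
  the identity onto the fibre over e. Equal fibres are the reason why averages do not change when S
  grows.\<close>

lemma card_Emb_fiber: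
  assumes "S \<subseteq> T" "e \<in> Emb S"
  shows "card {f\<in>Emb T. restrict f S = e} = card {f\<in>Emb T. restrict f S = restrict id S}"
proof -
  obtain \<tau> where \<tau>: "\<tau> \<in> Gal" "e = restrict \<tau> S" using assms(2) by (auto simp: Emb_def)
  have c: "restrict (\<rho> \<circ> restrict f T) T = restrict (\<rho> \<circ> f) T" for \<rho> f :: "complex \<Rightarrow> complex" by auto
  have r: "restrict (restrict f T) S = restrict f S" for f :: "complex \<Rightarrow> complex"
    using assms(1) by (auto simp: restrict_def fun_eq_iff)
  have agree: "restrict f S = restrict g S \<longleftrightarrow> (\<forall>s\<in>S. f s = g s)" for f g :: "complex \<Rightarrow> complex"
    by (auto simp: restrict_def fun_eq_iff)
  have "bij_betw (\<lambda>f. restrict (\<tau> \<circ> f) T) {f\<in>Emb T. restrict f S = restrict id S} {f\<in>Emb T. restrict f S = e}"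
  proof (rule bij_betw_byWitness[where f' = "\<lambda>f. restrict (ginv \<tau> \<circ> f) T"])
    show "\<forall>f\<in>{f\<in>Emb T. restrict f S = restrict id S}. restrict (ginv \<tau> \<circ> restrict (\<tau> \<circ> f) T) T = f"
      using \<tau> by (auto simp: Emb_def Gal_inv_left restrict_def fun_eq_iff)
    show "\<forall>f\<in>{f\<in>Emb T. restrict f S = e}. restrict (\<tau> \<circ> restrict (ginv \<tau> \<circ> f) T) T = f"
      using \<tau> by (auto simp: Emb_def Gal_inv_right restrict_def fun_eq_iff)
    show "(\<lambda>f. restrict (\<tau> \<circ> f) T) ` {f\<in>Emb T. restrict f S = restrict id S} \<subseteq> {f\<in>Emb T. restrict f S = e}"
    proof clarify
      fix f assume f: "f \<in> Emb T" "restrict f S = restrict id S"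
      then obtain \<sigma> where \<sigma>: "\<sigma> \<in> Gal" "f = restrict \<sigma> T" by (auto simp: Emb_def)
      have "restrict (\<tau> \<circ> f) T = restrict (\<tau> \<circ> \<sigma>) T" by (auto simp: \<sigma>)
      moreover have "restrict (\<tau> \<circ> \<sigma>) S = e"
        using f \<tau> assms(1) unfolding \<sigma> r agree by (simp add: agree)
      ultimately show "restrict (\<tau> \<circ> f) T \<in> Emb T \<and> restrict (restrict (\<tau> \<circ> f) T) S = e"
        using restrict_Emb[of "\<tau> \<circ> \<sigma>" T] \<tau> \<sigma> r by simp
    qed
    show "(\<lambda>f. restrict (ginv \<tau> \<circ> f) T) ` {f\<in>Emb T. restrict f S = e} \<subseteq> {f\<in>Emb T. restrict f S = restrict id S}"
    proof clarify
      fix f assume f: "f \<in> Emb T" "e = restrict f S"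
      then obtain \<sigma> where \<sigma>: "\<sigma> \<in> Gal" "f = restrict \<sigma> T" by (auto simp: Emb_def)
      have "restrict (ginv \<tau> \<circ> f) T = restrict (ginv \<tau> \<circ> \<sigma>) T" by (auto simp: \<sigma>)
      moreover have "restrict (ginv \<tau> \<circ> \<sigma>) S = restrict id S"
        using f \<tau> assms(1) unfolding \<sigma> r by (auto simp: agree Gal_inv_left) (metis Gal_inv_left)
      ultimately show "restrict (ginv \<tau> \<circ> f) T \<in> Emb T \<and> restrict (restrict (ginv \<tau> \<circ> f) T) S = restrict id S"
        using restrict_Emb[of "ginv \<tau> \<circ> \<sigma>" T] \<tau> \<sigma> r by simp
    qed
  qed
  then show ?thesis by (simp add: bij_betw_same_card)
qed

text \<open>Passing from S to T repeats every value k times, where k is the common fibre size, and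
  multiplies the number of restrictions by the same k.\<close>

lemma avg_on_mono_set:
  assumes S: "finite T" "T \<subseteq> Qbar" "S \<subseteq> T" and h: "depends S h"
  shows "avg_on T h = avg_on S h"
proof -
  have fS: "finite S" "S \<subseteq> Qbar" using S finite_subset by auto
  define k where "k = card {f\<in>Emb T. restrict f S = restrict id S}"
  have im: "(\<lambda>f. restrict f S) ` Emb T \<subseteq> Emb S"
  proof clarify
    fix f assume "f \<in> Emb T"
    then obtain \<sigma> where \<sigma>: "\<sigma> \<in> Gal" "f = restrict \<sigma> T" by (auto simp: Emb_def)
    have "restrict f S = restrict \<sigma> S" using S(3) by (auto simp: \<sigma> restrict_def fun_eq_iff)
    then show "restrict f S \<in> Emb S" using restrict_Emb[OF \<sigma>(1)] by simp
  qed
  have grp: "(\<Sum>e\<in>Emb S. \<Sum>f\<in>{f\<in>Emb T. restrict f S = e}. g f) = sum g (Emb T)" for g :: "_ \<Rightarrow> real"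
    by (rule sum.group[OF finite_Emb[OF S(1,2)] finite_Emb[OF fS] im])
  have inner: "(\<Sum>f\<in>{f\<in>Emb T. restrict f S = e}. h (lift T f)) = real k * h (lift S e)" if e: "e \<in> Emb S" for e
  proof -
    have "h (lift T f) = h (lift S e)" if f: "f \<in> Emb T" "restrict f S = e" for f
    proof (rule dependsD[OF h lift_Emb(1)[OF f(1)] lift_Emb(1)[OF e]])
      fix s assume s: "s \<in> S"
      have "lift T f s = f s" using lift_Emb(2)[OF f(1)] s S(3) by (metis restrict_apply' subsetD)
      moreover have "lift S e s = f s" using lift_Emb(2)[OF e] f(2) s by (metis restrict_apply')
      ultimately show "lift T f s = lift S e s" by simp
    qed
    then have "(\<Sum>f\<in>{f\<in>Emb T. restrict f S = e}. h (lift T f)) = (\<Sum>f\<in>{f\<in>Emb T. restrict f S = e}. h (lift S e))"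
      by (intro sum.cong) auto
    then show ?thesis using card_Emb_fiber[OF S(3) e] by (simp add: k_def)
  qed
  have "(\<Sum>f\<in>Emb T. h (lift T f)) = real k * (\<Sum>e\<in>Emb S. h (lift S e))"
    unfolding grp[symmetric] sum_distrib_left by (rule sum.cong) (auto simp: inner)
  moreover have "real (card (Emb T)) = real k * real (card (Emb S))"
  proof -
    have "(\<Sum>f\<in>Emb T. 1) = (\<Sum>e\<in>Emb S. real k)"
      unfolding grp[symmetric] by (rule sum.cong) (simp_all add: k_def card_Emb_fiber[OF S(3)])
    then show ?thesis by simp
  qed
  moreover have "real k \<noteq> 0" using calculation(2) card_Emb_pos[OF S(1,2)] by (cases "k = 0") auto
  ultimately show ?thesis by (simp add: avg_on_def)
qed

lemma avg_eq:
  assumes "finite S" "S \<subseteq> Qbar" "depends S h"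
  shows "avg h = avg_on S h"
proof -
  let ?T = "SOME S. finite S \<and> S \<subseteq> Qbar \<and> depends S h"
  have T: "finite ?T \<and> ?T \<subseteq> Qbar \<and> depends ?T h" by (rule someI) (use assms in blast)
  have "avg_on ?T h = avg_on (?T \<union> S) h" using T assms by (intro avg_on_mono_set[symmetric]) auto
  also have "\<dots> = avg_on S h" using T assms by (intro avg_on_mono_set) auto
  finally show ?thesis by (simp add: avg_def)
qed

lemma avg_on_cong: "(\<And>\<sigma>. \<sigma> \<in> Gal \<Longrightarrow> h \<sigma> = h' \<sigma>) \<Longrightarrow> avg_on S h = avg_on S h'"
  unfolding avg_on_def by (metis (no_types, lifting) lift_Emb(1) sum.cong)

lemma avg_on_sum: "avg_on S (\<lambda>\<sigma>. \<Sum>i\<in>I. h i \<sigma>) = (\<Sum>i\<in>I. avg_on S (h i))"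
  unfolding avg_on_def by (subst sum.swap) (simp add: sum_divide_distrib)

lemma avg_on_add: "avg_on S (\<lambda>\<sigma>. h \<sigma> + h' \<sigma>) = avg_on S h + avg_on S h'"
  by (simp add: avg_on_def sum.distrib add_divide_distrib)

lemma avg_on_cmult: "avg_on S (\<lambda>\<sigma>. c * h \<sigma>) = c * avg_on S h"
  by (simp add: avg_on_def sum_distrib_left)

lemma avg_on_const: "finite S \<Longrightarrow> S \<subseteq> Qbar \<Longrightarrow> avg_on S (\<lambda>\<sigma>. c) = c"
  using card_Emb_pos[of S] by (simp add: avg_on_def)

lemma avg_on_rat: "(\<And>\<sigma>. \<sigma> \<in> Gal \<Longrightarrow> h \<sigma> \<in> \<rat>) \<Longrightarrow> avg_on S h \<in> \<rat>"
  unfolding avg_on_def by (intro Rats_divide Rats_sum) (auto simp: lift_Emb)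

lemma avg_on_abs_le:
  assumes "\<And>\<sigma>. \<sigma> \<in> Gal \<Longrightarrow> \<bar>h \<sigma>\<bar> \<le> h' \<sigma>"
  shows "\<bar>avg_on S h\<bar> \<le> avg_on S h'"
proof -
  have "\<bar>\<Sum>e\<in>Emb S. h (lift S e)\<bar> \<le> (\<Sum>e\<in>Emb S. h' (lift S e))"
    by (rule sum_abs[THEN order_trans], rule sum_mono) (use assms lift_Emb in auto)
  then show ?thesis unfolding avg_on_def abs_divide by (simp add: divide_right_mono)
qed

text \<open>Right invariance of Haar measure. The translated function depends on the image of S
  under \<rho>, and precomposition with \<rho> matches restrictions to that image with restrictions
  to S.\<close>

lemma avg_right_translate:
  assumes S: "finite S" "S \<subseteq> Qbar" "depends S h" and \<rho>: "\<rho> \<in> Gal"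
  shows "avg (\<lambda>\<sigma>. h (\<sigma> \<circ> \<rho>)) = avg h"
proof -
  let ?h = "\<lambda>\<sigma>. h (\<sigma> \<circ> \<rho>)" and ?T = "\<rho> ` S"
  have T: "finite ?T" "?T \<subseteq> Qbar" using S Gal_Qbar[OF \<rho>] by auto
  have dT: "depends ?T ?h"
    unfolding depends_def
  proof (intro ballI impI)
    fix \<sigma> \<tau> assume st: "\<sigma> \<in> Gal" "\<tau> \<in> Gal" "\<forall>s\<in>?T. \<sigma> s = \<tau> s"
    show "h (\<sigma> \<circ> \<rho>) = h (\<tau> \<circ> \<rho>)" by (rule dependsD[OF S(3)]) (use st \<rho> in auto)
  qed
  let ?\<phi> = "\<lambda>e. restrict (e \<circ> \<rho>) S" and ?\<psi> = "\<lambda>e. restrict (e \<circ> ginv \<rho>) ?T"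
  have \<phi>: "?\<phi> (restrict \<sigma> ?T) = restrict (\<sigma> \<circ> \<rho>) S" for \<sigma> :: "complex \<Rightarrow> complex" by auto
  have \<psi>: "?\<psi> (restrict \<sigma> S) = restrict (\<sigma> \<circ> ginv \<rho>) ?T" for \<sigma> :: "complex \<Rightarrow> complex"
    using \<rho> by (auto simp: restrict_def fun_eq_iff Gal_inv_left)
  have bij: "bij_betw ?\<phi> (Emb ?T) (Emb S)"
  proof (rule bij_betw_byWitness[where f' = ?\<psi>])
    show "\<forall>e\<in>Emb ?T. ?\<psi> (?\<phi> e) = e"
      using \<rho> by (auto simp: Emb_def restrict_def fun_eq_iff Gal_inv_left)
    show "\<forall>e\<in>Emb S. ?\<phi> (?\<psi> e) = e"
      using \<rho> by (auto simp: Emb_def restrict_def fun_eq_iff Gal_inv_left)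
    show "?\<phi> ` Emb ?T \<subseteq> Emb S"
    proof clarify
      fix e assume "e \<in> Emb ?T"
      then obtain \<sigma> where \<sigma>: "\<sigma> \<in> Gal" "e = restrict \<sigma> ?T" by (auto simp: Emb_def)
      show "?\<phi> e \<in> Emb S" unfolding \<sigma>(2) \<phi> by (rule restrict_Emb) (use \<sigma> \<rho> in simp)
    qed
    show "?\<psi> ` Emb S \<subseteq> Emb ?T"
    proof clarify
      fix e assume "e \<in> Emb S"
      then obtain \<sigma> where \<sigma>: "\<sigma> \<in> Gal" "e = restrict \<sigma> S" by (auto simp: Emb_def)
      show "?\<psi> e \<in> Emb ?T" unfolding \<sigma>(2) \<psi> by (rule restrict_Emb) (use \<sigma> \<rho> in simp)
    qed
  qed
  have "(\<Sum>e\<in>Emb ?T. ?h (lift ?T e)) = (\<Sum>e\<in>Emb ?T. h (lift S (?\<phi> e)))"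
  proof (rule sum.cong[OF refl])
    fix e assume "e \<in> Emb ?T"
    then obtain \<sigma> where \<sigma>: "\<sigma> \<in> Gal" "e = restrict \<sigma> ?T" by (auto simp: Emb_def)
    have "?h (lift ?T e) = h (\<sigma> \<circ> \<rho>)" unfolding \<sigma>(2) using depends_lift[OF dT \<sigma>(1)] by simp
    also have "\<dots> = h (lift S (?\<phi> e))"
      unfolding \<sigma>(2) \<phi> using depends_lift[OF S(3), of "\<sigma> \<circ> \<rho>"] \<sigma> \<rho> by simp
    finally show "?h (lift ?T e) = h (lift S (?\<phi> e))" .
  qed
  also have "\<dots> = (\<Sum>e\<in>Emb S. h (lift S e))" by (rule sum.reindex_bij_betw[OF bij])
  finally have "avg_on ?T ?h = avg_on S h"
    using bij_betw_same_card[OF bij] by (simp add: avg_on_def)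
  then show ?thesis using avg_eq[OF T dT] avg_eq[OF S] by simp
qed

section \<open>Conjugacy of places\<close>

text \<open>The value 0 outside K follows the convention of \<open>nonarch_place\<close>, so that
  two places of K are equal exactly when they are equal as functions.\<close>

definition pl :: "(complex \<Rightarrow> real) \<Rightarrow> complex set \<Rightarrow> (complex \<Rightarrow> complex) \<Rightarrow> complex \<Rightarrow> real" where
  "pl N K \<sigma> = (\<lambda>z. if z \<in> K then N (\<sigma> z) else 0)"

lemma pl_place_over:
  assumes N: "place_over Qbar p N" and K: "csubfield K" "K \<subseteq> Qbar" and s: "\<sigma> \<in> Gal"
  shows "place_over K p (pl N K \<sigma>)"
proof -
  have KQ: "z \<in> Qbar" "\<sigma> z \<in> Qbar" if "z \<in> K" for z using that K(2) Gal_Qbar[OF s] by auto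
  have "nonarch_place K (pl N K \<sigma>)"
    unfolding nonarch_place_def
  proof (intro conjI allI ballI impI)
    show "pl N K \<sigma> 0 = 0" using place_0[OF csubfield_Qbar N] Gal_0[OF s] by (simp add: pl_def)
    show "pl N K \<sigma> z > 0" if "z \<in> K - {0}" for z
      using that place_pos[OF csubfield_Qbar N KQ(2)] Gal_eq_0_iff[OF s] by (auto simp: pl_def)
    show "\<exists>p. prime p \<and> (\<forall>q. pl N K \<sigma> (of_rat q) = padic_abs p q)"
      using N csubfield_of_rat[OF K(1)] Gal_of_rat[OF s]
      by (intro exI[of _ p]) (auto simp: pl_def place_over_def)
    fix a b assume ab: "a \<in> K" "b \<in> K"
    show "pl N K \<sigma> (a * b) = pl N K \<sigma> a * pl N K \<sigma> b"
      using ab csubfield_closed(5)[OF K(1)] KQ place_mult[OF csubfield_Qbar N] by (simp add: pl_def Gal_mult[OF s])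
    show "pl N K \<sigma> (a + b) \<le> max (pl N K \<sigma> a) (pl N K \<sigma> b)"
      using ab csubfield_closed(3)[OF K(1)] KQ place_add[OF csubfield_Qbar N] by (simp add: pl_def Gal_add[OF s])
  qed (simp add: pl_def)
  then show ?thesis
    using N csubfield_of_rat[OF K(1)] Gal_of_rat[OF s] by (auto simp: pl_def place_over_def)
qed

lemma Gal_agree_span:
  assumes "\<sigma> \<in> Gal" "\<tau> \<in> Gal" "B \<subseteq> Qbar" "\<And>b. b \<in> B \<Longrightarrow> \<sigma> b = \<tau> b" "x \<in> rvs.span B"
  shows "\<sigma> x = \<tau> x"
proof -
  from assms(5) have "x \<in> Qbar \<and> \<sigma> x = \<tau> x"
  proof (induction rule: rvs.span_induct_alt)
    case base
    show ?case using assms by (simp add: Gal_0)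
  next
    case (step c b y)
    then have b: "b \<in> Qbar" "\<sigma> b = \<tau> b" using assms by auto
    then show ?case using step assms(1,2) by (simp add: Gal_add Gal_mult Gal_of_rat)
  qed
  then show ?thesis by blast
qed

lemma number_field_basis:
  assumes "number_field K"
  obtains B where "finite B" "B \<subseteq> Qbar" "K = rvs.span B"
proof -
  obtain B where "finite B" "B \<subseteq> K" "K = rat_span B" using assms by (auto simp: number_field_def)
  then show ?thesis using that[of B] number_field_subset_Qbar[OF assms] rat_span_eq_span[of B] by auto
qed

lemma depends_pl:
  assumes "B \<subseteq> Qbar" "K = rvs.span B"
  shows "depends B (pl N K)"
  unfolding depends_def
proof (intro ballI impI)
  fix \<sigma> \<tau> assume st: "\<sigma> \<in> Gal" "\<tau> \<in> Gal" "\<forall>b\<in>B. \<sigma> b = \<tau> b"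
  have "\<sigma> z = \<tau> z" if "z \<in> K" for z using Gal_agree_span[OF st(1,2) assms(1)] st(3) that assms(2) by blast
  then show "pl N K \<sigma> = pl N K \<tau>" by (auto simp: pl_def fun_eq_iff)
qed

lemma finite_pl:
  assumes "number_field K"
  shows "finite (pl N K ` Gal)"
proof -
  obtain B where B: "finite B" "B \<subseteq> Qbar" "K = rvs.span B" by (rule number_field_basis[OF assms])
  have "pl N K ` Gal \<subseteq> (\<lambda>e. pl N K (lift B e)) ` Emb B"
  proof clarify
    fix \<sigma> assume s: "\<sigma> \<in> Gal"
    show "pl N K \<sigma> \<in> (\<lambda>e. pl N K (lift B e)) ` Emb B"
      using depends_lift[OF depends_pl[OF B(2,3)] s, of N] restrict_Emb[OF s, of B] by (metis image_eqI)
  qed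
  then show ?thesis using finite_Emb[OF B(1,2)] by (meson finite_imageI finite_subset)
qed

subsection \<open>Size estimates from polynomial equations\<close>

context
  fixes K p v
  assumes K: "csubfield K" and v: "place_over K p v"
begin

text \<open>If z had size greater than 1, the leading term, whose coefficient is a unit at p, would
  strictly exceed all the others in the vanishing sum.\<close>

lemma place_root_le_1:
  assumes z: "z \<in> K" and f: "poly (map_poly of_int f) z = 0" "f \<noteq> 0" "\<not> int p dvd lead_coeff f"
  shows "v z \<le> 1"
proof (rule ccontr)
  assume "\<not> v z \<le> 1"
  then have vz: "v z > 1" by simp
  let ?n = "degree f"
  have nz: "?n \<noteq> 0"
  proof
    assume "?n = 0"
    then obtain c where "f = [:c:]" by (rule degree_eq_zeroE)
    with f show False by (auto simp: map_poly_pCons)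
  qed
  have "(\<Sum>i\<le>?n. of_int (coeff f i) * z ^ i) = 0"
    using f(1) by (simp add: poly_altdef coeff_map_poly degree_map_poly)
  then have eq: "of_int (lead_coeff f) * z ^ ?n = - (\<Sum>i<?n. of_int (coeff f i) * z ^ i)"
    by (simp add: lessThan_Suc_atMost[symmetric] eq_neg_iff_add_eq_0 add.commute)
  have inK: "of_int c * z ^ i \<in> K" for c i
    using z K by (intro csubfield_closed csubfield_of_int csubfield_power)
  have sm: "v (\<Sum>i<?n. of_int (coeff f i) * z ^ i) < v z ^ ?n"
  proof (rule place_sum_less[OF K v])
    fix i assume "i \<in> {..<?n}"
    then have "v z ^ i < v z ^ ?n" using vz by (simp add: power_strict_increasing)
    moreover have "v (of_int (coeff f i) * z ^ i) \<le> v z ^ i"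
      using place_mult[OF K v csubfield_of_int[OF K] csubfield_power[OF K z]] place_power[OF K v z]
        place_of_int_le_1[OF K v, of "coeff f i"] vz place_nonneg[OF K v]
      by (simp add: mult_left_le_one_le)
    ultimately show "v (of_int (coeff f i) * z ^ i) < v z ^ ?n" by simp
  qed (use vz inK in auto)
  have "v (of_int (lead_coeff f)) = 1"
    using place_of_rat[OF K v, of "of_int (lead_coeff f)"] padic_abs_of_int_eq_1[OF place_prime_p[OF K v] f(3)] by simp
  then have "v (of_int (lead_coeff f) * z ^ ?n) = v z ^ ?n"
    using place_mult[OF K v csubfield_of_int[OF K] csubfield_power[OF K z]] place_power[OF K v z] by simp
  moreover have "v (of_int (lead_coeff f) * z ^ ?n) = v (\<Sum>i<?n. of_int (coeff f i) * z ^ i)"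
    unfolding eq using inK by (intro place_uminus[OF K v] csubfield_sum[OF K])
  ultimately show False using sm by simp
qed

lemma place_root_ge_1:
  assumes z: "z \<in> K" and f: "poly (map_poly of_int f) z = 0" "\<not> int p dvd coeff f 0"
  shows "v z \<ge> 1"
proof (rule ccontr)
  assume "\<not> v z \<ge> 1"
  then have vz: "v z < 1" by simp
  obtain c g where fg: "f = pCons c g" by (rule pCons_cases)
  have eq: "of_int c = - (z * poly (map_poly of_int g) z)"
    using f(1) by (simp add: fg map_poly_pCons eq_neg_iff_add_eq_0)
  have gK: "poly (map_poly of_int g) z \<in> K"
    unfolding poly_altdef using z K
    by (intro csubfield_sum csubfield_closed csubfield_power) (simp_all add: coeff_map_poly csubfield_of_int)
  have "v (poly (map_poly of_int g) z) \<le> 1"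
    unfolding poly_altdef
  proof (rule place_sum_le[OF K v])
    fix i
    show "coeff (map_poly of_int g) i * z ^ i \<in> K"
      using z K by (simp add: coeff_map_poly) (intro csubfield_closed csubfield_of_int csubfield_power)
    have "v (of_int (coeff g i) * z ^ i) = v (of_int (coeff g i)) * v z ^ i"
      using place_mult[OF K v csubfield_of_int[OF K] csubfield_power[OF K z]] place_power[OF K v z] by simp
    also have "\<dots> \<le> 1 * 1"
      using place_of_int_le_1[OF K v] place_nonneg[OF K v] vz by (intro mult_mono) (auto intro: power_le_one)
    finally show "v (coeff (map_poly of_int g) i * z ^ i) \<le> 1" by (simp add: coeff_map_poly)
  qed auto
  then have "v z * v (poly (map_poly of_int g) z) \<le> v z * 1"
    using place_nonneg[OF K v] by (intro mult_left_mono)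
  also have "\<dots> < 1" using vz by simp
  finally have "v z * v (poly (map_poly of_int g) z) < 1" .
  moreover have "v (of_int c) = v z * v (poly (map_poly of_int g) z)"
    unfolding eq using place_uminus[OF K v] place_mult[OF K v z gK] csubfield_closed(5)[OF K z gK] by simp
  moreover have "v (of_int c) = 1"
    using place_of_rat[OF K v, of "of_int c"] padic_abs_of_int_eq_1[OF place_prime_p[OF K v]] f(2) by (simp add: fg)
  ultimately show False by simp
qed

text \<open>The two largest terms of an integer equation must tie in size, so a power of x is as
  large as a rational number. This permits normalising an element to size 1 at a given
  place.\<close>

lemma place_value_power:
  assumes x: "x \<in> K" "x \<in> Qbar" "x \<noteq> 0"
  shows "\<exists>k>0. \<exists>q. v (x ^ k * of_rat q) = 1"
proof -
  from x have "algebraic x" by (simp add: Qbar_def)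
  then obtain f where f: "f \<noteq> 0" "poly (map_poly of_int f) x = 0" by (rule algebraicE')
  define T where "T i = of_int (coeff f i) * x ^ i" for i
  define I where "I = {i. i \<le> degree f \<and> coeff f i \<noteq> 0}"
  have fin: "finite I" by (simp add: I_def)
  have I: "degree f \<in> I" using f by (simp add: I_def)
  have TK: "T i \<in> K" for i unfolding T_def using x K by (intro csubfield_closed csubfield_of_int csubfield_power)
  have Tnz: "T i \<noteq> 0" if "i \<in> I" for i using that x by (auto simp: T_def I_def)
  have "(\<Sum>i\<le>degree f. T i) = 0"
    using f(2) by (simp add: T_def poly_altdef coeff_map_poly degree_map_poly)
  also have "(\<Sum>i\<le>degree f. T i) = (\<Sum>i\<in>I. T i)"
    by (intro sum.mono_neutral_right) (auto simp: I_def T_def)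
  finally have sum0: "(\<Sum>i\<in>I. T i) = 0" .
  obtain k where k: "k \<in> I" "\<forall>i\<in>I. v (T i) \<le> v (T k)"
  proof -
    have "Max ((\<lambda>i. v (T i)) ` I) \<in> (\<lambda>i. v (T i)) ` I" using fin I by (intro Max_in) auto
    then obtain k where "k \<in> I" "v (T k) = Max ((\<lambda>i. v (T i)) ` I)" by auto
    then show thesis using that[of k] fin by auto
  qed
  have "\<exists>i\<in>I - {k}. v (T i) = v (T k)"
  proof (rule ccontr)
    assume "\<not> ?thesis"
    then have "v (\<Sum>i\<in>I - {k}. T i) < v (T k)"
      using fin k TK Tnz place_pos[OF K v] by (intro place_sum_less[OF K v]) (auto simp: less_le)
    moreover have "(\<Sum>i\<in>I - {k}. T i) = - T k"
      using sum0 sum.remove[OF fin k(1), of T] by (simp add: eq_neg_iff_add_eq_0 add.commute)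
    ultimately show False using place_uminus[OF K v TK] by simp
  qed
  then obtain i where i: "i \<in> I" "i \<noteq> k" "v (T i) = v (T k)" by blast
  have *: ?thesis if "i \<in> I" "k \<in> I" "k < i" "v (T i) = v (T k)" for i k
  proof -
    define c d where "c = coeff f i" "d = coeff f k"
    have cd: "c \<noteq> 0" "d \<noteq> 0" using that by (auto simp: I_def c_d_def)
    have "v (T i / T k) = 1"
      using place_divide[OF K v TK TK] that place_pos[OF K v TK Tnz, of k] by simp
    also have "T i / T k = x ^ (i - k) * of_rat (of_int c / of_int d)"
      using cd x that(3) by (simp add: T_def c_d_def[symmetric] power_diff field_simps of_rat_divide)
    finally show ?thesis using that(3) by (intro exI[of _ "i - k"]) auto
  qed
  show ?thesis
  proof (cases "k < i")
    case False
    then have "i < k" using i by simp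
    then show ?thesis using *[of k i] i k by simp
  qed (use * i k in blast)
qed

end

text \<open>\<open>Phi\<close> chooses its field element only up to units of the algebraic integers;
  here such units are shown to be invisible to every place.\<close>

lemma alg_int_unit_place:
  assumes N: "place_over Qbar p N" and s: "\<sigma> \<in> Gal" and u: "alg_int_unit u" "u \<in> Qbar"
  shows "N (\<sigma> u) = 1"
proof -
  have le: "N (\<sigma> z) \<le> 1" if z: "algebraic_integer z" "z \<in> Qbar" for z
  proof -
    obtain P :: "complex poly" where P: "\<And>i. coeff P i \<in> \<int>" "lead_coeff P = 1" "poly P z = 0"
      using z by (auto simp: algebraic_integer_def)
    from P(1) obtain f where f: "P = map_poly of_int f" by (erule intpolyE)
    have "of_int (lead_coeff f) = (1 :: complex)" using P(2) by (simp add: f degree_map_poly coeff_map_poly)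
    then have lc: "lead_coeff f = 1" by simp
    have pr: "prime p" using N by (simp add: place_over_def)
    show ?thesis
    proof (rule place_root_le_1[OF csubfield_Qbar N])
      show "\<sigma> z \<in> Qbar" using Gal_Qbar[OF s] z by simp
      show "poly (map_poly of_int f) (\<sigma> z) = 0"
        using Gal_int_poly_root[OF s z(2)] P(3) by (simp add: f)
      show "f \<noteq> 0" using lc by auto
      show "\<not> int p dvd lead_coeff f" using lc prime_gt_1_nat[OF pr] by simp
    qed
  qed
  have "N (\<sigma> u) \<le> 1" "N (\<sigma> (inverse u)) \<le> 1" using u by (auto simp: alg_int_unit_def intro!: le)
  moreover have "N (\<sigma> (inverse u)) = inverse (N (\<sigma> u))"
    using Gal_inverse[OF s u(2)] place_inverse[OF csubfield_Qbar N] Gal_Qbar[OF s] u(2) by simp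
  moreover have "N (\<sigma> u) > 0"
    using place_pos[OF csubfield_Qbar N] Gal_Qbar[OF s] Gal_eq_0_iff[OF s] u by (auto simp: alg_int_unit_def)
  ultimately show ?thesis by (metis inverse_le_1_iff order_antisym_conv not_le)
qed

lemma finite_nonunit_primes:
  assumes y: "y \<in> Qbar" "y \<noteq> 0"
  shows "finite {p. \<exists>N \<sigma>. place_over Qbar p N \<and> \<sigma> \<in> Gal \<and> N (\<sigma> y) \<noteq> 1}"
proof -
  from y have "algebraic y" by (simp add: Qbar_def)
  then obtain f where f: "f \<noteq> 0" "coeff f 0 \<noteq> 0" "poly (map_poly of_int f) y = 0"
    using y(2) by (metis algebraicE'_nonzero)
  \<comment> \<open>A prime dividing neither end coefficient forces all conjugates of y to have size
    exactly 1: the leading coefficient bounds them above, the constant one below.\<close>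
  define m where "m = coeff f 0 * lead_coeff f"
  have m: "m \<noteq> 0" using f by (simp add: m_def)
  have "{p. \<exists>N \<sigma>. place_over Qbar p N \<and> \<sigma> \<in> Gal \<and> N (\<sigma> y) \<noteq> 1} \<subseteq> {..nat \<bar>m\<bar>}"
  proof clarify
    fix p N \<sigma> assume N: "place_over Qbar p N" and s: "\<sigma> \<in> Gal" and ne: "N (\<sigma> y) \<noteq> 1"
    have "int p dvd m"
    proof (rule ccontr)
      assume nd: "\<not> int p dvd m"
      have sy: "\<sigma> y \<in> Qbar" "poly (map_poly of_int f) (\<sigma> y) = 0"
        using Gal_Qbar[OF s] y(1) Gal_int_poly_root[OF s y(1) f(3)] by auto
      have "N (\<sigma> y) \<le> 1" "N (\<sigma> y) \<ge> 1"
        using place_root_le_1[OF csubfield_Qbar N sy f(1)] place_root_ge_1[OF csubfield_Qbar N sy] nd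
        unfolding m_def by (meson dvd_mult dvd_mult2)+
      then show False using ne by simp
    qed
    then have "int p \<le> \<bar>m\<bar>" using m dvd_imp_le_int[of m "int p"] by simp
    then show "p \<le> nat \<bar>m\<bar>" by linarith
  qed
  then show ?thesis by (rule finite_subset) simp
qed

subsection \<open>All places above p are conjugate\<close>

text \<open>Up to sign the coefficient at i is the elementary symmetric function of degree
  \<open>card T - i\<close> in the roots, and every one of its monomials has size at most the
  corresponding power of M.\<close>

lemma coeff_linear_prod_bound:
  assumes N: "place_over Qbar p N" and "finite T" "T \<subseteq> Qbar" "\<And>t. t \<in> T \<Longrightarrow> N t \<le> M" and M: "M \<ge> 0"
    and "i \<le> card T"
  shows "N (coeff (\<Prod>t\<in>T. [:- t, 1:]) i) \<le> M ^ (card T - i)"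
  using assms(2-4,6)
proof (induction T arbitrary: i rule: finite_induct)
  case empty
  then show ?case using place_1[OF csubfield_Qbar N] by simp
next
  case (insert x F)
  let ?P = "\<Prod>t\<in>F. [:- t, 1:]"
  have cQ: "coeff ?P j \<in> Qbar" for j using insert by (intro Qbar_coeffs_linear_prod) auto
  have x: "x \<in> Qbar" "N x \<le> M" using insert by auto
  have IH: "N (coeff ?P j) \<le> M ^ (card F - j)" if "j \<le> card F" for j using insert that by auto
  have c: "coeff (\<Prod>t\<in>insert x F. [:- t, 1:]) i = (case i of 0 \<Rightarrow> 0 | Suc j \<Rightarrow> coeff ?P j) - x * coeff ?P i"
    using insert by (simp add: coeff_pCons split: nat.splits)
  have xb: "N (x * coeff ?P i) \<le> M ^ (card (insert x F) - i)"
  proof (cases "i \<le> card F")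
    case True
    have "N (x * coeff ?P i) = N x * N (coeff ?P i)" using place_mult[OF csubfield_Qbar N x(1) cQ] .
    also have "\<dots> \<le> M * M ^ (card F - i)"
      using x IH[OF True] M place_nonneg[OF csubfield_Qbar N] by (intro mult_mono) auto
    finally show ?thesis using insert True by (simp add: Suc_diff_le)
  next
    case False
    then have "coeff ?P i = 0" by (intro coeff_eq_0) (simp add: degree_linear_prod)
    then show ?thesis using place_0[OF csubfield_Qbar N] M by simp
  qed
  show ?case
  proof (cases i)
    case 0
    have "N (- (x * coeff ?P 0)) = N (x * coeff ?P 0)"
      using place_uminus[OF csubfield_Qbar N] x(1) cQ by (simp add: Qbar_closed(7))
    then show ?thesis using c xb 0 by simp
  next
    case (Suc j)
    then have j: "j \<le> card F" using insert by simp
    have "N (coeff ?P j - x * coeff ?P i) \<le> max (N (coeff ?P j)) (N (x * coeff ?P i))"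
      using x(1) cQ by (intro place_diff[OF csubfield_Qbar N]) auto
    also have "\<dots> \<le> M ^ (card F - j)" using xb IH[OF j] Suc insert by simp
    finally show ?thesis using c Suc insert by simp
  qed
qed

text \<open>The minimal polynomial of x has rational coefficients, on which w and N agree. The
  conjugates bound these coefficients via N, and if w x exceeded M the leading power of x would
  dominate the equation at w.\<close>

lemma place_le_conjugates:
  assumes K: "csubfield K" "K \<subseteq> Qbar" and w: "place_over K p w" and N: "place_over Qbar p N"
    and x: "x \<in> K" and M: "\<And>\<sigma>. \<sigma> \<in> Gal \<Longrightarrow> N (\<sigma> x) \<le> M"
  shows "w x \<le> M"
proof (rule ccontr)
  assume "\<not> w x \<le> M"
  then have gt: "w x > M" by simp
  have xQ: "x \<in> Qbar" using x K by auto
  have M0: "M \<ge> 0" using M[OF Gal_id] place_nonneg[OF csubfield_Qbar N, of x] by simp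
  let ?P = "conj_poly x" and ?n = "card (conjs x)"
  have fin: "finite (conjs x)" by (rule finite_conjs[OF xQ])
  have deg: "degree ?P = ?n" and lc: "coeff ?P ?n = 1"
    using lead_coeff_linear_prod[of "conjs x"] by (simp_all add: conj_poly_def degree_linear_prod)
  have "poly ?P x = 0" using fin self_conjs[of x] by (auto simp: conj_poly_def poly_prod)
  then have "(\<Sum>i\<le>?n. coeff ?P i * x ^ i) = 0" by (simp add: poly_altdef deg)
  then have eq: "x ^ ?n = - (\<Sum>i<?n. coeff ?P i * x ^ i)"
    using lc by (simp add: lessThan_Suc_atMost[symmetric] eq_neg_iff_add_eq_0 add.commute)
  have cf: "coeff ?P i \<in> K" "w (coeff ?P i) = N (coeff ?P i)" for i
  proof -
    from conj_poly_rational[OF xQ, of i] obtain q where q: "coeff ?P i = of_rat q" by (auto elim: Rats_cases)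
    show "coeff ?P i \<in> K" using csubfield_of_rat[OF K(1)] q by simp
    show "w (coeff ?P i) = N (coeff ?P i)"
      using q place_of_rat[OF K(1) w] place_of_rat[OF csubfield_Qbar N] by simp
  qed
  have bd: "w (coeff ?P i) \<le> M ^ (?n - i)" if "i < ?n" for i
  proof -
    have "N (coeff ?P i) \<le> M ^ (?n - i)"
      unfolding conj_poly_def
      by (rule coeff_linear_prod_bound[OF N fin conjs_subset[OF xQ] _ M0]) (use M that in \<open>auto simp: conjs_def\<close>)
    then show ?thesis by (simp add: cf(2))
  qed
  have inK: "coeff ?P i * x ^ i \<in> K" for i
    using cf(1) x K(1) by (intro csubfield_closed csubfield_power)
  have "w (\<Sum>i<?n. coeff ?P i * x ^ i) < w x ^ ?n"
  proof (rule place_sum_less[OF K(1) w])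
    show "w x ^ ?n > 0" using gt M0 by simp
    fix i assume i: "i \<in> {..<?n}"
    have "w (coeff ?P i * x ^ i) = w (coeff ?P i) * w x ^ i"
      using place_mult[OF K(1) w cf(1) csubfield_power[OF K(1) x]] place_power[OF K(1) w x] by simp
    also have "\<dots> \<le> M ^ (?n - i) * w x ^ i" using bd i place_nonneg[OF K(1) w] by (intro mult_right_mono) auto
    also have "\<dots> < w x ^ (?n - i) * w x ^ i"
      using gt M0 i by (intro mult_strict_right_mono power_strict_mono) auto
    also have "\<dots> = w x ^ ?n" using i by (simp add: power_add[symmetric])
    finally show "w (coeff ?P i * x ^ i) < w x ^ ?n" .
  qed (use inK in auto)
  moreover have "w (\<Sum>i<?n. coeff ?P i * x ^ i) = w (x ^ ?n)"
    unfolding eq using inK by (intro place_uminus[OF K(1) w, symmetric] csubfield_sum[OF K(1)])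
  ultimately show False using place_power[OF K(1) w x] by simp
qed

text \<open>If \<open>w x = 1\<close>, \<open>v x < 1\<close> for the places \<open>v\<close> already treated and \<open>u x > 1\<close> at the new
  place \<open>u\<close>, then \<open>x ^ n / (1 + x ^ n)\<close> has size at least 1 at \<open>w\<close>, size 1 at \<open>u\<close> and tends to 0 at
  the places \<open>v\<close>.\<close>
lemma dominating_element:
  assumes K: "csubfield K" "K \<subseteq> Qbar" and w: "place_over K p w"
    and "finite V" "\<And>v. v \<in> V \<Longrightarrow> place_over K p v \<and> v \<noteq> w"
  shows "\<exists>x\<in>K. x \<noteq> 0 \<and> (\<forall>v\<in>V. v x < w x)"
  using assms(4,5)
proof (induction V rule: finite_induct)
  case empty
  show ?case using csubfield_closed(2)[OF K(1)] by (intro bexI[of _ 1]) auto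
next
  case (insert u V)
  have u: "place_over K p u" "u \<noteq> w" and V: "\<And>v. v \<in> V \<Longrightarrow> place_over K p v" using insert by auto
  obtain x0 where x0: "x0 \<in> K" "x0 \<noteq> 0" "\<forall>v\<in>V. v x0 < w x0" using insert by auto
  obtain k q where kq: "k > 0" "w (x0 ^ k * of_rat q) = 1"
    using place_value_power[OF K(1) w x0(1)] x0 K(2) by blast
  define x where "x = x0 ^ k * of_rat q"
  have xK: "x \<in> K" unfolding x_def using x0 K(1) by (intro csubfield_closed csubfield_power csubfield_of_rat)
  have wx: "w x = 1" using kq by (simp add: x_def)
  have vx: "v x < 1" if "v \<in> V" for v
  proof -
    \<comment> \<open>The rational factor has the same size at all places above p, so normalising at
      w preserves the strict comparisons with the places in V.\<close>
    have e: "v' x = v' x0 ^ k * padic_abs p q" if "place_over K p v'" for v'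
      unfolding x_def using place_mult[OF K(1) that csubfield_power[OF K(1) x0(1)] csubfield_of_rat[OF K(1)]]
        place_power[OF K(1) that x0(1)] place_of_rat[OF K(1) that] by simp
    have nn: "padic_abs p q \<ge> 0" using place_nonneg[OF K(1) w, of "of_rat q"] place_of_rat[OF K(1) w] by simp
    have pos: "padic_abs p q > 0" using e[OF w] wx nn by (metis less_eq_real_def mult_zero_right zero_neq_one)
    have "v x0 ^ k < w x0 ^ k"
      using x0(3) that kq(1) place_nonneg[OF K(1) V[OF that]] by (intro power_strict_mono) auto
    then have "v x < w x" unfolding e[OF w] e[OF V[OF that]] using pos by simp
    then show ?thesis using wx by simp
  qed
  have xnz: "x \<noteq> 0" using wx place_0[OF K(1) w] by auto
  \<comment> \<open>Two different places above p differ at some element, and passing to the inverse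
    reverses the inequality if it has the wrong direction.\<close>
  obtain y where y: "y \<in> K" "y \<noteq> 0" "u y < w y"
  proof -
    obtain z where z: "u z \<noteq> w z" using u(2) by blast
    have zK: "z \<in> K" using z place_outside[OF K(1) u(1)] place_outside[OF K(1) w] by metis
    have znz: "z \<noteq> 0" using z place_0[OF K(1) u(1)] place_0[OF K(1) w] by metis
    show thesis
    proof (cases "u z < w z")
      case False
      then have "w z < u z" using z by simp
      then have "inverse (u z) < inverse (w z)" using place_pos[OF K(1) w zK znz] by simp
      then show thesis using that[of "inverse z"] zK znz csubfield_closed(6)[OF K(1)]
        place_inverse[OF K(1) w zK] place_inverse[OF K(1) u(1) zK] by simp
    qed (use that zK znz in blast)
  qed
  have wy: "w y > 0" using place_pos[OF K(1) w] y by simp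
  have "\<forall>v\<in>V. \<forall>\<^sub>F n in sequentially. v x ^ n * v y < w y"
  proof
    fix v assume v: "v \<in> V"
    have "(\<lambda>n. v x ^ n * v y) \<longlonglongrightarrow> 0 * v y"
      using vx[OF v] place_nonneg[OF K(1) V[OF v]] by (intro tendsto_mult LIMSEQ_realpow_zero tendsto_const)
    then show "\<forall>\<^sub>F n in sequentially. v x ^ n * v y < w y" using wy by (auto intro: order_tendstoD)
  qed
  then have "\<forall>\<^sub>F n in sequentially. \<forall>v\<in>V. v x ^ n * v y < w y"
    using insert(1) by (simp add: eventually_ball_finite)
  then obtain n0 where n0: "\<forall>n\<ge>n0. \<forall>v\<in>V. v x ^ n * v y < w y" by (auto simp: eventually_sequentially)
  define n where "n = Suc n0"
  have n: "\<And>v. v \<in> V \<Longrightarrow> v x ^ n * v y < w y" "n > 0" using n0[rule_format, of n] by (simp_all add: n_def)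
  have xnK: "x ^ n \<in> K" by (rule csubfield_power[OF K(1) xK])
  show ?case
  proof (cases "u x > 1")
    case False
    \<comment> \<open>Here powers of x do no harm at u, so the plain product
      \<open>x ^ n * y\<close> already works; the quotient by 1 + x^n is reserved for the other
      case.\<close>
    have "u (x ^ n * y) \<le> u y"
      using False place_nonneg[OF K(1) u(1)] place_mult[OF K(1) u(1) xnK y(1)] place_power[OF K(1) u(1) xK]
      by (simp add: mult_left_le_one_le power_le_one)
    moreover have "w (x ^ n * y) = w y"
      using place_mult[OF K(1) w xnK y(1)] place_power[OF K(1) w xK] wx by simp
    moreover have "v (x ^ n * y) < w y" if "v \<in> V" for v
      using n(1)[OF that] place_mult[OF K(1) V[OF that] xnK y(1)] place_power[OF K(1) V[OF that] xK] by simp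
    ultimately show ?thesis using y xnz csubfield_closed(5)[OF K(1) xnK y(1)]
      by (intro bexI[of _ "x ^ n * y"]) auto
  next
    case True
    define d where "d = 1 + x ^ n"
    have dK: "d \<in> K" unfolding d_def by (intro csubfield_closed K(1) xnK)
    have uxn: "u (x ^ n) > 1" using True n(2) place_power[OF K(1) u(1) xK] by (simp add: one_less_power)
    have ud: "u d = u (x ^ n)"
      unfolding d_def using place_add_eq[OF K(1) u(1) xnK csubfield_closed(2)[OF K(1)]] uxn place_1[OF K(1) u(1)]
      by (simp add: add.commute)
    have dnz: "d \<noteq> 0" using ud uxn place_0[OF K(1) u(1)] by auto
    define z where "z = x ^ n / d"
    have zK: "z \<in> K" unfolding z_def by (rule csubfield_divide[OF K(1) xnK dK])
    have uz: "u z = 1" unfolding z_def using place_divide[OF K(1) u(1) xnK dK] ud uxn by simp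
    have wz: "w z \<ge> 1"
    proof -
      have "w d \<le> 1" unfolding d_def
        using place_add[OF K(1) w csubfield_closed(2)[OF K(1)] xnK] place_1[OF K(1) w] place_power[OF K(1) w xK] wx by simp
      moreover have "w d > 0" using place_pos[OF K(1) w dK dnz] .
      moreover have "w z = 1 / w d" unfolding z_def
        using place_divide[OF K(1) w xnK dK] place_power[OF K(1) w xK] wx by simp
      ultimately show ?thesis by simp
    qed
    have vz: "v z = v x ^ n" if "v \<in> V" for v
    proof -
      have "v (x ^ n) < 1" using vx[OF that] n(2) place_power[OF K(1) V[OF that] xK] place_nonneg[OF K(1) V[OF that]]
        by (simp add: power_less_one_iff)
      then have "v d = 1" unfolding d_def
        using place_add_eq[OF K(1) V[OF that] csubfield_closed(2)[OF K(1)] xnK] place_1[OF K(1) V[OF that]] by simp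
      then show ?thesis unfolding z_def
        using place_divide[OF K(1) V[OF that] xnK dK] place_power[OF K(1) V[OF that] xK] by simp
    qed
    have "w (z * y) \<ge> w y" using place_mult[OF K(1) w zK y(1)] wz wy by simp
    moreover have "u (z * y) = u y" using place_mult[OF K(1) u(1) zK y(1)] uz by simp
    moreover have "v (z * y) < w y" if "v \<in> V" for v
      using n(1)[OF that] place_mult[OF K(1) V[OF that] zK y(1)] vz[OF that] by simp
    moreover have "z * y \<noteq> 0" using y xnz dnz by (simp add: z_def)
    ultimately show ?thesis using y(3) csubfield_closed(5)[OF K(1) zK y(1)]
      by (intro bexI[of _ "z * y"]) (auto, fastforce)
  qed
qed

text \<open>The places induced by N form a finite set. If w were not among them, some x would be
  larger at w than all its conjugates are at N, which \<open>place_le_conjugates\<close>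
  excludes.\<close>

theorem places_conjugate:
  assumes nf: "number_field K" and w: "place_over K p w" and N: "place_over Qbar p N"
  shows "\<exists>\<sigma>\<in>Gal. w = pl N K \<sigma>"
proof (rule ccontr)
  assume "\<not> ?thesis"
  then have ne: "w \<notin> pl N K ` Gal" by blast
  note K = number_field_csubfield[OF nf] number_field_subset_Qbar[OF nf]
  have "\<exists>x\<in>K. x \<noteq> 0 \<and> (\<forall>v\<in>pl N K ` Gal. v x < w x)"
    by (rule dominating_element[OF K w finite_pl[OF nf]]) (use ne pl_place_over[OF N K] in blast)
  then obtain x where x: "x \<in> K" "\<And>\<sigma>. \<sigma> \<in> Gal \<Longrightarrow> N (\<sigma> x) < w x" by (auto simp: pl_def)
  define M where "M = Max ((\<lambda>\<sigma>. N (\<sigma> x)) ` Gal)"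
  have im: "(\<lambda>\<sigma>. N (\<sigma> x)) ` Gal = N ` conjs x" by (auto simp: conjs_def)
  have fin: "finite ((\<lambda>\<sigma>. N (\<sigma> x)) ` Gal)" unfolding im using finite_conjs x(1) K(2) by auto
  have "M \<in> (\<lambda>\<sigma>. N (\<sigma> x)) ` Gal" unfolding M_def using fin Gal_id by (intro Max_in) blast+
  then have "M < w x" using x(2) by auto
  moreover have "w x \<le> M"
    by (rule place_le_conjugates[OF K w N x(1)]) (use fin in \<open>auto simp: M_def\<close>)
  ultimately show False by simp
qed

section \<open>Global and local degrees\<close>

definition lagrange_basis :: "complex set \<Rightarrow> complex \<Rightarrow> complex poly" where
  "lagrange_basis T t = smult (1 / (\<Prod>s\<in>T - {t}. t - s)) (\<Prod>s\<in>T - {t}. [:- s, 1:])"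

lemma poly_lagrange_basis:
  assumes "finite T" "t \<in> T" "s \<in> T"
  shows "poly (lagrange_basis T t) s = (if s = t then 1 else 0)"
proof -
  have "poly (\<Prod>s\<in>T - {t}. [:- s, 1:]) s = (\<Prod>r\<in>T - {t}. s - r)"
    by (simp add: poly_prod)
  moreover have "(\<Prod>r\<in>T - {t}. s - r) = 0" if "s \<noteq> t"
    using that assms by (intro prod_zero) auto
  moreover have "(\<Prod>r\<in>T - {t}. t - r) \<noteq> 0" using assms by auto
  ultimately show ?thesis by (auto simp: lagrange_basis_def)
qed

lemma degree_lagrange_basis:
  assumes "finite T" "t \<in> T" shows "degree (lagrange_basis T t) < card T"
proof -
  have "degree (lagrange_basis T t) \<le> degree (\<Prod>s\<in>T - {t}. [:- s, 1:] :: complex poly)"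
    unfolding lagrange_basis_def by (rule degree_smult_le)
  also have "\<dots> = card (T - {t})" by (rule degree_linear_prod)
  also have "\<dots> < card T" using assms by (intro psubset_card_mono) auto
  finally show ?thesis .
qed

lemma lagrange_basis_Qbar:
  assumes "T \<subseteq> Qbar" "t \<in> T" shows "coeff (lagrange_basis T t) i \<in> Qbar"
proof -
  have "coeff (\<Prod>s\<in>T - {t}. [:- s, 1:]) i \<in> Qbar" using assms by (intro Qbar_coeffs_linear_prod) auto
  moreover have "(\<Prod>s\<in>T - {t}. t - s) \<in> Qbar" using assms by auto
  ultimately show ?thesis by (simp add: lagrange_basis_def)
qed

definition interpolant :: "complex set \<Rightarrow> (complex \<Rightarrow> complex) \<Rightarrow> complex poly" where
  "interpolant T h = (\<Sum>t\<in>T. smult (h t) (lagrange_basis T t))"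

lemma poly_interpolant:
  assumes "finite T" "s \<in> T" shows "poly (interpolant T h) s = h s"
proof -
  have "poly (interpolant T h) s = (\<Sum>t\<in>T. if t = s then h t else 0)"
    unfolding interpolant_def poly_sum using assms poly_lagrange_basis by (intro sum.cong) auto
  then show ?thesis using assms by simp
qed

lemma degree_interpolant:
  assumes "finite T" "T \<noteq> {}" shows "degree (interpolant T h) < card T"
proof -
  have "degree (interpolant T h) \<le> card T - 1"
    unfolding interpolant_def
  proof (rule degree_sum_le[OF assms(1)])
    fix t assume t: "t \<in> T"
    have "degree (smult (h t) (lagrange_basis T t)) \<le> degree (lagrange_basis T t)" by (rule degree_smult_le)
    also have "\<dots> \<le> card T - 1" using degree_lagrange_basis[OF assms(1) t] by simp
    finally show "degree (smult (h t) (lagrange_basis T t)) \<le> card T - 1" .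
  qed
  moreover have "card T > 0" using assms by (simp add: card_gt_0_iff)
  ultimately show ?thesis by linarith
qed

lemma poly_eq_if_agree:
  fixes P Q :: "complex poly"
  assumes "finite T" "degree P < card T" "degree Q < card T" "\<And>t. t \<in> T \<Longrightarrow> poly P t = poly Q t"
  shows "P = Q"
proof -
  have "P - Q = 0"
    by (rule poly_eq_0_if_many_roots[OF assms(1)]) (use assms in \<open>auto intro: degree_diff_less\<close>)
  then show ?thesis by simp
qed

lemma coeff_interpolant:
  "coeff (interpolant T h) i = (\<Sum>t\<in>T. h t * coeff (lagrange_basis T t) i)"
  by (simp add: interpolant_def coeff_sum)

text \<open>Any x in K is the value at \<theta> of the polynomial interpolating
  \<open>\<sigma> x\<close> at \<open>\<sigma> \<theta>\<close>. This interpolant commutes with the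
  Galois action, so its coefficients are rational, and as many powers of \<theta> as there are
  conjugates span K.\<close>

lemma nf_degree_le_card_Emb:
  assumes nf: "number_field K" and B: "finite B" "B \<subseteq> Qbar" "K = rvs.span B"
    and \<theta>: "\<theta> \<in> K" "\<And>\<sigma> \<tau>. \<sigma> \<in> Gal \<Longrightarrow> \<tau> \<in> Gal \<Longrightarrow> \<sigma> \<theta> = \<tau> \<theta> \<Longrightarrow> \<forall>b\<in>B. \<sigma> b = \<tau> b"
  shows "nf_degree K \<le> card (Emb B)"
proof -
  note K = number_field_csubfield[OF nf] number_field_subset_Qbar[OF nf]
  let ?T = "conjs \<theta>"
  have \<theta>Q: "\<theta> \<in> Qbar" using \<theta>(1) K by auto
  have fin: "finite ?T" and TQ: "?T \<subseteq> Qbar" using finite_conjs[OF \<theta>Q] conjs_subset[OF \<theta>Q] by auto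
  have ne: "?T \<noteq> {}" using self_conjs by blast
  define C where "C = (\<lambda>i. \<theta> ^ i) ` {..<card ?T}"
  have CK: "C \<subseteq> K" using csubfield_power[OF K(1) \<theta>(1)] by (auto simp: C_def)
  have "K \<subseteq> rvs.span C"
  proof
    fix x assume x: "x \<in> K"
    have xQ: "x \<in> Qbar" using x K by auto
    \<comment> \<open>The automorphism with \<open>\<sigma> \<theta> = t\<close> is chosen
      arbitrarily; since \<theta> separates B, any two choices agree on all of K.\<close>
    define h where "h t = (SOME \<sigma>. \<sigma> \<in> Gal \<and> \<sigma> \<theta> = t) x" for t
    have h: "h (\<sigma> \<theta>) = \<sigma> x" if s: "\<sigma> \<in> Gal" for \<sigma>
    proof -
      let ?\<tau> = "SOME \<tau>. \<tau> \<in> Gal \<and> \<tau> \<theta> = \<sigma> \<theta>"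
      have t: "?\<tau> \<in> Gal \<and> ?\<tau> \<theta> = \<sigma> \<theta>" by (rule someI[of _ \<sigma>]) (use s in simp)
      have "\<forall>b\<in>B. ?\<tau> b = \<sigma> b" using \<theta>(2) t s by blast
      then show ?thesis unfolding h_def using Gal_agree_span[of ?\<tau> \<sigma> B x] t s B x by blast
    qed
    let ?P = "interpolant ?T h"
    have deg: "degree ?P < card ?T" by (rule degree_interpolant[OF fin ne])
    have hQ: "h t \<in> Qbar" if "t \<in> ?T" for t using that h xQ by (auto simp: conjs_def Gal_Qbar)
    have cQ: "coeff ?P i \<in> Qbar" for i
      unfolding coeff_interpolant using hQ lagrange_basis_Qbar[OF TQ] by auto
    have "map_poly \<sigma> ?P = ?P" if s: "\<sigma> \<in> Gal" for \<sigma>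
    proof (rule poly_eq_if_agree[OF fin _ deg])
      have "degree (map_poly \<sigma> ?P) = degree ?P"
        by (rule degree_map_poly) (use Gal_eq_0_iff[OF s] in auto)
      then show "degree (map_poly \<sigma> ?P) < card ?T" using deg by simp
      fix t assume "t \<in> ?T"
      then have "t \<in> \<sigma> ` ?T" using Gal_image_conjs[OF s] by simp
      then obtain \<tau> where \<tau>: "\<tau> \<in> Gal" "t = \<sigma> (\<tau> \<theta>)" by (auto simp: conjs_def)
      then have "poly (map_poly \<sigma> ?P) t = \<sigma> (poly ?P (\<tau> \<theta>))"
        using Gal_poly[OF s cQ] \<theta>Q by (simp add: Gal_Qbar)
      also have "\<dots> = \<sigma> (\<tau> x)" using poly_interpolant[OF fin] h \<tau> by (simp add: conjs_def)
      also have "\<dots> = h t" using h[of "\<sigma> \<circ> \<tau>"] \<tau> s by simp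
      also have "\<dots> = poly ?P t" using poly_interpolant[OF fin \<open>t \<in> ?T\<close>] by simp
      finally show "poly (map_poly \<sigma> ?P) t = poly ?P t" .
    qed
    then have rat: "coeff ?P i \<in> \<rat>" for i using Gal_fixed_poly_rational cQ by blast
    have "x = poly ?P \<theta>" using poly_interpolant[OF fin self_conjs] h[OF Gal_id] by simp
    also have "\<dots> = (\<Sum>i\<le>degree ?P. coeff ?P i * \<theta> ^ i)" by (simp add: poly_altdef)
    also have "\<dots> \<in> rvs.span C"
    proof (rule rvs.span_sum)
      fix i assume "i \<in> {..degree ?P}"
      then have "\<theta> ^ i \<in> C" using deg by (auto simp: C_def)
      moreover obtain q where "coeff ?P i = of_rat q" using rat[of i] by (auto elim: Rats_cases)
      ultimately show "coeff ?P i * \<theta> ^ i \<in> rvs.span C" using rvs.span_scale[OF rvs.span_base] by simp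
    qed
    finally show "x \<in> rvs.span C" .
  qed
  moreover have "rvs.span C \<subseteq> K"
    using rvs.span_mono[OF CK] B(3) rvs.span_span by metis
  ultimately have KC: "K = rat_span C" using rat_span_eq_span[of C] by (simp add: C_def)
  have "nf_degree K \<le> card C"
    unfolding nf_degree_def by (rule Least_le) (use CK KC in \<open>auto simp: C_def intro!: exI[of _ C]\<close>)
  also have "\<dots> \<le> card ?T" unfolding C_def using card_image_le[of "{..<card ?T}" "\<lambda>i. \<theta> ^ i"] by simp
  also have "\<dots> \<le> card (Emb B)"
  proof (rule surj_card_le[OF finite_Emb[OF B(1,2)]])
    show "?T \<subseteq> (\<lambda>e. lift B e \<theta>) ` Emb B"
    proof
      fix t assume "t \<in> ?T"
      then obtain \<sigma> where s: "\<sigma> \<in> Gal" "t = \<sigma> \<theta>" by (auto simp: conjs_def)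
      have "depends B (\<lambda>\<sigma>. \<sigma> \<theta>)"
        unfolding depends_def using Gal_agree_span[OF _ _ B(2)] \<theta>(1) B(3) by blast
      from depends_lift[OF this s(1)] have "t = lift B (restrict \<sigma> B) \<theta>" using s by simp
      then show "t \<in> (\<lambda>e. lift B e \<theta>) ` Emb B" using restrict_Emb[OF s(1)] by blast
    qed
  qed
  finally show ?thesis .
qed

subsection \<open>Local degrees\<close>

text \<open>The predicate minimised in \<open>local_degree\<close>, given a name so that attainment
  and minimality can be treated separately.\<close>

definition spanning :: "complex set \<Rightarrow> (complex \<Rightarrow> real) \<Rightarrow> nat \<Rightarrow> bool" where
  "spanning K v d \<longleftrightarrow> (\<exists>b :: nat \<Rightarrow> nat \<Rightarrow> complex.
      (\<forall>i<d. v_cauchy K v (b i)) \<and>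
      (\<forall>f. v_cauchy K v f \<longrightarrow>
         (\<exists>a :: nat \<Rightarrow> nat \<Rightarrow> rat. (\<forall>i<d. v_cauchy K v (\<lambda>n. of_rat (a i n))) \<and>
             v_null v (\<lambda>n. f n - (\<Sum>i<d. of_rat (a i n) * b i n)))))"

lemma local_degree_spanning: "local_degree K v = (LEAST d. spanning K v d)"
  by (simp add: local_degree_def spanning_def)

text \<open>Linear independence over the p-adic numbers, in a quantitative form that mentions only
  rational coefficients.\<close>
definition padic_indep :: "complex set \<Rightarrow> (complex \<Rightarrow> real) \<Rightarrow> nat \<Rightarrow> (nat \<Rightarrow> complex) \<Rightarrow> bool" where
  "padic_indep K v m e \<longleftrightarrow> (\<forall>j<m. e j \<in> K) \<and>
     (\<exists>C>0. \<forall>q :: nat \<Rightarrow> rat. \<forall>i<m. v (of_rat (q i)) \<le> C * v (\<Sum>j<m. of_rat (q j) * e j))"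

context
  fixes K p v
  assumes K: "csubfield K" and v: "place_over K p v"
begin

lemma rat_comb_in: "(\<And>j. j < m \<Longrightarrow> e j \<in> K) \<Longrightarrow> (\<Sum>j<m. of_rat (q j) * e j) \<in> K"
  by (intro csubfield_sum[OF K] csubfield_closed(5)[OF K] csubfield_of_rat[OF K]) auto

text \<open>Everything happens at one late index n: the m elements e j are approximated by
  combinations of only d elements of K, so fewer than m elements would make the approximants
  rationally dependent. The same coefficients applied to e give a combination that is too small for
  independence.\<close>

lemma padic_indep_le_spanning:
  assumes ind: "padic_indep K v m e" and sp: "spanning K v d"
  shows "m \<le> d"
proof (rule ccontr)
  assume "\<not> m \<le> d"
  then have md: "d < m" by simp
  obtain C where C: "C > 0" "\<And>q :: nat \<Rightarrow> rat. \<And>i. i < m \<Longrightarrow> v (of_rat (q i)) \<le> C * v (\<Sum>j<m. of_rat (q j) * e j)"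
    and e: "\<And>j. j < m \<Longrightarrow> e j \<in> K" using ind unfolding padic_indep_def by blast
  obtain b where b: "\<forall>i<d. v_cauchy K v (b i)" "\<forall>f. v_cauchy K v f \<longrightarrow>
         (\<exists>a :: nat \<Rightarrow> nat \<Rightarrow> rat. (\<forall>i<d. v_cauchy K v (\<lambda>n. of_rat (a i n))) \<and>
             v_null v (\<lambda>n. f n - (\<Sum>i<d. of_rat (a i n) * b i n)))"
    using sp unfolding spanning_def by blast
  have bK: "b i n \<in> K" if "i < d" for i n using b(1) that by (simp add: v_cauchy_def)
  have "\<forall>j. \<exists>a :: nat \<Rightarrow> nat \<Rightarrow> rat. j < m \<longrightarrow> v_null v (\<lambda>n. e j - (\<Sum>i<d. of_rat (a i n) * b i n))"
  proof
    fix j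
    have "v_cauchy K v (\<lambda>n. e j)" if "j < m" using e[OF that] place_0[OF K v] by (simp add: v_cauchy_def)
    then show "\<exists>a :: nat \<Rightarrow> nat \<Rightarrow> rat. j < m \<longrightarrow> v_null v (\<lambda>n. e j - (\<Sum>i<d. of_rat (a i n) * b i n))"
      using b(2)[rule_format, of "\<lambda>n. e j"] by blast
  qed
  from choice[OF this] obtain a :: "nat \<Rightarrow> nat \<Rightarrow> nat \<Rightarrow> rat"
    where a: "\<And>j. j < m \<Longrightarrow> v_null v (\<lambda>n. e j - (\<Sum>i<d. of_rat (a j i n) * b i n))" by blast
  define y where "y j n = (\<Sum>i<d. of_rat (a j i n) * b i n)" for j n
  \<comment> \<open>The precision is taken below 1 / C, because a combination whose largest
    coefficient has size 1 must have size at least 1 / C.\<close>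
  have "\<forall>j\<in>{..<m}. \<forall>\<^sub>F n in sequentially. v (e j - y j n) < 1 / (C + 1)"
  proof
    fix j assume "j \<in> {..<m}"
    then have "(\<lambda>n. v (e j - y j n)) \<longlonglongrightarrow> 0" using a by (simp add: v_null_def y_def)
    then show "\<forall>\<^sub>F n in sequentially. v (e j - y j n) < 1 / (C + 1)"
      using C(1) by (intro order_tendstoD(2)) auto
  qed
  then have "\<forall>\<^sub>F n in sequentially. \<forall>j\<in>{..<m}. v (e j - y j n) < 1 / (C + 1)"
    by (simp add: eventually_ball_finite)
  then obtain n where n: "\<And>j. j < m \<Longrightarrow> v (e j - y j n) < 1 / (C + 1)"
    by (auto simp: eventually_sequentially)
  let ?S = "(\<lambda>i. b i n) ` {..<d}"
  have "y j n \<in> rvs.span ?S" for j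
    unfolding y_def by (intro rvs.span_sum rvs.span_scale rvs.span_base) auto
  moreover have "card ?S < m" using md card_image_le[of "{..<d}" "\<lambda>i. b i n"] by simp
  ultimately obtain q i0 where q: "(\<Sum>j<m. of_rat (q j) * y j n) = 0" "i0 < m" "q i0 \<noteq> 0"
    using rational_dependence[of ?S m "\<lambda>j. y j n"] by auto
  define g where "g j = v (of_rat (q j))" for j
  obtain k where k: "k < m" "\<And>j. j < m \<Longrightarrow> g j \<le> g k"
  proof -
    have "Max (g ` {..<m}) \<in> g ` {..<m}" using q(2) by (intro Max_in) auto
    then obtain k where "k < m" "g k = Max (g ` {..<m})" by auto
    then show thesis using that[of k] by auto
  qed
  have vq: "g j > 0 \<longleftrightarrow> q j \<noteq> 0" for j
    using place_pos[OF K v csubfield_of_rat[OF K], of "q j"] place_0[OF K v] by (auto simp: g_def)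
  have qk: "q k \<noteq> 0" using vq[of k] vq[of i0] k(2)[OF q(2)] q(3) by simp
  \<comment> \<open>Dividing by a coefficient of largest size makes all coefficients at most 1 in
    size and the one at k equal to 1, so errors are not amplified.\<close>
  define r where "r j = q j / q k" for j
  have vr: "v (of_rat (r j)) \<le> 1" if "j < m" for j
  proof -
    have "v (of_rat (r j)) = g j / g k"
      using place_divide[OF K v csubfield_of_rat[OF K] csubfield_of_rat[OF K]] by (simp add: r_def g_def of_rat_divide)
    then show ?thesis using k(2)[OF that] vq[of k] qk by simp
  qed
  have yK: "y j n \<in> K" for j unfolding y_def using bK by (intro rat_comb_in) auto
  have "(\<Sum>j<m. of_rat (r j) * y j n) = (\<Sum>j<m. of_rat (q j) * y j n) / of_rat (q k)"
    unfolding sum_divide_distrib by (intro sum.cong) (auto simp: r_def of_rat_divide)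
  then have r0: "(\<Sum>j<m. of_rat (r j) * y j n) = 0" using q(1) by simp
  have "(\<Sum>j<m. of_rat (r j) * e j) = (\<Sum>j<m. of_rat (r j) * (e j - y j n))"
    using r0 by (simp add: right_diff_distrib sum_subtractf)
  moreover have "v (\<Sum>j<m. of_rat (r j) * (e j - y j n)) < 1 / (C + 1)"
  proof (rule place_sum_less[OF K v])
    fix j assume "j \<in> {..<m}"
    then have j: "j < m" by simp
    have dK: "e j - y j n \<in> K" by (intro csubfield_closed K e j yK)
    show "of_rat (r j) * (e j - y j n) \<in> K" by (intro csubfield_closed csubfield_of_rat K dK)
    have "v (of_rat (r j) * (e j - y j n)) = v (of_rat (r j)) * v (e j - y j n)"
      by (rule place_mult[OF K v csubfield_of_rat[OF K] dK])
    also have "\<dots> \<le> v (e j - y j n)"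
      using vr[OF j] place_nonneg[OF K v] by (simp add: mult_left_le_one_le)
    finally show "v (of_rat (r j) * (e j - y j n)) < 1 / (C + 1)" using n[OF j] by simp
  qed (use C(1) in auto)
  ultimately have "v (of_rat (r k)) \<le> C * (1 / (C + 1))"
    using C(2)[OF k(1), of r] C(1) by (smt (verit) mult_left_mono)
  moreover have "v (of_rat (r k)) = 1" using qk place_1[OF K v] by (simp add: r_def)
  ultimately show False using C(1) by (simp add: field_simps)
qed

text \<open>A combination s with last coefficient q m is q m times the difference of x and a
  rational combination of e, so the distance hypothesis bounds q m by
  \<open>v s / \<epsilon>\<close>. Subtracting this last term leaves a combination to which the old
  bound applies.\<close>

lemma padic_indep_extend:
  assumes ind: "padic_indep K v m e" and x: "x \<in> K" and \<epsilon>: "\<epsilon> > 0"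
    and far: "\<And>q :: nat \<Rightarrow> rat. v (x - (\<Sum>j<m. of_rat (q j) * e j)) \<ge> \<epsilon>"
  shows "padic_indep K v (Suc m) (e(m := x))"
proof -
  obtain C where C: "C > 0" "\<And>q :: nat \<Rightarrow> rat. \<And>i. i < m \<Longrightarrow> v (of_rat (q i)) \<le> C * v (\<Sum>j<m. of_rat (q j) * e j)"
    and e: "\<And>j. j < m \<Longrightarrow> e j \<in> K" using ind unfolding padic_indep_def by blast
  \<comment> \<open>One summand for each estimate: 1 / \<epsilon> for the new coefficient, the other
    two for the alternatives of the ultrametric maximum in the bound of an old coefficient.\<close>
  define D where "D = 1 / \<epsilon> + C + C * (v x / \<epsilon>)"
  have nn: "v y \<ge> 0" for y by (rule place_nonneg[OF K v])
  have D: "D > 0" "1 / \<epsilon> \<le> D" "C \<le> D" "C * (v x / \<epsilon>) \<le> D" using C(1) \<epsilon> nn[of x] by (auto simp: D_def add_pos_nonneg)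
  have "v (of_rat (q i)) \<le> D * v (\<Sum>j<Suc m. of_rat (q j) * (e(m := x)) j)" if i: "i < Suc m" for q :: "nat \<Rightarrow> rat" and i
  proof -
    define t where "t = (\<Sum>j<m. of_rat (q j) * e j)"
    define s where "s = t + of_rat (q m) * x"
    have s: "(\<Sum>j<Suc m. of_rat (q j) * (e(m := x)) j) = s" by (simp add: s_def t_def)
    have tK: "t \<in> K" unfolding t_def by (rule rat_comb_in[OF e])
    have qxK: "of_rat (q m) * x \<in> K" by (intro csubfield_closed csubfield_of_rat K x)
    have sK: "s \<in> K" unfolding s_def by (intro csubfield_closed K tK qxK)
    have qm: "v (of_rat (q m)) \<le> v s / \<epsilon>"
    proof (cases "q m = 0")
      case True
      then show ?thesis using nn \<epsilon> place_0[OF K v] by simp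
    next
      case False
      have "s = of_rat (q m) * (x - (\<Sum>j<m. of_rat (- q j / q m) * e j))"
      proof -
        have "(\<Sum>j<m. of_rat (- q j / q m) * e j) = - t / of_rat (q m)"
          unfolding t_def sum_negf[symmetric] sum_divide_distrib
          by (intro sum.cong) (auto simp: of_rat_divide of_rat_minus)
        then show ?thesis using False by (simp add: s_def field_simps)
      qed
      moreover have "x - (\<Sum>j<m. of_rat (- q j / q m) * e j) \<in> K"
        by (intro csubfield_closed K x rat_comb_in e)
      ultimately have "v s = v (of_rat (q m)) * v (x - (\<Sum>j<m. of_rat (- q j / q m) * e j))"
        using place_mult[OF K v csubfield_of_rat[OF K]] by metis
      also have "\<dots> \<ge> v (of_rat (q m)) * \<epsilon>" using far nn by (intro mult_left_mono)
      finally show ?thesis using \<epsilon> by (simp add: field_simps)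
    qed
    show ?thesis
    proof (cases "i = m")
      case True
      have "v s / \<epsilon> \<le> D * v s" using D(2) nn[of s] mult_right_mono[OF D(2) nn[of s]] by simp
      then show ?thesis unfolding s using qm True by simp
    next
      case False
      then have "i < m" using i by simp
      from C(2)[OF this, of q] have "v (of_rat (q i)) \<le> C * v t" by (simp add: t_def)
      also have "t = s - of_rat (q m) * x" by (simp add: s_def)
      also have "C * v (s - of_rat (q m) * x) \<le> C * max (v s) (v (of_rat (q m) * x))"
        using C(1) place_diff[OF K v sK qxK] by simp
      also have "v (of_rat (q m) * x) \<le> v s * (v x / \<epsilon>)"
        using place_mult[OF K v csubfield_of_rat[OF K] x] mult_right_mono[OF qm nn[of x]] by simp
      finally have le: "v (of_rat (q i)) \<le> C * max (v s) (v s * (v x / \<epsilon>))"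
        using C(1) by (smt (verit) mult_left_mono)
      have "C * v s \<le> D * v s" "C * (v x / \<epsilon>) * v s \<le> D * v s"
        using D nn[of s] by (intro mult_right_mono; simp)+
      then have "C * max (v s) (v s * (v x / \<epsilon>)) \<le> D * v s" by (auto simp: max_def mult_ac)
      then show ?thesis unfolding s using le by simp
    qed
  qed
  then show ?thesis unfolding padic_indep_def using D(1) e x by (auto simp: less_Suc_eq)
qed

text \<open>Guarantees that the \<open>LEAST\<close> in \<open>local_degree\<close> is attained.
  Independent families have at most \<open>card B\<close> members; a largest one approximates every
  element of K by \<open>padic_indep_extend\<close>, and its constant sequences span.\<close>

lemma exists_spanning:
  assumes B: "finite B" "K = rvs.span B"
  shows "\<exists>d. spanning K v d"
proof -
  have nn: "v y \<ge> 0" for y by (rule place_nonneg[OF K v])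
  have bound: "m \<le> card B" if ind: "padic_indep K v m e" for m e
  proof (rule ccontr)
    assume "\<not> m \<le> card B"
    moreover obtain C where C: "C > 0" "\<And>q :: nat \<Rightarrow> rat. \<And>i. i < m \<Longrightarrow> v (of_rat (q i)) \<le> C * v (\<Sum>j<m. of_rat (q j) * e j)"
      and e: "\<And>j. j < m \<Longrightarrow> e j \<in> K" using ind unfolding padic_indep_def by blast
    ultimately obtain q i where q: "(\<Sum>j<m. of_rat (q j) * e j) = 0" "i < m" "q i \<noteq> 0"
      using rational_dependence[OF B(1), of m e] B(2) by auto
    have "v (of_rat (q i)) \<le> 0" using C(2)[OF q(2), of q] q(1) place_0[OF K v] by simp
    moreover have "v (of_rat (q i)) > 0" using place_pos[OF K v csubfield_of_rat[OF K]] q(3) by simp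
    ultimately show False by simp
  qed
  have "padic_indep K v 0 (\<lambda>_. 0)" by (auto simp: padic_indep_def intro: exI[of _ 1])
  then obtain m where m: "\<exists>e. padic_indep K v m e" "\<And>m'. (\<exists>e. padic_indep K v m' e) \<Longrightarrow> m' \<le> m"
    using GreatestI_nat[of "\<lambda>m. \<exists>e. padic_indep K v m e" 0 "card B"]
      Greatest_le_nat[of "\<lambda>m. \<exists>e. padic_indep K v m e" _ "card B"] bound by metis
  obtain e where ind: "padic_indep K v m e" using m(1) by blast
  obtain C where C: "C > 0" "\<And>q :: nat \<Rightarrow> rat. \<And>i. i < m \<Longrightarrow> v (of_rat (q i)) \<le> C * v (\<Sum>j<m. of_rat (q j) * e j)"
    and e: "\<And>j. j < m \<Longrightarrow> e j \<in> K" using ind unfolding padic_indep_def by blast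
  have approx: "\<exists>q :: nat \<Rightarrow> rat. v (x - (\<Sum>j<m. of_rat (q j) * e j)) < \<epsilon>" if "x \<in> K" "\<epsilon> > 0" for x \<epsilon>
  proof (rule ccontr)
    assume "\<not> ?thesis"
    then have "\<And>q :: nat \<Rightarrow> rat. v (x - (\<Sum>j<m. of_rat (q j) * e j)) \<ge> \<epsilon>" by (simp add: not_less)
    from padic_indep_extend[OF ind that this] m(2)[of "Suc m"] show False by auto
  qed
  have "spanning K v m"
    unfolding spanning_def
  proof (intro exI[of _ "\<lambda>i n. e i"] conjI allI impI)
    show "v_cauchy K v (\<lambda>n. e i)" if "i < m" for i using e[OF that] place_0[OF K v] by (simp add: v_cauchy_def)
    fix f assume f: "v_cauchy K v f"
    have fK: "f n \<in> K" for n using f by (simp add: v_cauchy_def)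
    have "\<forall>n. \<exists>q :: nat \<Rightarrow> rat. v (f n - (\<Sum>j<m. of_rat (q j) * e j)) < 1 / real (Suc n)"
      using approx[OF fK] by simp
    from choice[OF this] obtain q :: "nat \<Rightarrow> nat \<Rightarrow> rat"
      where q: "\<And>n. v (f n - (\<Sum>j<m. of_rat (q n j) * e j)) < 1 / real (Suc n)" by blast
    define t where "t n = (\<Sum>j<m. of_rat (q n j) * e j)" for n
    have tK: "t n \<in> K" for n unfolding t_def by (rule rat_comb_in[OF e])
    have dK: "f n - t n \<in> K" for n by (intro csubfield_closed K fK tK)
    \<comment> \<open>Independence bounds a difference of coefficients by C times the difference of
      the approximants, and the approximants inherit the Cauchy property from f.\<close>
    have "v_cauchy K v (\<lambda>n. of_rat (q n i))" if i: "i < m" for i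
      unfolding v_cauchy_def
    proof (intro conjI allI impI csubfield_of_rat[OF K])
      fix \<epsilon> :: real assume \<epsilon>: "\<epsilon> > 0"
      define \<delta> where "\<delta> = \<epsilon> / C"
      have \<delta>: "\<delta> > 0" using \<epsilon> C(1) by (simp add: \<delta>_def)
      obtain N1 where N1: "\<forall>n\<ge>N1. \<forall>n'\<ge>N1. v (f n - f n') < \<delta>" using f \<delta> unfolding v_cauchy_def by blast
      obtain N2 where N2: "1 / real (Suc N2) < \<delta>" using \<delta> by (metis nat_approx_posE of_nat_Suc)
      show "\<exists>N. \<forall>n\<ge>N. \<forall>n'\<ge>N. v (of_rat (q n i) - of_rat (q n' i)) < \<epsilon>"
      proof (intro exI[of _ "max N1 N2"] allI impI)
        fix n n' assume n: "max N1 N2 \<le> n" "max N1 N2 \<le> n'"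
        have small: "v (f k - t k) < \<delta>" if "k \<ge> N2" for k
        proof -
          have "1 / real (Suc k) \<le> 1 / real (Suc N2)" using that by (intro divide_left_mono) auto
          then show ?thesis using q[of k] N2 by (simp add: t_def)
        qed
        have "v (t n - t n') = v ((f n - f n') + ((f n' - t n') - (f n - t n)))" by (simp add: algebra_simps)
        also have "\<dots> \<le> max (v (f n - f n')) (v ((f n' - t n') - (f n - t n)))"
          by (intro place_add[OF K v] csubfield_closed K fK tK)
        finally have "v (t n - t n') \<le> max (v (f n - f n')) (v ((f n' - t n') - (f n - t n)))" .
        moreover have "v ((f n' - t n') - (f n - t n)) \<le> max (v (f n' - t n')) (v (f n - t n))"
          by (rule place_diff[OF K v dK dK])
        moreover have "v (f n - f n') < \<delta>" "v (f n - t n) < \<delta>" "v (f n' - t n') < \<delta>"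
          using N1 n small by auto
        ultimately have "v (t n - t n') < \<delta>" by linarith
        moreover have "t n - t n' = (\<Sum>j<m. of_rat (q n j - q n' j) * e j)"
          by (simp add: t_def of_rat_diff left_diff_distrib sum_subtractf)
        ultimately have "C * v (\<Sum>j<m. of_rat (q n j - q n' j) * e j) < C * \<delta>" using C(1) by simp
        then have "v (of_rat (q n i - q n' i)) < C * \<delta>" using C(2)[OF i, of "\<lambda>j. q n j - q n' j"] by simp
        then show "v (of_rat (q n i) - of_rat (q n' i)) < \<epsilon>" using C(1) by (simp add: of_rat_diff \<delta>_def)
      qed
    qed
    moreover have "v_null v (\<lambda>n. f n - (\<Sum>i<m. of_rat (q n i) * e i))"
      unfolding v_null_def
    proof (rule real_tendsto_sandwich[of "\<lambda>_. 0" _ _ "\<lambda>n. 1 / real (Suc n)"])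
      show "(\<lambda>n. 1 / real (Suc n)) \<longlonglongrightarrow> 0" using LIMSEQ_inverse_real_of_nat by (simp add: inverse_eq_divide)
    qed (use nn q in \<open>auto intro!: always_eventually less_imp_le\<close>)
    ultimately show "\<exists>a. (\<forall>i<m. v_cauchy K v (\<lambda>n. of_rat (a i n))) \<and>
        v_null v (\<lambda>n. f n - (\<Sum>i<m. of_rat (a i n) * e i))"
      by (intro exI[of _ "\<lambda>i n. q n i"]) auto
  qed
  then show ?thesis by blast
qed

end

text \<open>Each conjugate t in T induces v, so the polynomial with coefficients q takes at t a
  value of the same size as its value at \<theta> under v. Interpolation at T recovers the
  coefficients from these values with a loss depending only on T.\<close>

lemma powers_padic_indep:
  assumes K: "csubfield K" "K \<subseteq> Qbar" and N: "place_over Qbar p N" and v: "place_over K p v"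
    and \<theta>: "\<theta> \<in> K" and T: "finite T" "\<And>t. t \<in> T \<Longrightarrow> \<exists>\<sigma>\<in>Gal. t = \<sigma> \<theta> \<and> pl N K \<sigma> = v"
  shows "padic_indep K v (card T) (\<lambda>j. \<theta> ^ j)"
proof -
  have \<theta>Q: "\<theta> \<in> Qbar" using \<theta> K by auto
  have TQ: "T \<subseteq> Qbar" using T(2) \<theta>Q Gal_Qbar by blast
  have nn: "N y \<ge> 0" "v y \<ge> 0" for y using place_nonneg[OF csubfield_Qbar N] place_nonneg[OF K(1) v] by auto
  \<comment> \<open>The sum dominates all coefficients of the Lagrange basis; the added 1 keeps C
    positive even when the sum is empty.\<close>
  define C where "C = 1 + (\<Sum>i<card T. \<Sum>t\<in>T. N (coeff (lagrange_basis T t) i))"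
  have C: "C > 0" unfolding C_def using nn by (intro add_pos_nonneg sum_nonneg) auto
  have NC: "N (coeff (lagrange_basis T t) i) \<le> C" if "t \<in> T" "i < card T" for t i
  proof -
    have "N (coeff (lagrange_basis T t) i) \<le> (\<Sum>t\<in>T. N (coeff (lagrange_basis T t) i))"
      using that T(1) nn by (intro member_le_sum) auto
    also have "\<dots> \<le> (\<Sum>i<card T. \<Sum>t\<in>T. N (coeff (lagrange_basis T t) i))"
      using that nn by (intro member_le_sum[of i "{..<card T}" "\<lambda>i. \<Sum>t\<in>T. N (coeff (lagrange_basis T t) i)"]) (auto intro: sum_nonneg)
    finally show ?thesis by (simp add: C_def)
  qed
  have "v (of_rat (q i)) \<le> C * v (\<Sum>j<card T. of_rat (q j) * \<theta> ^ j)" if i: "i < card T" for q :: "nat \<Rightarrow> rat" and i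
  proof -
    define s where "s = (\<Sum>j<card T. of_rat (q j) * \<theta> ^ j)"
    have sQ: "s \<in> Qbar" and sK: "s \<in> K"
      unfolding s_def using \<theta>Q by (auto intro!: rat_comb_in[OF K(1) v] csubfield_power[OF K(1) \<theta>])
    define P where "P = (\<Sum>j<card T. monom (of_rat (q j) :: complex) j)"
    have cP: "coeff P k = (if k < card T then of_rat (q k) else 0)" for k by (simp add: P_def coeff_sum)
    have degP: "degree P < card T"
    proof -
      have "degree P \<le> card T - 1" by (rule degree_le) (auto simp: cP)
      then show ?thesis using i by simp
    qed
    have val: "N (poly P t) = v s" "poly P t \<in> Qbar" if "t \<in> T" for t
    proof -
      obtain \<sigma> where s: "\<sigma> \<in> Gal" "t = \<sigma> \<theta>" "pl N K \<sigma> = v" using T(2)[OF \<open>t \<in> T\<close>] by blast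
      have "poly P t = \<sigma> s"
        using s(1) \<theta>Q by (simp add: P_def poly_sum poly_monom s(2) s_def Gal_sum Gal_mult Gal_of_rat Gal_power)
      then show "N (poly P t) = v s" "poly P t \<in> Qbar" using s(1,3) sK sQ Gal_Qbar[OF s(1)] by (auto simp: pl_def)
    qed
    have ne: "T \<noteq> {}" using i by auto
    have "P = interpolant T (poly P)"
      by (rule poly_eq_if_agree[OF T(1) degP degree_interpolant[OF T(1) ne]]) (simp add: poly_interpolant[OF T(1)])
    then have "of_rat (q i) = (\<Sum>t\<in>T. poly P t * coeff (lagrange_basis T t) i)"
      using cP[of i] i coeff_interpolant[of T "poly P" i] by simp
    moreover have "N (\<Sum>t\<in>T. poly P t * coeff (lagrange_basis T t) i) \<le> C * v s"
    proof (rule place_sum_le[OF csubfield_Qbar N T(1)])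
      fix t assume t: "t \<in> T"
      have cQ: "coeff (lagrange_basis T t) i \<in> Qbar" by (rule lagrange_basis_Qbar[OF TQ t])
      show "poly P t * coeff (lagrange_basis T t) i \<in> Qbar" using val(2)[OF t] cQ by auto
      have "N (poly P t * coeff (lagrange_basis T t) i) = v s * N (coeff (lagrange_basis T t) i)"
        using place_mult[OF csubfield_Qbar N val(2)[OF t] cQ] val(1)[OF t] by simp
      also have "\<dots> \<le> v s * C" using NC[OF t i] nn by (intro mult_left_mono)
      finally show "N (poly P t * coeff (lagrange_basis T t) i) \<le> C * v s" by (simp add: mult.commute)
    qed (use C nn in auto)
    ultimately have "N (of_rat (q i)) \<le> C * v s" by simp
    then show ?thesis using place_of_rat[OF csubfield_Qbar N] place_of_rat[OF K(1) v] by (simp add: s_def)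
  qed
  then show ?thesis unfolding padic_indep_def using C csubfield_power[OF K(1) \<theta>] by blast
qed

text \<open>The product of two inequalities: embeddings inducing v are told apart by their values at
  \<theta>, so their number is at most the local degree, and the global degree is at most the number
  of all embeddings. Read as a quotient, the measure of the set inducing v is at most the ratio of
  local to global degree.\<close>

theorem degree_quotient_bound:
  assumes nf: "number_field K" and v: "place_over K p v" and N: "place_over Qbar p N"
    and B: "finite B" "B \<subseteq> Qbar" "K = rvs.span B"
  shows "real (nf_degree K) * real (card {e\<in>Emb B. pl N K (lift B e) = v})
      \<le> real (card (Emb B)) * real (local_degree K v)"
proof -
  note K = number_field_csubfield[OF nf] number_field_subset_Qbar[OF nf]
  obtain \<theta> where \<theta>: "\<theta> \<in> K" "\<And>\<sigma> \<tau>. \<sigma> \<in> Gal \<Longrightarrow> \<tau> \<in> Gal \<Longrightarrow> \<sigma> \<theta> = \<tau> \<theta> \<Longrightarrow> \<forall>b\<in>B. \<sigma> b = \<tau> b"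
    using separating_element[OF B(1,2)] B(3) by blast
  let ?E = "{e\<in>Emb B. pl N K (lift B e) = v}"
  have "inj_on (\<lambda>e. lift B e \<theta>) ?E"
  proof (rule inj_onI)
    fix e e' assume e: "e \<in> ?E" "e' \<in> ?E" "lift B e \<theta> = lift B e' \<theta>"
    then have "\<forall>b\<in>B. lift B e b = lift B e' b" using \<theta>(2) lift_Emb(1) by blast
    then have "restrict (lift B e) B = restrict (lift B e') B" by (auto simp: restrict_def fun_eq_iff)
    then show "e = e'" using e lift_Emb(2) by (metis (no_types, lifting) mem_Collect_eq)
  qed
  then have card: "card ((\<lambda>e. lift B e \<theta>) ` ?E) = card ?E" by (rule card_image)
  have "finite ((\<lambda>e. lift B e \<theta>) ` ?E)" using finite_Emb[OF B(1,2)] by simp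
  then have "padic_indep K v (card ((\<lambda>e. lift B e \<theta>) ` ?E)) (\<lambda>j. \<theta> ^ j)"
    by (rule powers_padic_indep[OF K N v \<theta>(1)]) (use lift_Emb(1) in blast)
  moreover have "spanning K v (local_degree K v)"
    unfolding local_degree_spanning using exists_spanning[OF K(1) v B(1,3)] by (metis LeastI)
  ultimately have "card ?E \<le> local_degree K v" using padic_indep_le_spanning[OF K(1) v] card by metis
  moreover have "nf_degree K \<le> card (Emb B)" by (rule nf_degree_le_card_Emb[OF nf B \<theta>])
  ultimately show ?thesis by (intro mult_mono) auto
qed

section \<open>Open subgroups and isolating places\<close>

text \<open>Supplies the number field needed to show that the choice in \<open>Phi\<close> has a
  candidate. Inverses come from an integer equation with non-zero constant term, as for
  \<open>graph_ring_inverse\<close>.\<close>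

lemma number_field_adjoin:
  assumes a: "a \<in> Qbar"
  shows "\<exists>K. number_field K \<and> a \<in> K"
proof -
  from a have "algebraic a" by (simp add: Qbar_def)
  then obtain n where n: "n > 0" "a ^ n \<in> rvs.span ((\<lambda>i. a ^ i) ` {..<n})"
    using algebraic_power_reduction by blast
  define B where "B = (\<lambda>i. a ^ i) ` {..<n}"
  define K where "K = rvs.span B"
  have fin: "finite B" by (simp add: B_def)
  have KB: "K = rat_span B" using rat_span_eq_span[OF fin] by (simp add: K_def)
  have pw: "a ^ i \<in> K" if "i \<le> n" for i
    using that n(2) by (cases "i = n") (auto simp: K_def B_def intro: rvs.span_base)
  have aK: "a * x \<in> K" if "x \<in> K" for x
    using that unfolding K_def
  proof (rule span_mult_closed[rotated])
    fix b assume "b \<in> B"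
    then obtain i where "b = a ^ i" "i < n" by (auto simp: B_def)
    then show "a * b \<in> rvs.span B" using pw[of "Suc i"] by (simp add: K_def)
  qed
  have apK: "a ^ i * x \<in> K" if "x \<in> K" for i x
    using that by (induction i) (auto simp: mult.assoc intro: aK)
  have mult: "x * y \<in> K" if "x \<in> K" "y \<in> K" for x y
    using that(2) unfolding K_def
  proof (rule span_mult_closed[rotated])
    fix b assume "b \<in> B"
    then obtain i where "b = a ^ i" by (auto simp: B_def)
    then show "x * b \<in> rvs.span B" using apK[OF that(1), of i] by (simp add: K_def mult.commute)
  qed
  have one: "1 \<in> K" using pw[of 0] by simp
  have KQ: "K \<subseteq> Qbar" using a by (auto simp: KB rat_span_def B_def)
  have rat: "of_rat q * x \<in> K" if "x \<in> K" for q x using that by (simp add: K_def rvs.span_scale)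
  have inv: "inverse x \<in> K" if x: "x \<in> K" "x \<noteq> 0" for x
  proof -
    have "algebraic x" using x KQ by (auto simp: Qbar_def)
    then obtain f where f: "coeff f 0 \<noteq> 0" "poly (map_poly of_int f) x = 0"
      using x(2) by (metis algebraicE'_nonzero)
    obtain c r where cr: "f = pCons c r" by (rule pCons_cases)
    with f have c: "c \<noteq> 0" by simp
    have "of_int c + x * poly (map_poly of_int r) x = 0" using f(2) by (simp add: cr map_poly_pCons)
    then have ix: "inverse x = of_rat (- 1 / of_int c) * poly (map_poly of_int r) x"
      using c x(2) by (simp add: of_rat_divide of_rat_minus field_simps eq_neg_iff_add_eq_0)
    have xp: "x ^ i \<in> K" for i by (induction i) (auto simp: one mult x)
    have "of_int k * x ^ i \<in> K" for k i using rat[OF xp, of "of_int k"] by simp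
    then have "poly (map_poly of_int r) x \<in> K"
      unfolding poly_altdef K_def by (intro rvs.span_sum) (simp add: coeff_map_poly)
    then show ?thesis unfolding ix by (rule rat)
  qed
  have "number_field K"
    unfolding number_field_def
  proof (intro conjI ballI impI)
    show "\<exists>B. finite B \<and> B \<subseteq> K \<and> K = rat_span B"
      using fin KB rvs.span_superset[of B] by (intro exI[of _ B]) (auto simp: K_def)
  qed (use KQ one mult inv in \<open>auto simp: K_def rvs.span_zero rvs.span_add rvs.span_diff\<close>)
  moreover have "a \<in> K" using aK[OF one] by simp
  ultimately show ?thesis by blast
qed

lemma number_field_Rats: "number_field \<rat>"
proof -
  have span: "\<rat> = rat_span {1}" by (auto simp: rat_span_def Rats_def)
  show ?thesis unfolding number_field_def
  proof (intro conjI ballI impI)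
    show "\<exists>B. finite B \<and> B \<subseteq> \<rat> \<and> \<rat> = rat_span B"
      by (rule exI[of _ "{1}"]) (simp add: span[symmetric])
  qed (auto simp: Qbar_def rat_imp_algebraic)
qed

text \<open>Separate the finitely many conjugates of the set \<open>H\<eta>\<close>, where \<open>\<eta>\<close> is a separating element for
  the finite set defining a neighbourhood of the identity inside \<open>H\<close>, by the value of the polynomial
  with that root set at a natural number.\<close>
lemma open_subgroup_stabilizer:
  assumes H: "subgroup H Gal_group" and op: "krull_open H"
  shows "\<exists>\<theta>\<in>Qbar. \<theta> \<noteq> 0 \<and> H = {\<sigma>\<in>Gal. \<sigma> \<theta> = \<theta>}"
proof -
  have HG: "H \<subseteq> Gal" using op by (simp add: krull_open_def)
  have idH: "id \<in> H" using subgroup.one_closed[OF H] by (simp add: Gal_group_def)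
  have comp: "\<sigma> \<circ> \<tau> \<in> H" if "\<sigma> \<in> H" "\<tau> \<in> H" for \<sigma> \<tau>
    using subgroup.m_closed[OF H that] by (simp add: Gal_group_def)
  obtain F where F: "finite F" "F \<subseteq> Qbar" "{\<tau>\<in>Gal. \<forall>a\<in>F. \<tau> a = id a} \<subseteq> H"
    using op idH unfolding krull_open_def by blast
  obtain \<eta> where \<eta>: "\<eta> \<in> Qbar" "\<And>\<sigma> \<tau>. \<sigma> \<in> Gal \<Longrightarrow> \<tau> \<in> Gal \<Longrightarrow> \<sigma> \<eta> = \<tau> \<eta> \<Longrightarrow> \<forall>s\<in>F. \<sigma> s = \<tau> s"
    using separating_element[OF F(1,2)] by blast
  \<comment> \<open>Agreement at \<eta> forces agreement on F, so \<sigma> is h times an element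
    fixing F pointwise, and such elements lie in H.\<close>
  have coset: "\<sigma> \<in> H" if s: "\<sigma> \<in> Gal" "h \<in> H" "\<sigma> \<eta> = h \<eta>" for \<sigma> h
  proof -
    have h: "h \<in> Gal" using that HG by blast
    have "(ginv h \<circ> \<sigma>) \<eta> = id \<eta>" using that h by (simp add: Gal_inv_left)
    then have "\<forall>a\<in>F. (ginv h \<circ> \<sigma>) a = id a" using \<eta>(2)[of "ginv h \<circ> \<sigma>" id] s h by simp
    then have "ginv h \<circ> \<sigma> \<in> H" using F(3) s h Gal_comp[OF Gal_inv[OF h] s(1)] by blast
    then have "h \<circ> (ginv h \<circ> \<sigma>) \<in> H" using comp s by blast
    moreover have "h \<circ> (ginv h \<circ> \<sigma>) = \<sigma>" using h by (auto simp: fun_eq_iff Gal_inv_right)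
    ultimately show ?thesis by simp
  qed
  define O' where "O' = (\<lambda>h. h \<eta>) ` H"
  have O': "O' \<subseteq> conjs \<eta>" using HG by (auto simp: O'_def conjs_def)
  have fin: "finite (conjs \<eta>)" by (rule finite_conjs[OF \<eta>(1)])
  have finO: "finite O'" using O' fin finite_subset by blast
  have O'Q: "O' \<subseteq> Qbar" using O' conjs_subset[OF \<eta>(1)] by blast
  have stab: "\<sigma> ` O' = O' \<longleftrightarrow> \<sigma> \<in> H" if s: "\<sigma> \<in> Gal" for \<sigma>
  proof
    assume "\<sigma> ` O' = O'"
    moreover have "\<eta> \<in> O'" unfolding O'_def by (rule image_eqI[where x = id]) (use idH in auto)
    ultimately have "\<sigma> \<eta> \<in> O'" by blast
    then show "\<sigma> \<in> H" using coset[OF s] by (auto simp: O'_def)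
  next
    assume sH: "\<sigma> \<in> H"
    have "\<sigma> ` O' \<subseteq> O'"
    proof clarify
      fix y assume "y \<in> O'"
      then obtain h where h: "h \<in> H" "y = h \<eta>" by (auto simp: O'_def)
      have "\<sigma> y = (\<sigma> \<circ> h) \<eta>" using h by simp
      then show "\<sigma> y \<in> O'" unfolding O'_def using comp[OF sH h(1)] by blast
    qed
    moreover have "card (\<sigma> ` O') = card O'"
      using Gal_inj[OF s] by (intro card_image) (auto simp: inj_on_def)
    ultimately show "\<sigma> ` O' = O'" using finO by (simp add: card_subset_eq)
  qed
  define Q :: "complex set \<Rightarrow> complex poly" where "Q T = (\<Prod>t\<in>T. [:- t, 1:])" for T
  have rootsQ: "poly (Q T) z = 0 \<longleftrightarrow> z \<in> T" if "finite T" for T z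
    using that by (auto simp: Q_def poly_prod)
  have Qne: "Q T \<noteq> Q O'" if "finite T" "T \<noteq> O'" for T
  proof
    assume eq: "Q T = Q O'"
    have "z \<in> T \<longleftrightarrow> z \<in> O'" for z using rootsQ[OF that(1), of z] rootsQ[OF finO, of z] eq by simp
    then show False using that(2) by blast
  qed
  \<comment> \<open>The sets T are the possible images of \<open>O'\<close> under automorphisms.
    Including \<open>O'\<close> itself in the excluded points makes \<theta> non-zero.\<close>
  define bad where "bad = O' \<union> (\<Union>T\<in>{T. T \<subseteq> conjs \<eta> \<and> T \<noteq> O'}. {z. poly (Q T - Q O') z = 0})"
  have "finite bad"
    unfolding bad_def
  proof (intro finite_UnI finite_UN_I finO)
    show "finite {T. T \<subseteq> conjs \<eta> \<and> T \<noteq> O'}" using fin by (auto intro: finite_subset[of _ "Pow (conjs \<eta>)"])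
    fix T assume "T \<in> {T. T \<subseteq> conjs \<eta> \<and> T \<noteq> O'}"
    then have "Q T - Q O' \<noteq> 0" using Qne[of T] fin finite_subset by auto
    then show "finite {z. poly (Q T - Q O') z = 0}" by (rule poly_roots_finite)
  qed
  then have "finite (of_nat -` bad :: nat set)" by (rule finite_vimageI) (auto simp: inj_on_def)
  then obtain t :: nat where t: "of_nat t \<notin> bad" by (metis ex_new_if_finite infinite_UNIV_nat vimage_eq)
  define \<theta> where "\<theta> = poly (Q O') (of_nat t)"
  have \<theta>: "\<theta> = (\<Prod>y\<in>O'. of_nat t - y)" by (simp add: \<theta>_def Q_def poly_prod)
  have \<theta>Q: "\<theta> \<in> Qbar" unfolding \<theta> using O'Q by auto
  have "\<theta> \<noteq> 0" using t rootsQ[OF finO] by (auto simp: \<theta>_def bad_def)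
  moreover have "\<sigma> \<theta> = \<theta> \<longleftrightarrow> \<sigma> \<in> H" if s: "\<sigma> \<in> Gal" for \<sigma>
  proof -
    have inj: "inj_on \<sigma> O'" using Gal_inj[OF s] by (auto simp: inj_on_def)
    have "\<sigma> \<theta> = (\<Prod>y\<in>O'. \<sigma> (of_nat t - y))" unfolding \<theta> using O'Q by (intro Gal_prod[OF s]) auto
    also have "\<dots> = (\<Prod>y\<in>O'. of_nat t - \<sigma> y)"
      using O'Q by (intro prod.cong) (auto simp: Gal_diff[OF s] Gal_of_nat[OF s])
    also have "\<dots> = poly (Q (\<sigma> ` O')) (of_nat t)" using inj by (simp add: Q_def poly_prod prod.reindex)
    finally have e: "\<sigma> \<theta> = poly (Q (\<sigma> ` O')) (of_nat t)" .
    have sub: "\<sigma> ` O' \<subseteq> conjs \<eta>" using O' Gal_image_conjs[OF s] by blast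
    have "\<sigma> \<theta> = \<theta> \<longleftrightarrow> \<sigma> ` O' = O'"
    proof
      assume "\<sigma> \<theta> = \<theta>"
      then have z: "poly (Q (\<sigma> ` O') - Q O') (of_nat t) = 0" using e by (simp add: \<theta>_def)
      show "\<sigma> ` O' = O'"
      proof (rule ccontr)
        assume "\<sigma> ` O' \<noteq> O'"
        then have "of_nat t \<in> bad" unfolding bad_def using sub z by blast
        then show False using t by simp
      qed
    qed (use e in \<open>simp add: \<theta>_def\<close>)
    then show ?thesis using stab[OF s] by simp
  qed
  ultimately show ?thesis using \<theta>Q HG by (intro bexI[of _ \<theta>]) auto
qed

text \<open>A prime dividing the numerator or denominator of the reduced fraction would occur
  equally often in both, contradicting coprimality.\<close>

lemma rat_padic_units:
  assumes "\<And>p. prime p \<Longrightarrow> padic_abs p q = 1"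
  shows "q = 1 \<or> q = - 1"
proof -
  obtain a b where ab: "quotient_of q = (a, b)" by fastforce
  have b: "b > 0" and cop: "coprime a b" and q: "q = of_int a / of_int b"
    using quotient_of_denom_pos[OF ab] quotient_of_coprime[OF ab] quotient_of_div[OF ab] by auto
  have a: "a \<noteq> 0" using assms[OF two_is_prime_nat] q by auto
  have mult: "multiplicity (int p) a = multiplicity (int p) b" if p: "prime p" for p
  proof -
    have "real p powr (real (multiplicity (int p) b) - real (multiplicity (int p) a)) = 1"
      using assms[OF p] padic_abs_fraction[OF p a, of b] b q by simp
    then show ?thesis using prime_gt_1_nat[OF p] by (simp add: powr_eq_one_iff)
  qed
  have unit: "\<bar>c\<bar> = 1" if c: "c = a \<or> c = b" for c
  proof (rule ccontr)
    assume "\<bar>c\<bar> \<noteq> 1"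
    moreover have "c \<noteq> 0" using c a b by auto
    ultimately have "nat \<bar>c\<bar> \<noteq> 1" by auto
    then obtain p where p: "prime p" "p dvd nat \<bar>c\<bar>" using prime_factor_nat by blast
    then have "int p dvd c" by (metis dvd_abs_iff int_dvd_int_iff nat_0_le abs_ge_zero)
    moreover have pe: "prime_elem (int p)" using p by simp
    ultimately have "multiplicity (int p) c > 0"
      using \<open>c \<noteq> 0\<close> by (simp add: prime_multiplicity_gt_zero_iff)
    then have "multiplicity (int p) a > 0" "multiplicity (int p) b > 0" using c mult[OF p(1)] by auto
    then have "int p dvd a" "int p dvd b" by (metis neq0_conv not_dvd_imp_multiplicity_0)+
    then have "is_unit (int p)" using cop coprime_common_divisor by blast
    then show False using prime_gt_1_nat[OF p(1)] by simp
  qed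
  from unit[of a] unit[of b] b have "b = 1" "a = 1 \<or> a = - 1" by auto
  then show ?thesis using q by auto
qed

text \<open>The rational numbers \<open>r(k)\<close>, the product of \<open>1 - D ^ e * k / t\<close> over the conjugates \<open>t\<close> of
  \<open>\<theta>\<close>, are units at the finitely many bad primes, which all divide \<open>D\<close>; since \<open>r\<close> is not constant,
  some \<open>r(k)\<close> is divisible by a good prime.\<close>
lemma isolating_place:
  assumes \<theta>: "\<theta> \<in> Qbar" "\<theta> \<noteq> 0"
  shows "\<exists>p N (m::nat). place_over Qbar p N \<and> \<theta> \<noteq> of_nat m \<and> N (\<theta> - of_nat m) < 1 \<and>
    (\<forall>t\<in>conjs \<theta>. t \<noteq> \<theta> \<longrightarrow> N (t - of_nat m) = 1)"
proof -
  define Np where "Np p = (SOME N. place_over Qbar p N)" for p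
  have Np: "place_over Qbar p (Np p)" if "prime p" for p
    unfolding Np_def using exists_place_over_Qbar[OF that] by (rule someI_ex)
  let ?T = "conjs \<theta>"
  have fin: "finite ?T" and TQ: "?T \<subseteq> Qbar" using finite_conjs[OF \<theta>(1)] conjs_subset[OF \<theta>(1)] by auto
  have T0: "t \<noteq> 0" if "t \<in> ?T" for t using that \<theta>(2) by (auto simp: conjs_def Gal_eq_0_iff)
  \<comment> \<open>Away from the primes where some element of Y fails to be a unit, the conjugates
    are units and remain distinct modulo the maximal ideal, so m can be congruent to at most one of
    them.\<close>
  define Y where "Y = insert \<theta> ((\<lambda>(t, t'). t - t') ` {(t, t')\<in>?T \<times> ?T. t \<noteq> t'})"
  have Y: "finite Y" "\<And>y. y \<in> Y \<Longrightarrow> y \<in> Qbar \<and> y \<noteq> 0"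
  proof -
    have "finite {(t, t')\<in>?T \<times> ?T. t \<noteq> t'}" by (rule finite_subset[of _ "?T \<times> ?T"]) (use fin in auto)
    then show "finite Y" by (simp add: Y_def)
    show "y \<in> Qbar \<and> y \<noteq> 0" if "y \<in> Y" for y using that TQ \<theta> by (auto simp: Y_def)
  qed
  define P where "P = (\<Union>y\<in>Y. {p. \<exists>N \<sigma>. place_over Qbar p N \<and> \<sigma> \<in> Gal \<and> N (\<sigma> y) \<noteq> 1})"
  have finP: "finite P" unfolding P_def using Y finite_nonunit_primes by auto
  have good: "Np p (\<sigma> y) = 1" if "prime p" "p \<notin> P" "y \<in> Y" "\<sigma> \<in> Gal" for p y \<sigma>
    using that Np by (auto simp: P_def)
  have goodT: "Np p t = 1" if "prime p" "p \<notin> P" "t \<in> ?T" for p t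
    using that good[of p \<theta>] by (auto simp: conjs_def Y_def)
  have Pprime: "prime p" if "p \<in> P" for p using that by (auto simp: P_def place_over_def)
  define D where "D = \<Prod>P"
  have D0: "D > 0" using finP Pprime prime_gt_0_nat by (auto simp: D_def intro!: prod_pos)
  have small: "Np p (of_nat D) < 1" if p: "p \<in> P" for p
  proof -
    note N = Np[OF Pprime[OF p]]
    have "p dvd D" unfolding D_def using finP p by (rule dvd_prodI)
    then obtain k where "D = p * k" by (elim dvdE)
    then have "Np p (of_nat D) = Np p (of_nat p) * Np p (of_nat k)"
      using place_mult[OF csubfield_Qbar N, of "of_nat p" "of_nat k"] by simp
    also have "\<dots> \<le> Np p (of_nat p) * 1"
      using place_of_nat_le_1[OF csubfield_Qbar N] place_nonneg[OF csubfield_Qbar N] by (intro mult_left_mono)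
    also have "\<dots> < 1" using place_p[OF csubfield_Qbar N] place_p_gt_1[OF csubfield_Qbar N] by simp
    finally show ?thesis .
  qed
  have "\<forall>z\<in>P \<times> ?T. \<forall>\<^sub>F e in sequentially. Np (fst z) (of_nat D) ^ e / Np (fst z) (snd z) < 1"
  proof
    fix z assume z: "z \<in> P \<times> ?T"
    note N = Np[OF Pprime, of "fst z"]
    have "(\<lambda>e. Np (fst z) (of_nat D) ^ e / Np (fst z) (snd z)) \<longlonglongrightarrow> 0 / Np (fst z) (snd z)"
      using z small[of "fst z"] place_nonneg[OF csubfield_Qbar N] place_pos[OF csubfield_Qbar N, of "snd z"] T0 TQ
      by (intro tendsto_divide LIMSEQ_realpow_zero tendsto_const) (auto simp: less_le)
    then show "\<forall>\<^sub>F e in sequentially. Np (fst z) (of_nat D) ^ e / Np (fst z) (snd z) < 1"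
      by (auto intro: order_tendstoD)
  qed
  then have "\<forall>\<^sub>F e in sequentially. \<forall>z\<in>P \<times> ?T. Np (fst z) (of_nat D) ^ e / Np (fst z) (snd z) < 1"
    using finP fin by (simp add: eventually_ball_finite)
  \<comment> \<open>The exponent compensates for conjugates that are small at bad primes: every
    multiple m of D^e makes m / t smaller than 1 there, and hence 1 - m / t a unit.\<close>
  then obtain e where e: "\<And>p t. p \<in> P \<Longrightarrow> t \<in> ?T \<Longrightarrow> Np p (of_nat D) ^ e / Np p t < 1"
    by (fastforce simp: eventually_sequentially)
  define A where "A = D ^ e"
  have A0: "A > 0" using D0 by (simp add: A_def)
  define r where "r = (\<Prod>t\<in>?T. [:1, - of_nat A / t:])"
  have pr: "poly r z = (\<Prod>t\<in>?T. 1 - of_nat A * z / t)" for z by (simp add: r_def poly_prod field_simps)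
  have degr: "degree r > 0"
  proof -
    have "degree r = (\<Sum>t\<in>?T. degree [:1, - of_nat A / t:])"
      unfolding r_def by (rule degree_prod_eq_sum_degree) auto
    also have "\<dots> = (\<Sum>t\<in>?T. 1)" using T0 A0 by (intro sum.cong) auto
    also have "\<dots> > 0" using fin self_conjs[of \<theta>] by (auto simp: card_gt_0_iff simp del: self_conjs)
    finally show ?thesis .
  qed
  have finc: "finite {z. poly (r - [:c:]) z = 0}" for c
  proof (rule poly_roots_finite)
    show "r - [:c:] \<noteq> 0" using degr by (metis degree_pCons_0 eq_iff_diff_eq_0 less_irrefl)
  qed
  have "finite (of_nat -` ({z. poly (r - [:0:]) z = 0} \<union> {z. poly (r - [:1:]) z = 0} \<union> {z. poly (r - [:-1:]) z = 0}) :: nat set)"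
    by (rule finite_vimageI[OF finite_UnI[OF finite_UnI[OF finc finc] finc]]) (auto simp: inj_on_def)
  then obtain k :: nat where "of_nat k \<notin> {z. poly (r - [:0:]) z = 0} \<union> {z. poly (r - [:1:]) z = 0} \<union> {z. poly (r - [:-1:]) z = 0}"
    by (metis ex_new_if_finite infinite_UNIV_nat vimage_eq)
  \<comment> \<open>Rational numbers that are units at every prime are 1 or -1, so avoiding these
    forces a non-unit factor; avoiding 0 ensures that no conjugate equals m.\<close>
  then have k: "poly r (of_nat k) \<noteq> 0" "poly r (of_nat k) \<noteq> 1" "poly r (of_nat k) \<noteq> - 1"
    by (auto simp: add_eq_0_iff)
  define m where "m = A * k"
  define fac where "fac t = 1 - of_nat m / t" for t :: complex
  have facQ: "fac t \<in> Qbar" if "t \<in> ?T" for t using that TQ by (auto simp: fac_def)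
  have rr: "poly r (of_nat k) = (\<Prod>t\<in>?T. fac t)" by (simp add: pr fac_def m_def)
  have fac0: "fac t \<noteq> 0" if "t \<in> ?T" for t using k(1) that fin unfolding rr by (auto simp: prod_zero_iff)
  have "(\<Prod>t\<in>?T. fac t) \<in> \<rat>"
  proof (rule Gal_fixed_imp_rational)
    show "(\<Prod>t\<in>?T. fac t) \<in> Qbar" using facQ by auto
    fix \<sigma> assume s: "\<sigma> \<in> Gal"
    show "\<sigma> (\<Prod>t\<in>?T. fac t) = (\<Prod>t\<in>?T. fac t)"
    proof (rule Gal_prod_conjs[OF s])
      fix t assume "t \<in> ?T"
      then have "t \<in> Qbar" using TQ by auto
      then show "fac (\<sigma> t) = \<sigma> (fac t)"
        using s by (simp add: fac_def Gal_diff Gal_divide Gal_1 Gal_of_nat)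
    qed (rule facQ)
  qed
  then obtain q where q: "(\<Prod>t\<in>?T. fac t) = of_rat q" by (auto elim: Rats_cases)
  have "\<exists>p t. prime p \<and> t \<in> ?T \<and> Np p (fac t) \<noteq> 1"
  proof (rule ccontr)
    assume con: "\<not> ?thesis"
    have "padic_abs p q = 1" if p: "prime p" for p
    proof -
      note N = Np[OF p]
      have "Np p (\<Prod>t\<in>S. fac t) = 1" if "finite S" "S \<subseteq> ?T" for S
        using that
      proof (induction S rule: finite_induct)
        case (insert t S)
        then have "Np p (fac t * (\<Prod>t\<in>S. fac t)) = Np p (fac t) * Np p (\<Prod>t\<in>S. fac t)"
          using facQ by (intro place_mult[OF csubfield_Qbar N]) auto
        then show ?case using insert con p by auto
      qed (simp add: place_1[OF csubfield_Qbar N])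
      from this[OF fin order_refl] show ?thesis using q place_of_rat[OF csubfield_Qbar N, of q] by simp
    qed
    then have "q = 1 \<or> q = - 1" by (rule rat_padic_units)
    then show False using k q rr by (auto simp: of_rat_minus)
  qed
  then obtain p t where pt: "prime p" "t \<in> ?T" "Np p (fac t) \<noteq> 1" by blast
  note N = Np[OF pt(1)]
  have tQ: "t \<in> Qbar" and tnz: "t \<noteq> 0" using pt TQ T0 by auto
  have mQ: "of_nat m / t \<in> Qbar" using tQ by auto
  have vm: "Np p (of_nat m / t) = Np p (of_nat m) / Np p t"
    by (rule place_divide[OF csubfield_Qbar N _ tQ]) auto
  have pP: "p \<notin> P"
  proof
    assume p: "p \<in> P"
    have "of_nat m = of_nat D ^ e * (of_nat k :: complex)" by (simp add: m_def A_def)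
    then have "Np p (of_nat m) = Np p (of_nat D) ^ e * Np p (of_nat k)"
      using place_mult[OF csubfield_Qbar N, of "of_nat D ^ e" "of_nat k"] place_power[OF csubfield_Qbar N] by simp
    also have "\<dots> \<le> Np p (of_nat D) ^ e"
      using place_of_nat_le_1[OF csubfield_Qbar N] place_nonneg[OF csubfield_Qbar N] by (simp add: mult_left_le)
    finally have "Np p (of_nat m / t) \<le> Np p (of_nat D) ^ e / Np p t"
      unfolding vm using place_nonneg[OF csubfield_Qbar N] by (simp add: divide_right_mono)
    then have "Np p (of_nat m / t) < 1" using e[OF p pt(2)] by simp
    then have "Np p (- (of_nat m / t)) < Np p 1"
      using place_uminus[OF csubfield_Qbar N mQ] place_1[OF csubfield_Qbar N] by simp
    then have "Np p (1 + - (of_nat m / t)) = Np p 1"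
      using mQ by (intro place_add_eq[OF csubfield_Qbar N]) auto
    then show False using pt(3) place_1[OF csubfield_Qbar N] by (simp add: fac_def)
  qed
  have Nt: "Np p t = 1" using goodT pt pP by blast
  have "Np p (fac t) \<le> max (Np p 1) (Np p (of_nat m / t))"
    unfolding fac_def using mQ by (intro place_diff[OF csubfield_Qbar N]) auto
  also have "\<dots> \<le> 1"
    using vm Nt place_of_nat_le_1[OF csubfield_Qbar N, of m] place_1[OF csubfield_Qbar N] by simp
  finally have f1: "Np p (fac t) < 1" using pt(3) by simp
  have tm: "Np p (t - of_nat m) < 1"
  proof -
    have "t - of_nat m = t * fac t" using tnz by (simp add: fac_def field_simps)
    then show ?thesis using place_mult[OF csubfield_Qbar N tQ facQ[OF pt(2)]] Nt f1 by simp
  qed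
  \<comment> \<open>The conjugate found need not be \<theta> itself. Twisting the absolute value by
    \<tau> moves the isolated conjugate to \<theta>.\<close>
  obtain \<tau> where \<tau>: "\<tau> \<in> Gal" "t = \<tau> \<theta>" using pt(2) by (auto simp: conjs_def)
  have place: "place_over Qbar p (pl (Np p) Qbar \<tau>)"
    by (rule pl_place_over[OF N csubfield_Qbar order_refl \<tau>(1)])
  have ev: "pl (Np p) Qbar \<tau> (s - of_nat m) = Np p (\<tau> s - of_nat m)" if "s \<in> Qbar" for s
    using that \<tau>(1) by (simp add: pl_def Gal_diff Gal_of_nat)
  have "\<theta> \<noteq> of_nat m"
  proof
    assume "\<theta> = of_nat m"
    then have "t = of_nat m" using \<tau> by (simp add: Gal_of_nat)
    then show False using fac0[OF pt(2)] tnz by (simp add: fac_def)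
  qed
  moreover have "pl (Np p) Qbar \<tau> (\<theta> - of_nat m) < 1" using ev[OF \<theta>(1)] tm \<tau> by simp
  moreover have "pl (Np p) Qbar \<tau> (s - of_nat m) = 1" if s: "s \<in> ?T" "s \<noteq> \<theta>" for s
  proof -
    have sQ: "s \<in> Qbar" using s TQ by auto
    have "(s, \<theta>) \<in> {(t, t')\<in>?T \<times> ?T. t \<noteq> t'}" using s self_conjs by auto
    \<comment> \<open>The number s - m is the sum of s - \<theta>, a unit at the twisted place, and
      \<theta> - m, which is smaller than 1 there.\<close>
    then have "s - \<theta> \<in> Y" unfolding Y_def by force
    then have "Np p (\<tau> (s - \<theta>)) = 1" using good pt(1) pP \<tau>(1) by blast
    then have "Np p (\<tau> s - t) = 1" using Gal_diff[OF \<tau>(1) sQ \<theta>(1)] \<tau> by simp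
    moreover have "\<tau> s \<in> Qbar" using sQ Gal_Qbar[OF \<tau>(1)] by simp
    ultimately have "Np p ((\<tau> s - t) + (t - of_nat m)) = Np p (\<tau> s - t)"
      using tQ tm by (intro place_add_eq[OF csubfield_Qbar N]) auto
    then show ?thesis using ev[OF sQ] \<open>Np p (\<tau> s - t) = 1\<close> by simp
  qed
  ultimately show ?thesis using place by blast
qed

section \<open>Consistent maps from densities on the Galois group\<close>

lemma depends_cong: "(\<And>\<sigma>. \<sigma> \<in> Gal \<Longrightarrow> h \<sigma> = h' \<sigma>) \<Longrightarrow> depends S h \<Longrightarrow> depends S h'"
  unfolding depends_def by metis

lemma alg_int_unit_1: "alg_int_unit 1"
proof -
  have "algebraic_integer 1"
    unfolding algebraic_integer_def
    by (rule exI[of _ "[:- 1, 1:]"]) (auto simp: coeff_pCons split: nat.splits)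
  then show ?thesis by (simp add: alg_int_unit_def)
qed

text \<open>The consistent map attached to a weight function \<open>g p\<close> on the Galois group for each prime \<open>p\<close>: push the
  measure with density \<open>g p\<close> forward to the places above \<open>p\<close>.\<close>
locale weights =
  fixes N :: "nat \<Rightarrow> complex \<Rightarrow> real" and g :: "nat \<Rightarrow> (complex \<Rightarrow> complex) \<Rightarrow> real" and S0 :: "complex set"
  assumes N: "\<And>p. prime p \<Longrightarrow> place_over Qbar p (N p)"
    and S0: "finite S0" "S0 \<subseteq> Qbar"
    and g_depends: "\<And>p. depends S0 (g p)"
    and g_rat: "\<And>p \<sigma>. \<sigma> \<in> Gal \<Longrightarrow> g p \<sigma> \<in> \<rat>"
begin

definition weight :: "nat \<Rightarrow> complex set \<Rightarrow> (complex \<Rightarrow> real) \<Rightarrow> (complex \<Rightarrow> complex) \<Rightarrow> real" where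
  "weight p K v \<sigma> = (if pl (N p) K \<sigma> = v then g p \<sigma> else 0)"

definition cm :: cmap where "cm K v = avg (weight (place_prime v) K v)"

lemma depends_weight:
  assumes "B \<subseteq> Qbar" "K = rvs.span B"
  shows "depends (B \<union> S0) (weight p K v)"
proof -
  have "depends (B \<union> S0) (pl M K)" "depends (B \<union> S0) (g p)" for M
    using depends_mono[OF depends_pl[OF assms]] depends_mono[OF g_depends] by auto
  then show ?thesis unfolding depends_def weight_def by metis
qed

lemma cm_eq:
  assumes "finite B" "B \<subseteq> Qbar" "K = rvs.span B"
  shows "cm K v = avg_on (B \<union> S0) (weight (place_prime v) K v)"
  unfolding cm_def
proof (rule avg_eq)
  show "depends (B \<union> S0) (weight (place_prime v) K v)" by (rule depends_weight[OF assms(2,3)])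
qed (use assms S0 in auto)

lemma place_prime_pl:
  assumes "prime p" "csubfield K" "K \<subseteq> Qbar" "\<sigma> \<in> Gal"
  shows "place_prime (pl (N p) K \<sigma>) = p"
  using place_over_place_prime[OF pl_place_over[OF N[OF assms(1)] assms(2-4)]] .

text \<open>Each automorphism puts its weight on exactly one place of L, and that place lies above v
  precisely when the automorphism induces v on K. Summing over the places above v therefore
  reproduces the integral for v pointwise.\<close>

lemma cm_consistent: "cm \<in> consistent_maps"
  unfolding consistent_maps_def
proof (intro CollectI conjI allI impI)
  fix K v assume "number_field K \<and> nonarch_place K v"
  then have nf: "number_field K" by blast
  obtain B where B: "finite B" "B \<subseteq> Qbar" "K = rvs.span B" by (rule number_field_basis[OF nf])
  show "cm K v \<in> \<rat>" unfolding cm_eq[OF B] by (rule avg_on_rat) (simp add: weight_def g_rat)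
next
  fix K L v assume h: "number_field K \<and> number_field L \<and> K \<subseteq> L \<and> nonarch_place K v"
  then have nf: "number_field K" "number_field L" and KL: "K \<subseteq> L" by auto
  note K = number_field_csubfield[OF nf(1)] number_field_subset_Qbar[OF nf(1)]
  note L = number_field_csubfield[OF nf(2)] number_field_subset_Qbar[OF nf(2)]
  obtain B where B: "finite B" "B \<subseteq> Qbar" "K = rvs.span B" by (rule number_field_basis[OF nf(1)])
  obtain C where C: "finite C" "C \<subseteq> Qbar" "L = rvs.span C" by (rule number_field_basis[OF nf(2)])
  let ?p = "place_prime v" and ?W = "{w. nonarch_place L w \<and> (\<forall>z\<in>K. w z = v z)}"
  have vo: "place_over K ?p v" using h nonarch_place_over by blast
  then have p: "prime ?p" by (simp add: place_over_def)
  have wo: "place_over L ?p w" if "w \<in> ?W" for w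
  proof -
    have "w (of_rat q) = v (of_rat q)" for q using that csubfield_of_rat[OF K(1), of q] by blast
    then show ?thesis using that vo by (simp add: place_over_def)
  qed
  then have pw: "place_prime w = ?p" if "w \<in> ?W" for w using that place_over_place_prime by blast
  \<comment> \<open>Conjugacy makes the set of places above v finite, without which its
    \<open>sum\<close> would be 0 by default.\<close>
  have "?W \<subseteq> pl (N ?p) L ` Gal"
    using places_conjugate[OF nf(2) wo N[OF p]] by blast
  then have finW: "finite ?W" using finite_pl[OF nf(2)] finite_subset by blast
  have res: "(\<forall>z\<in>K. pl (N ?p) L \<sigma> z = v z) \<longleftrightarrow> pl (N ?p) K \<sigma> = v" for \<sigma>
  proof
    assume *: "\<forall>z\<in>K. pl (N ?p) L \<sigma> z = v z"
    show "pl (N ?p) K \<sigma> = v"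
    proof
      fix z show "pl (N ?p) K \<sigma> z = v z"
        using *[rule_format, of z] subsetD[OF KL, of z] place_outside[OF K(1) vo, of z]
        by (cases "z \<in> K") (simp_all add: pl_def)
    qed
  next
    assume e: "pl (N ?p) K \<sigma> = v"
    show "\<forall>z\<in>K. pl (N ?p) L \<sigma> z = v z"
    proof
      fix z assume "z \<in> K"
      then show "pl (N ?p) L \<sigma> z = v z" using fun_cong[OF e, of z] subsetD[OF KL, of z] by (simp add: pl_def)
    qed
  qed
  let ?S = "(B \<union> C) \<union> S0"
  have S: "finite ?S" "?S \<subseteq> Qbar" using B C S0 by auto
  have spC: "avg_on ?S (weight ?p L w) = cm L w" if "w \<in> ?W" for w
  proof -
    have "avg_on ?S (weight ?p L w) = avg_on (C \<union> S0) (weight ?p L w)"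
      using S by (intro avg_on_mono_set depends_weight[OF C(2,3)]) auto
    then show ?thesis using cm_eq[OF C, of w] pw[OF that] by simp
  qed
  have spB: "avg_on ?S (weight ?p K v) = cm K v"
  proof -
    have "avg_on ?S (weight ?p K v) = avg_on (B \<union> S0) (weight ?p K v)"
      using S by (intro avg_on_mono_set depends_weight[OF B(2,3)]) auto
    then show ?thesis using cm_eq[OF B, of v] by simp
  qed
  have "(\<Sum>w\<in>?W. cm L w) = (\<Sum>w\<in>?W. avg_on ?S (weight ?p L w))" using spC by simp
  also have "\<dots> = avg_on ?S (\<lambda>\<sigma>. \<Sum>w\<in>?W. weight ?p L w \<sigma>)" by (simp add: avg_on_sum)
  also have "\<dots> = avg_on ?S (weight ?p K v)"
  proof (rule avg_on_cong)
    fix \<sigma> assume s: "\<sigma> \<in> Gal"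
    have "nonarch_place L (pl (N ?p) L \<sigma>)"
      using pl_place_over[OF N[OF p] L s] by (simp add: place_over_def)
    then have iff: "pl (N ?p) L \<sigma> \<in> ?W \<longleftrightarrow> pl (N ?p) K \<sigma> = v" using res by simp
    have "(\<Sum>w\<in>?W. weight ?p L w \<sigma>) = (\<Sum>w\<in>?W. if w = pl (N ?p) L \<sigma> then g ?p \<sigma> else 0)"
      by (intro sum.cong) (auto simp: weight_def)
    also have "\<dots> = weight ?p K v \<sigma>" using finW iff by (simp add: weight_def)
    finally show "(\<Sum>w\<in>?W. weight ?p L w \<sigma>) = weight ?p K v \<sigma>" .
  qed
  also have "\<dots> = cm K v" by (rule spB)
  finally show "cm K v = (\<Sum>w\<in>?W. cm L w)" by simp
qed

text \<open>Automorphisms fix the rationals, so all of them induce the same place and the whole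
  density is integrated.\<close>

lemma cm_Rats:
  assumes p: "prime p"
  shows "cm \<rat> (rat_place p) = avg (g p)"
proof -
  have e: "pl (N p) \<rat> \<sigma> = rat_place p" if "\<sigma> \<in> Gal" for \<sigma>
  proof
    fix z show "pl (N p) \<rat> \<sigma> z = rat_place p z"
    proof (cases "z \<in> \<rat>")
      case True
      then obtain q where q: "z = of_rat q" by (auto elim: Rats_cases)
      then have "(THE q. z = of_rat q) = q" by auto
      then show ?thesis using True q place_of_rat[OF csubfield_Qbar N[OF p]] Gal_of_rat[OF that]
        by (simp add: pl_def rat_place_def)
    qed (simp add: pl_def rat_place_def)
  qed
  have pp: "place_prime (rat_place p) = p"
    using place_prime_pl[OF p number_field_csubfield[OF number_field_Rats]
        number_field_subset_Qbar[OF number_field_Rats] Gal_id] e[OF Gal_id] by simp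
  obtain B where B: "finite B" "B \<subseteq> Qbar" "\<rat> = rvs.span B"
    by (rule number_field_basis[OF number_field_Rats])
  have "cm \<rat> (rat_place p) = avg_on (B \<union> S0) (weight p \<rat> (rat_place p))" using cm_eq[OF B] pp by simp
  also have "\<dots> = avg_on (B \<union> S0) (g p)" by (rule avg_on_cong) (simp add: weight_def e)
  also have "\<dots> = avg (g p)"
    using B S0 depends_mono[OF g_depends] by (intro avg_eq[symmetric]) auto
  finally show ?thesis .
qed

section \<open>Evaluation of the functional and the boundedness estimate\<close>

lemma depends_log: "depends {a} (\<lambda>\<sigma>. ln (N p (\<sigma> a)))"
  unfolding depends_def by auto

lemma depends_weighted_log: "depends (insert a S0) (\<lambda>\<sigma>. g p \<sigma> * ln (N p (\<sigma> a)))"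
  using depends_mono[OF depends_log, of a "insert a S0" p] depends_mono[OF g_depends, of "insert a S0" p]
  unfolding depends_def by (metis empty_subsetI insert_subset insertI1 subset_insertI)

text \<open>Grouping automorphisms by the place they induce turns the sum over places above p into
  one average. P may be larger than necessary, which lets two elements be evaluated over the same
  set of primes.\<close>

theorem Phi_cm:
  assumes a: "a \<in> Qbar" "a \<noteq> 0" and P: "finite P" "\<And>p. p \<in> P \<Longrightarrow> prime p"
    and out: "\<And>p \<sigma>. prime p \<Longrightarrow> p \<notin> P \<Longrightarrow> \<sigma> \<in> Gal \<Longrightarrow> N p (\<sigma> a) = 1"
  shows "Phi cm a = (\<Sum>p\<in>P. avg (\<lambda>\<sigma>. g p \<sigma> * ln (N p (\<sigma> a))) / ln (real p))"
proof -
  define good where "good = (\<lambda>(K, n::nat, b). number_field K \<and> n \<ge> 1 \<and> b \<in> K - {0} \<and> alg_int_unit (a ^ n / b))"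
  obtain K0 where "number_field K0" "a \<in> K0" using number_field_adjoin[OF a(1)] by blast
  \<comment> \<open>This triple only shows that the choice succeeds; the argument must then work for
    whichever field, exponent and element were chosen.\<close>
  then have "good (K0, 1, a)" using a(2) alg_int_unit_1 by (simp add: good_def)
  then have "good (SOME t. good t)" by (rule someI)
  then obtain K n b where t: "(SOME t. good t) = (K, n, b)" and "good (K, n, b)"
    by (metis prod_cases3)
  then have nf: "number_field K" and n: "n \<ge> 1" and b: "b \<in> K" "b \<noteq> 0" and u: "alg_int_unit (a ^ n / b)"
    by (auto simp: good_def)
  note K = number_field_csubfield[OF nf] number_field_subset_Qbar[OF nf]
  obtain B where B: "finite B" "B \<subseteq> Qbar" "K = rvs.span B" by (rule number_field_basis[OF nf])
  have bQ: "b \<in> Qbar" using b K by auto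
  define F where "F v = cm K v / ln (real (place_prime v)) * ln (v b powr (1 / real n))" for v
  have Phi: "Phi cm a = infsum F {v. nonarch_place K v}"
    using t unfolding Phi_def good_def F_def by simp
  have rel: "N p (\<sigma> b) = N p (\<sigma> a) ^ n" if p: "prime p" and s: "\<sigma> \<in> Gal" for p \<sigma>
  proof -
    note Np = N[OF p]
    have uQ: "a ^ n / b \<in> Qbar" using a bQ by auto
    have sQ: "\<sigma> a \<in> Qbar" "\<sigma> b \<in> Qbar" "\<sigma> b \<noteq> 0" using a b bQ s by (auto simp: Gal_Qbar Gal_eq_0_iff)
    have "\<sigma> (a ^ n / b) = \<sigma> a ^ n / \<sigma> b" using a(1) bQ s by (simp add: Gal_divide Gal_power)
    then have "N p (\<sigma> a ^ n / \<sigma> b) = 1" using alg_int_unit_place[OF Np s u uQ] by simp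
    moreover have "N p (\<sigma> a ^ n / \<sigma> b) = N p (\<sigma> a) ^ n / N p (\<sigma> b)"
      using place_divide[OF csubfield_Qbar Np] place_power[OF csubfield_Qbar Np] sQ by auto
    ultimately show ?thesis using place_pos[OF csubfield_Qbar Np sQ(2,3)] by (simp add: field_simps)
  qed
  have lnrel: "ln (N p (\<sigma> b) powr (1 / real n)) = ln (N p (\<sigma> a))" if p: "prime p" and s: "\<sigma> \<in> Gal" for p \<sigma>
  proof -
    have "N p (\<sigma> a) > 0"
      using place_pos[OF csubfield_Qbar N[OF p]] a s by (simp add: Gal_Qbar Gal_eq_0_iff)
    then show ?thesis unfolding rel[OF p s] using n by (simp add: ln_powr ln_realpow)
  qed
  define W where "W p = pl (N p) K ` Gal" for p
  have finW: "finite (W p)" for p unfolding W_def by (rule finite_pl[OF nf])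
  have Wp: "place_over K p v" "place_prime v = p" if "prime p" "v \<in> W p" for p v
    using that pl_place_over[OF N K] place_prime_pl[OF _ K] by (auto simp: W_def)
  \<comment> \<open>By conjugacy, every place above a prime outside P gives b size 1, and its
    summand vanishes. The sum over all places thus becomes finite.\<close>
  have "infsum F {v. nonarch_place K v} = infsum F (\<Union>p\<in>P. W p)"
  proof (rule infsum_cong_neutral)
    fix v assume "v \<in> {v. nonarch_place K v} - (\<Union>p\<in>P. W p)"
    then have v: "place_over K (place_prime v) v" and nW: "\<And>p. p \<in> P \<Longrightarrow> v \<notin> W p"
      using nonarch_place_over by auto
    let ?p = "place_prime v"
    have p: "prime ?p" using v by (simp add: place_over_def)
    obtain \<sigma> where s: "\<sigma> \<in> Gal" "v = pl (N ?p) K \<sigma>" using places_conjugate[OF nf v N[OF p]] by blast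
    have "?p \<notin> P" using nW[of ?p] s by (auto simp: W_def)
    then have "N ?p (\<sigma> a) = 1" using out p s by blast
    moreover have "v b = N ?p (\<sigma> b)" using s(2) b(1) by (metis pl_def)
    ultimately have "v b = 1" using rel[OF p s(1)] by simp
    then show "F v = 0" by (simp add: F_def)
  next
    fix v assume "v \<in> (\<Union>p\<in>P. W p) - {v. nonarch_place K v}"
    then obtain p where "p \<in> P" "v \<in> W p" and nv: "\<not> nonarch_place K v" by auto
    then have "place_over K p v" using Wp(1) P(2) by blast
    then show "F v = 0" using nv by (simp add: place_over_def)
  qed simp
  also have "\<dots> = sum F (\<Union>p\<in>P. W p)" using P(1) finW by (intro infsum_finite) auto
  also have "\<dots> = (\<Sum>p\<in>P. sum F (W p))"
  proof (rule sum.UNION_disjoint[OF P(1)])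
    show "\<forall>p\<in>P. \<forall>p'\<in>P. p \<noteq> p' \<longrightarrow> W p \<inter> W p' = {}" using Wp(2) P(2) by blast
  qed (use finW in auto)
  also have "\<dots> = (\<Sum>p\<in>P. avg (\<lambda>\<sigma>. g p \<sigma> * ln (N p (\<sigma> a))) / ln (real p))"
  proof (rule sum.cong[OF refl])
    fix p assume "p \<in> P"
    then have p: "prime p" using P by blast
    let ?S = "B \<union> S0"
    have "sum F (W p) = (\<Sum>v\<in>W p. ln (v b powr (1 / real n)) * avg_on ?S (weight p K v)) / ln (real p)"
      unfolding sum_divide_distrib
      by (rule sum.cong) (use Wp[OF p] cm_eq[OF B] in \<open>auto simp: F_def mult_ac\<close>)
    also have "(\<Sum>v\<in>W p. ln (v b powr (1 / real n)) * avg_on ?S (weight p K v)) =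
        avg_on ?S (\<lambda>\<sigma>. \<Sum>v\<in>W p. ln (v b powr (1 / real n)) * weight p K v \<sigma>)"
      unfolding avg_on_sum avg_on_cmult ..
    also have "\<dots> = avg_on ?S (\<lambda>\<sigma>. g p \<sigma> * ln (N p (\<sigma> b) powr (1 / real n)))"
    proof (rule avg_on_cong)
      fix \<sigma> assume s: "\<sigma> \<in> Gal"
      have "(\<Sum>v\<in>W p. ln (v b powr (1 / real n)) * weight p K v \<sigma>) =
          (\<Sum>v\<in>W p. if v = pl (N p) K \<sigma> then ln (v b powr (1 / real n)) * g p \<sigma> else 0)"
        by (intro sum.cong) (auto simp: weight_def)
      also have "\<dots> = ln (pl (N p) K \<sigma> b powr (1 / real n)) * g p \<sigma>"
        using finW[of p] s by (simp add: W_def)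
      also have "\<dots> = g p \<sigma> * ln (N p (\<sigma> b) powr (1 / real n))" using b(1) by (simp add: pl_def)
      finally show "(\<Sum>v\<in>W p. ln (v b powr (1 / real n)) * weight p K v \<sigma>) =
        g p \<sigma> * ln (N p (\<sigma> b) powr (1 / real n))" .
    qed
    also have "\<dots> = avg_on ?S (\<lambda>\<sigma>. g p \<sigma> * ln (N p (\<sigma> a)))"
      by (rule avg_on_cong) (simp only: lnrel[OF p])
    also have "\<dots> = avg (\<lambda>\<sigma>. g p \<sigma> * ln (N p (\<sigma> a)))"
    proof (rule avg_eq[symmetric])
      have "depends ?S (\<lambda>\<sigma>. g p \<sigma> * ln (N p (\<sigma> b) powr (1 / real n)))"
        unfolding depends_def
      proof (intro ballI impI)
        fix \<sigma> \<tau> assume st: "\<sigma> \<in> Gal" "\<tau> \<in> Gal" "\<forall>s\<in>?S. \<sigma> s = \<tau> s"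
        have "\<sigma> b = \<tau> b" using Gal_agree_span[OF st(1,2) B(2)] st(3) b(1) B(3) by blast
        moreover have "g p \<sigma> = g p \<tau>" using dependsD[OF g_depends st(1,2)] st(3) by blast
        ultimately show "g p \<sigma> * ln (N p (\<sigma> b) powr (1 / real n)) = g p \<tau> * ln (N p (\<tau> b) powr (1 / real n))" by simp
      qed
      then show "depends ?S (\<lambda>\<sigma>. g p \<sigma> * ln (N p (\<sigma> a)))"
        by (rule depends_cong[rotated]) (simp only: lnrel[OF p])
    qed (use B S0 in auto)
    finally show "sum F (W p) = avg (\<lambda>\<sigma>. g p \<sigma> * ln (N p (\<sigma> a))) / ln (real p)" .
  qed
  finally show ?thesis using Phi by simp
qed

text \<open>The value at v is at most G times the measure of the automorphisms inducing v, and
  \<open>degree_quotient_bound\<close> says that this measure cancels the degree factor.\<close>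

lemma cm_abs_bound:
  assumes nf: "number_field K" and v: "place_over K p v" and G: "\<And>\<sigma>. \<sigma> \<in> Gal \<Longrightarrow> \<bar>g p \<sigma>\<bar> \<le> G"
  shows "\<bar>real (nf_degree K) / real (local_degree K v) * (cm K v / ln (real p))\<bar> \<le> G / ln (real p)"
proof -
  obtain B where B: "finite B" "B \<subseteq> Qbar" "K = rvs.span B" by (rule number_field_basis[OF nf])
  have p: "prime p" using v by (simp add: place_over_def)
  have lnp: "ln (real p) > 0" using prime_gt_1_nat[OF p] by simp
  have G0: "G \<ge> 0" using G[OF Gal_id] by linarith
  let ?one = "\<lambda>\<sigma>. if pl (N p) K \<sigma> = v then 1 else 0 :: real"
  have d1: "depends B ?one" using depends_pl[OF B(2,3), of "N p"] unfolding depends_def by metis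
  let ?n = "real (card {e\<in>Emb B. pl (N p) K (lift B e) = v})" and ?E = "real (card (Emb B))"
  have "\<bar>cm K v\<bar> = \<bar>avg_on (B \<union> S0) (weight p K v)\<bar>"
    using cm_eq[OF B] place_over_place_prime[OF v] by simp
  also have "\<dots> \<le> avg_on (B \<union> S0) (\<lambda>\<sigma>. G * ?one \<sigma>)"
    by (rule avg_on_abs_le) (use G in \<open>auto simp: weight_def\<close>)
  also have "\<dots> = G * avg_on B ?one"
    unfolding avg_on_cmult using avg_on_mono_set[OF _ _ _ d1, of "B \<union> S0"] B S0 by simp
  also have "avg_on B ?one = ?n / ?E"
  proof -
    have "(\<Sum>e\<in>Emb B. ?one (lift B e)) = (\<Sum>e\<in>{e\<in>Emb B. pl (N p) K (lift B e) = v}. 1)"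
      using finite_Emb[OF B(1,2)] by (intro sum.mono_neutral_cong_right) auto
    then show ?thesis by (simp add: avg_on_def)
  qed
  finally have le: "\<bar>cm K v\<bar> \<le> G * (?n / ?E)" .
  let ?l = "real (local_degree K v)" and ?d = "real (nf_degree K)"
  have q: "?d / ?l * (?n / ?E) \<le> 1"
  \<comment> \<open>Division by zero yields 0, so a vanishing local degree would make the left side
    0; the case is settled without proving the degree positive.\<close>
  proof (cases "?l = 0")
    case False
    then have "?l > 0" by simp
    moreover have "?E > 0" using card_Emb_pos[OF B(1,2)] by simp
    moreover have "?d * ?n \<le> ?E * ?l" by (rule degree_quotient_bound[OF nf v N[OF p] B])
    ultimately show ?thesis by (simp add: field_simps)
  qed simp
  have "\<bar>?d / ?l * (cm K v / ln (real p))\<bar> = ?d / ?l * \<bar>cm K v\<bar> / ln (real p)"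
    using lnp by (simp add: abs_mult)
  also have "\<dots> \<le> ?d / ?l * (G * (?n / ?E)) / ln (real p)"
    using lnp le by (intro divide_right_mono mult_left_mono) auto
  also have "\<dots> = G * (?d / ?l * (?n / ?E)) / ln (real p)" by simp
  also have "\<dots> \<le> G * 1 / ln (real p)"
    using lnp q G0 by (intro divide_right_mono mult_left_mono) auto
  finally show ?thesis by simp
qed

text \<open>A constant density does not notice the Galois action; only the deviation from it can
  contribute to a change of the functional.\<close>

lemma avg_log_invariant:
  assumes "a \<in> Qbar" "\<rho> \<in> Gal" "prime p"
  shows "avg (\<lambda>\<sigma>. ln (N p (\<sigma> (\<rho> a)))) = avg (\<lambda>\<sigma>. ln (N p (\<sigma> a)))"
  using avg_right_translate[OF _ _ depends_log[of a p] assms(2)] assms(1) by simp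

end

section \<open>The density at the isolating prime, its stabilizer and its bound\<close>

theorem theorem2p4:
  fixes H :: "(complex \<Rightarrow> complex) set" and x :: "nat \<Rightarrow> rat"
  assumes "subgroup H Gal_group" and "krull_open H"
  shows "(\<exists>c\<in>consistent_maps. (\<forall>p. prime p \<longrightarrow> c \<rat> (rat_place p) = of_rat (x p))
                            \<and> Stab (Phi c) = H)
       \<and> ((\<exists>B. \<forall>p. prime p \<longrightarrow> \<bar>of_rat (x p) / ln (real p)\<bar> \<le> B) \<longrightarrow>
          (\<exists>c\<in>bounded_maps. (\<forall>p. prime p \<longrightarrow> c \<rat> (rat_place p) = of_rat (x p))
                            \<and> Stab (Phi c) = H))"
proof -
  obtain \<theta> where \<theta>: "\<theta> \<in> Qbar" "\<theta> \<noteq> 0" and H: "H = {\<sigma>\<in>Gal. \<sigma> \<theta> = \<theta>}"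
    using open_subgroup_stabilizer[OF assms] by blast
  obtain p0 N0 and m :: nat where N0: "place_over Qbar p0 N0" and m: "\<theta> \<noteq> of_nat m" "N0 (\<theta> - of_nat m) < 1"
    and iso: "\<And>t. t \<in> conjs \<theta> \<Longrightarrow> t \<noteq> \<theta> \<Longrightarrow> N0 (t - of_nat m) = 1"
    using isolating_place[OF \<theta>] by metis
  have p0: "prime p0" using N0 by (simp add: place_over_def)
  define N where "N p = (if p = p0 then N0 else SOME v. place_over Qbar p v)" for p
  have N: "place_over Qbar p (N p)" if "prime p" for p
    using N0 someI_ex[OF exists_place_over_Qbar[OF that]] by (simp add: N_def)
  define ind where "ind \<sigma> = (if \<sigma> \<theta> = \<theta> then 1 else 0 :: real)" for \<sigma> :: "complex \<Rightarrow> complex"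
  \<comment> \<open>The Haar measure of H, that is, the reciprocal of its index; rationality of the
    weights relies on its being rational.\<close>
  define a where "a = avg_on {\<theta>} ind"
  define g where "g p \<sigma> = of_rat (x p) + (if p = p0 then ind \<sigma> - a else 0)" for p \<sigma>
  have ind_dep: "depends {\<theta>} ind" unfolding depends_def ind_def by simp
  have a_rat: "a \<in> \<rat>" unfolding a_def by (rule avg_on_rat) (simp add: ind_def)
  have fS: "finite {\<theta>}" "{\<theta>} \<subseteq> Qbar" using \<theta> by auto
  have a_pos: "a > 0"
  proof -
    let ?e = "restrict id {\<theta>}"
    have e: "?e \<in> Emb {\<theta>}" by (rule restrict_Emb[OF Gal_id])
    have "0 < ind (lift {\<theta>} ?e)" using depends_lift[OF ind_dep Gal_id] by (simp add: ind_def)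
    also have "\<dots> \<le> (\<Sum>e\<in>Emb {\<theta>}. ind (lift {\<theta>} e))"
      by (rule member_le_sum[OF e]) (use finite_Emb[OF fS] in \<open>auto simp: ind_def\<close>)
    finally show ?thesis using card_Emb_pos[OF fS] by (simp add: a_def avg_on_def)
  qed
  have g_dep: "depends {\<theta>} (g p)" for p
    using ind_dep unfolding depends_def g_def by metis
  interpret weights N g "{\<theta>}"
  proof unfold_locales
    show "g p \<sigma> \<in> \<rat>" if "\<sigma> \<in> Gal" for p \<sigma> using a_rat by (simp add: g_def ind_def)
  qed (use N fS g_dep in auto)
  have base: "cm \<rat> (rat_place p) = of_rat (x p)" if p: "prime p" for p
  proof -
    have "cm \<rat> (rat_place p) = avg_on {\<theta>} (g p)" using cm_Rats[OF p] avg_eq[OF fS g_dep] by simp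
    also have "g p = (\<lambda>\<sigma>. (of_rat (x p) + (if p = p0 then - a else 0)) + (if p = p0 then 1 else 0) * ind \<sigma>)"
      by (auto simp: g_def fun_eq_iff)
    also have "avg_on {\<theta>} \<dots> = of_rat (x p)"
      unfolding avg_on_add avg_on_cmult avg_on_const[OF fS] by (simp add: a_def)
    finally show ?thesis .
  qed
  define \<phi> where "\<phi> p y = avg (\<lambda>\<sigma>. g p \<sigma> * ln (N p (\<sigma> y)))" for p y
  have Phi_eq: "\<exists>P. finite P \<and> (\<forall>p\<in>P. prime p) \<and> p0 \<in> P \<and> Phi cm y = (\<Sum>p\<in>P. \<phi> p y / ln (real p)) \<and>
      Phi cm (\<rho> y) = (\<Sum>p\<in>P. \<phi> p (\<rho> y) / ln (real p))"
    if y: "y \<in> Qbar" "y \<noteq> 0" and r: "\<rho> \<in> Gal" for y \<rho>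
  proof -
    \<comment> \<open>The condition runs over the whole Galois orbit of y, so one set serves y and
      \<open>\<rho> y\<close> alike. The prime \<open>p0\<close> is inserted because its term is
      extracted from the sum later.\<close>
    define P where "P = insert p0 {p. prime p \<and> (\<exists>\<sigma>\<in>Gal. N p (\<sigma> y) \<noteq> 1)}"
    have "finite {p. prime p \<and> (\<exists>\<sigma>\<in>Gal. N p (\<sigma> y) \<noteq> 1)}"
      by (rule finite_subset[OF _ finite_nonunit_primes[OF y]]) (use N in blast)
    then have P: "finite P" "\<And>p. p \<in> P \<Longrightarrow> prime p" using p0 by (auto simp: P_def)
    have out: "N p (\<sigma> y) = 1" if "prime p" "p \<notin> P" "\<sigma> \<in> Gal" for p \<sigma> using that by (auto simp: P_def)
    have out': "N p (\<sigma> (\<rho> y)) = 1" if "prime p" "p \<notin> P" "\<sigma> \<in> Gal" for p \<sigma>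
      using out[OF that(1,2), of "\<sigma> \<circ> \<rho>"] that(3) r by simp
    have ry: "\<rho> y \<in> Qbar" "\<rho> y \<noteq> 0" using y r by (auto simp: Gal_Qbar Gal_eq_0_iff)
    have "Phi cm y = (\<Sum>p\<in>P. \<phi> p y / ln (real p))"
      unfolding \<phi>_def by (rule Phi_cm[OF y P(1)]) (use P(2) out in blast)+
    moreover have "Phi cm (\<rho> y) = (\<Sum>p\<in>P. \<phi> p (\<rho> y) / ln (real p))"
      unfolding \<phi>_def by (rule Phi_cm[OF ry P(1)]) (use P(2) out' in blast)+
    moreover have "p0 \<in> P" by (simp add: P_def)
    ultimately show ?thesis using P by blast
  qed
  have "Stab (Phi cm) = H"
  proof
    show "H \<subseteq> Stab (Phi cm)"
    proof
      fix \<rho> assume "\<rho> \<in> H"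
      then have r: "\<rho> \<in> Gal" "\<rho> \<theta> = \<theta>" by (auto simp: H)
      have "Phi cm (\<rho> y) = Phi cm y" if y: "y \<in> Qbar - {0}" for y
      proof -
        have "\<phi> p (\<rho> y) = \<phi> p y" for p
        proof -
          \<comment> \<open>The densities see an automorphism only through its value at \<theta>,
            which \<rho> fixes.\<close>
          have "g p \<sigma> = g p (\<sigma> \<circ> \<rho>)" for \<sigma> using r(2) by (simp add: g_def ind_def)
          then have "\<phi> p (\<rho> y) = avg (\<lambda>\<sigma>. g p (\<sigma> \<circ> \<rho>) * ln (N p ((\<sigma> \<circ> \<rho>) y)))" by (simp add: \<phi>_def)
          also have "\<dots> = \<phi> p y" unfolding \<phi>_def
            by (rule avg_right_translate[OF _ _ depends_weighted_log r(1)]) (use y fS in auto)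
          finally show ?thesis .
        qed
        then show ?thesis using Phi_eq[of y \<rho>] y r by auto
      qed
      then show "\<rho> \<in> Stab (Phi cm)" using r by (simp add: Stab_def)
    qed
    show "Stab (Phi cm) \<subseteq> H"
    proof
      fix \<rho> assume st: "\<rho> \<in> Stab (Phi cm)"
      then have r: "\<rho> \<in> Gal" by (simp add: Stab_def)
      show "\<rho> \<in> H"
      proof (rule ccontr)
        assume "\<rho> \<notin> H"
        then have moved: "\<rho> \<theta> \<noteq> \<theta>" using r by (simp add: H)
        define y where "y = \<theta> - of_nat m"
        have y: "y \<in> Qbar" "y \<noteq> 0" using \<theta> m by (auto simp: y_def)
        have sy: "\<sigma> y = \<sigma> \<theta> - of_nat m" if "\<sigma> \<in> Gal" for \<sigma>
          using that \<theta> by (simp add: y_def Gal_diff Gal_of_nat)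
        obtain P where P: "finite P" "\<And>p. p \<in> P \<Longrightarrow> prime p" "p0 \<in> P"
          "Phi cm y = (\<Sum>p\<in>P. \<phi> p y / ln (real p))" "Phi cm (\<rho> y) = (\<Sum>p\<in>P. \<phi> p (\<rho> y) / ln (real p))"
          using Phi_eq[OF y r] by blast
        define \<psi> where "\<psi> z = avg (\<lambda>\<sigma>. ind \<sigma> * ln (N p0 (\<sigma> z)))" for z
        \<comment> \<open>Separates the part with constant density, which agrees for y and
          \<open>\<rho> y\<close>, from the part concentrated on H.\<close>
        have split: "\<phi> p z = (of_rat (x p) - (if p = p0 then a else 0)) * avg (\<lambda>\<sigma>. ln (N p (\<sigma> z)))
            + (if p = p0 then \<psi> z else 0)" if z: "z \<in> Qbar" for p z
        proof -
          have S: "finite {z, \<theta>}" "{z, \<theta>} \<subseteq> Qbar" using z \<theta> by auto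
          have dl: "depends {z, \<theta>} (\<lambda>\<sigma>. ln (N p (\<sigma> z)))" for p by (rule depends_mono[OF depends_log]) auto
          have di: "depends {z, \<theta>} (\<lambda>\<sigma>. ind \<sigma> * ln (N p (\<sigma> z)))" for p
            unfolding depends_def ind_def by simp
          have "\<phi> p z = avg_on {z, \<theta>} (\<lambda>\<sigma>. g p \<sigma> * ln (N p (\<sigma> z)))"
            unfolding \<phi>_def by (rule avg_eq[OF S depends_weighted_log])
          also have "(\<lambda>\<sigma>. g p \<sigma> * ln (N p (\<sigma> z))) = (\<lambda>\<sigma>. (of_rat (x p) - (if p = p0 then a else 0)) * ln (N p (\<sigma> z))
              + (if p = p0 then 1 else 0) * (ind \<sigma> * ln (N p (\<sigma> z))))"
            by (auto simp: g_def fun_eq_iff algebra_simps)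
          also have "avg_on {z, \<theta>} \<dots> = (of_rat (x p) - (if p = p0 then a else 0)) * avg (\<lambda>\<sigma>. ln (N p (\<sigma> z)))
              + (if p = p0 then \<psi> z else 0)"
            unfolding avg_on_add avg_on_cmult avg_eq[OF S dl] \<psi>_def avg_eq[OF S di] by simp
          finally show ?thesis .
        qed
        have ry: "\<rho> y \<in> Qbar" using y r by (simp add: Gal_Qbar)
        have diff: "\<phi> p (\<rho> y) - \<phi> p y = (if p = p0 then \<psi> (\<rho> y) - \<psi> y else 0)" if "p \<in> P" for p
          unfolding split[OF ry] split[OF y(1)] avg_log_invariant[OF y(1) r P(2)[OF that]] by simp
        have "Phi cm (\<rho> y) = Phi cm y" using st y by (simp add: Stab_def)
        then have "0 = (\<Sum>p\<in>P. (\<phi> p (\<rho> y) - \<phi> p y) / ln (real p))"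
          using P(4,5) by (simp add: sum_subtractf diff_divide_distrib)
        also have "\<dots> = (\<Sum>p\<in>P. if p = p0 then (\<psi> (\<rho> y) - \<psi> y) / ln (real p0) else 0)"
          by (intro sum.cong) (auto simp: diff)
        also have "\<dots> = (\<psi> (\<rho> y) - \<psi> y) / ln (real p0)" using P(1,3) by simp
        finally have "\<psi> (\<rho> y) = \<psi> y" using prime_gt_1_nat[OF p0] by simp
        moreover have "\<psi> y = a * ln (N0 y)"
        proof -
          have "depends {y, \<theta>} (\<lambda>\<sigma>. ind \<sigma> * ln (N p0 (\<sigma> y)))" unfolding depends_def ind_def by simp
          then have "\<psi> y = avg_on {y, \<theta>} (\<lambda>\<sigma>. ind \<sigma> * ln (N p0 (\<sigma> y)))"
            unfolding \<psi>_def using y \<theta> by (intro avg_eq) auto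
          \<comment> \<open>Where the indicator is non-zero, \<sigma> fixes \<theta> and hence y, so
            the logarithm is constant there.\<close>
          also have "\<dots> = avg_on {y, \<theta>} (\<lambda>\<sigma>. ln (N0 y) * ind \<sigma>)"
            by (rule avg_on_cong) (auto simp: ind_def sy N_def y_def[symmetric])
          also have "\<dots> = ln (N0 y) * a"
            unfolding avg_on_cmult a_def using avg_on_mono_set[OF _ _ _ ind_dep, of "{y, \<theta>}"] y \<theta> by simp
          finally show ?thesis by simp
        qed
        moreover have "\<psi> (\<rho> y) = 0"
        proof -
          have S: "finite {\<rho> y, \<theta>}" "{\<rho> y, \<theta>} \<subseteq> Qbar" using ry \<theta> by auto
          have "depends {\<rho> y, \<theta>} (\<lambda>\<sigma>. ind \<sigma> * ln (N p0 (\<sigma> (\<rho> y))))" unfolding depends_def ind_def by simp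
          then have "\<psi> (\<rho> y) = avg_on {\<rho> y, \<theta>} (\<lambda>\<sigma>. ind \<sigma> * ln (N p0 (\<sigma> (\<rho> y))))"
            unfolding \<psi>_def by (rule avg_eq[OF S])
          also have "\<dots> = avg_on {\<rho> y, \<theta>} (\<lambda>\<sigma>. 0)"
          proof (rule avg_on_cong)
            fix \<sigma> assume s: "\<sigma> \<in> Gal"
            show "ind \<sigma> * ln (N p0 (\<sigma> (\<rho> y))) = 0"
            proof (cases "\<sigma> \<theta> = \<theta>")
              case True
              \<comment> \<open>By injectivity \<sigma>, which fixes \<theta>, cannot send another
                conjugate to it. The image is therefore one of the conjugates at which m was chosen
                to give a unit.\<close>
              have "\<sigma> (\<rho> \<theta>) \<noteq> \<theta>" using moved Gal_inj[OF s, of "\<rho> \<theta>" \<theta>] True by simp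
              moreover have "\<sigma> (\<rho> \<theta>) \<in> conjs \<theta>"
                unfolding Gal_conjs_iff[OF s] Gal_conjs_iff[OF r] by simp
              ultimately have "N0 (\<sigma> (\<rho> \<theta>) - of_nat m) = 1" using iso by blast
              moreover have "\<sigma> (\<rho> y) = \<sigma> (\<rho> \<theta>) - of_nat m" using sy[of "\<sigma> \<circ> \<rho>"] s r by simp
              ultimately show ?thesis by (simp add: N_def)
            qed (simp add: ind_def)
          qed
          also have "\<dots> = 0" by (rule avg_on_const[OF S])
          finally show ?thesis .
        qed
        ultimately have "a * ln (N0 y) = 0" by simp
        moreover have "ln (N0 y) < 0"
          using place_pos[OF csubfield_Qbar N0 y] m(2) by (simp add: y_def)
        ultimately show False using a_pos by simp
      qed
    qed
  qed
  then have main: "(\<forall>p. prime p \<longrightarrow> cm \<rat> (rat_place p) = of_rat (x p)) \<and> Stab (Phi cm) = H" using base by blast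
  have "cm \<in> bounded_maps" if "\<exists>B. \<forall>p. prime p \<longrightarrow> \<bar>of_rat (x p) / ln (real p)\<bar> \<le> B"
  proof -
    from that obtain B where B: "\<And>p. prime p \<Longrightarrow> \<bar>of_rat (x p) / ln (real p)\<bar> \<le> B" by blast
    \<comment> \<open>The deviation from \<open>x p\<close> is at most 1 plus the absolute value of
      a, and it occurs only at \<open>p0\<close>; its contribution is a fixed constant added to
      B.\<close>
    have "\<bar>real (nf_degree K) / real (local_degree K v) * (cm K v / ln (real (place_prime v)))\<bar>
        \<le> B + (1 + \<bar>a\<bar>) / ln (real p0)" if Kv: "number_field K" "nonarch_place K v" for K v
    proof -
      let ?p = "place_prime v"
      have v: "place_over K ?p v" by (rule nonarch_place_over[OF Kv(2)])
      have p: "prime ?p" using v by (simp add: place_over_def)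
      have lnp: "ln (real ?p) > 0" "ln (real p0) > 0" using prime_gt_1_nat[OF p] prime_gt_1_nat[OF p0] by simp_all
      let ?G = "\<bar>of_rat (x ?p)\<bar> + (if ?p = p0 then 1 + \<bar>a\<bar> else 0)"
      have est: "\<bar>r + (if b then i - a else 0)\<bar> \<le> \<bar>r\<bar> + (if b then 1 + \<bar>a\<bar> else 0)"
        if "i = 0 \<or> i = 1" for r i :: real and b
        using that by auto
      have "\<bar>g ?p \<sigma>\<bar> \<le> ?G" for \<sigma> unfolding g_def by (rule est) (simp add: ind_def)
      from cm_abs_bound[OF Kv(1) v this]
      have "\<bar>real (nf_degree K) / real (local_degree K v) * (cm K v / ln (real ?p))\<bar> \<le> ?G / ln (real ?p)" .
      also have "\<dots> = \<bar>of_rat (x ?p) / ln (real ?p)\<bar> + (if ?p = p0 then (1 + \<bar>a\<bar>) / ln (real p0) else 0)"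
        using lnp by (auto simp: add_divide_distrib)
      also have "\<dots> \<le> B + (1 + \<bar>a\<bar>) / ln (real p0)" using B[OF p] lnp by (intro add_mono) auto
      finally show ?thesis .
    qed
    then show ?thesis using cm_consistent unfolding bounded_maps_def by blast
  qed
  then show ?thesis using main cm_consistent by blast
qed

end
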